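(* Let $m(t),n(t)\colon\mathbb{Z}_{>0}\to\mathbb{Z}_{>0}$ be functions satisfying $n(t)\to\infty$ as $t\to\infty$ and $1<m(t)\le\frac{n(t)^2+n(t)}{2}$. Writing $m=m(t)$ and $n=n(t)$, we have, as $t\to\infty$, $$(1+o(1))\log\left(n^m\binom{mn}{n}\right)\le\log|\mathcal{D}_n^m|\le(1+o(1))\log\left(n^{2m}\binom{mn}{n}\right).$$
   Context: For a polynomial $P\in\mathbb{C}[x]$ of degree exactly $n$ and an $m$-tuple $\Lambda=(\lambda_1,\ldots,\lambda_m)$ of distinct complex numbers, the dope matrix $D_P(\Lambda)$ is the $m\times(n+1)$ matrix $(c_{ij})$, with $i\in\{1,\ldots,m\}$ and $j\in\{0,1,\ldots,n\}$, where $c_{ij}=1$ if $P^{(j)}(\lambda_i)=0$ and $c_{ij}=0$ otherwise. $\mathcal{D}_n^m$ denotes the set of all $m\times(n+1)$ dope matrices, i.e. all matrices $D_P(\Lambda)$ with $\deg P=n$ and $\Lambda$ any $m$-tuple of distinct complex numbers. The notation $o(1)$ denotes a function of $t$ tending to $0$ as $t\to\infty$; $\log$ is the natural logarithm. *)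

theory Defs
  imports
    "HOL-Computational_Algebra.Polynomial"
    "Jordan_Normal_Form.Matrix"
    Complex_Main
begin

text \<open>
  Tuples of points are lists, so row indices run over \<open>0, \<dots>, m - 1\<close> instead of
  \<open>1, \<dots>, m\<close>; column \<open>j\<close> records the vanishing of the \<open>j\<close>-th derivative, \<open>j = 0, \<dots>, n\<close>.
\<close>

definition dope_matrix :: "complex poly \<Rightarrow> complex list \<Rightarrow> nat mat" where
  "dope_matrix P \<Lambda> =
     mat (length \<Lambda>) (degree P + 1)
       (\<lambda>(i, j). if poly ((pderiv ^^ j) P) (\<Lambda> ! i) = 0 then 1 else 0)"

text \<open>
  The condition \<open>P \<noteq> 0\<close> only matters for \<open>n = 0\<close>, since the library sets \<open>degree 0 = 0\<close>.
\<close>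

definition dope_matrices :: "nat \<Rightarrow> nat \<Rightarrow> nat mat set" where
  "dope_matrices m n =
     {dope_matrix P \<Lambda> | P \<Lambda>. P \<noteq> 0 \<and> degree P = n \<and> length \<Lambda> = m \<and> distinct \<Lambda>}"

end

theory Submission
  imports
    Defs
    "Jordan_Normal_Form.Determinant"
    "HOL-Library.FuncSet"
    "HOL-Computational_Algebra.Fundamental_Theorem_Algebra"
    "HOL-Real_Asymp.Real_Asymp"
begin

text \<open>
  A dope matrix is the zero pattern of the \<open>m n\<close> expressions \<open>P\<^sup>(\<^sup>j\<^sup>)(\<lambda>\<^sub>i)\<close> with \<open>j < n\<close>, because
  the derivative of order \<open>n\<close> is a nonzero constant.

  \<^emph>\<open>Upper bound.\<close> Fix a pair \<open>(\<Lambda>, P)\<close> for every pattern, and let \<open>f\<^sub>A\<close> be the product of the expressions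
  that the pattern declares to be nonzero, \<open>A\<close> being the set of their positions. At the pair
  of a pattern with nonzero set \<open>B\<close>, the function \<open>f\<^sub>A\<close> is nonzero exactly if \<open>A \<subseteq> B\<close>, so the \<open>f\<^sub>A\<close> are linearly
  independent and their number is at most the dimension of their span (the argument of
  Ronyai, Babai and Ganapathy). To see a binomial coefficient of \<open>m n\<close> rather than of \<open>m n + n\<close>, the
  variables are treated differently. For fixed \<open>\<Lambda>\<close>, the \<open>f\<^sub>A\<close> are products of distinct members of a list of
  \<open>m n\<close> linear forms in the \<open>n + 1\<close> coefficients of \<open>P\<close>, and such products span a space
  of dimension at most \<open>\<Sum>k\<le>n+1. m n choose k\<close>, by deletion and restriction of hyperplanes
  (\<open>line_bounded_unisolvent\<close>). One and the same finite set of polynomials \<open>P\<close> is enough to test the vanishing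
  of combinations for almost all \<open>\<Lambda>\<close>, and on it a combination is a polynomial of degree at most
  \<open>n (n + 1) / 2\<close> in each \<open>\<lambda>\<^sub>i\<close>. This gives \<open>card_dope_matrices_le\<close>, where the sum exceeds
  \<open>m n choose n\<close> by a factor of at most \<open>(n + 2) m\<close>, and \<open>n (n + 1) / 2 + 1 \<le> n ^ 2\<close>.

  \<^emph>\<open>Lower bound, few points.\<close> If \<open>m \<le> sqrt n\<close>, then \<open>n ^ m\<close> is negligible. Let \<open>S\<close> be a set of \<open>n\<close> positions with
  at least \<open>l\<close> positions of order below \<open>l\<close>, for every \<open>l\<close> (the Polya condition). Birkhoff interpolation
  at generic points is solvable for such sets (\<open>generic_birkhoff\<close>), and this applies to \<open>S\<close> and
  also to \<open>S\<close> with any further position. Hence the polynomial \<open>P\<close> of degree \<open>n\<close> that vanishes at \<open>S\<close> vanishes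
  nowhere else (\<open>exact_pattern_realizable\<close>). A cyclic shift of the orders turns every set of \<open>n\<close>
  positions into one with the Polya condition, so there are at least \<open>(m n choose n) / n\<close> of them.

  \<^emph>\<open>Lower bound, many points.\<close> If \<open>m \<longrightarrow> \<infinity>\<close>, the logarithm of \<open>m n choose n\<close> is that of \<open>m ^ n\<close> up to lower
  order. Write \<open>n = a + k\<close>. One vanishing condition for each order \<open>j < a\<close>, at any of \<open>m1\<close> points,
  gives \<open>m1 ^ a\<close> choices, and leaves the derivative \<open>U\<close> of order \<open>a\<close> free. Taking \<open>U\<close> of degree \<open>k\<close> such
  that all of its derivatives have simple roots and no common roots, one may place \<open>m2\<close> further points
  on these \<open>k (k + 1) / 2\<close> roots. Distinguishing only the orders of the derivatives
  to which these roots belong, this gives at least \<open>((k (k + 1) / 2 - m2) / k) ^ m2\<close> different patterns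
  (\<open>two_parts_le_card_dope_matrices\<close>, \<open>card_bounded_words_ge\<close>). For \<open>m\<close> up to \<open>n sqrt n\<close> one takes \<open>k\<close> and \<open>m1\<close> to be small multiples of
  \<open>n\<close> and \<open>m\<close>; beyond that only \<open>n ^ m\<close> matters, and \<open>k = n\<close>, \<open>m1 = 0\<close>.
\<close>

hide_const (open) Module.smult

section \<open>Generic tuples of points\<close>

definition poly_fun :: "('a::comm_ring_1 \<Rightarrow> 'a) \<Rightarrow> bool" where
  "poly_fun f \<longleftrightarrow> (\<exists>p. f = poly p)"

lemma poly_fun_const [simp]: "poly_fun (\<lambda>s. c)"
  unfolding poly_fun_def by (intro exI[of _ "[:c:]"]) auto

lemma poly_fun_poly [simp]: "poly_fun (poly p)"
  unfolding poly_fun_def by auto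

lemma poly_fun_add: "poly_fun f \<Longrightarrow> poly_fun g \<Longrightarrow> poly_fun (\<lambda>s. f s + g s)"
  unfolding poly_fun_def by (auto simp: fun_eq_iff simp flip: poly_add)

lemma poly_fun_mult: "poly_fun f \<Longrightarrow> poly_fun g \<Longrightarrow> poly_fun (\<lambda>s. f s * g s)"
  unfolding poly_fun_def by (auto simp: fun_eq_iff simp flip: poly_mult)

lemma poly_fun_sum: "(\<And>x. x \<in> A \<Longrightarrow> poly_fun (f x)) \<Longrightarrow> poly_fun (\<lambda>s. \<Sum>x\<in>A. f x s)"
  by (induction A rule: infinite_finite_induct) (auto intro: poly_fun_add)

lemma poly_fun_prod: "(\<And>x. x \<in> A \<Longrightarrow> poly_fun (f x)) \<Longrightarrow> poly_fun (\<lambda>s. \<Prod>x\<in>A. f x s)"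
  by (induction A rule: infinite_finite_induct) (auto intro: poly_fun_mult)

text \<open>
  A substitute for polynomials in the coordinates of \<open>\<Lambda>\<close>: only the restrictions to lines are ever used.
\<close>

definition line_poly :: "((nat \<Rightarrow> complex) \<Rightarrow> complex) \<Rightarrow> bool" where
  "line_poly F \<longleftrightarrow> (\<forall>\<Lambda> \<Lambda>'. poly_fun (\<lambda>s. F (\<lambda>i. \<Lambda> i + s * \<Lambda>' i)))"

lemma line_poly_const [simp]: "line_poly (\<lambda>\<Lambda>. c)"
  by (auto simp: line_poly_def)

lemma line_poly_poly [simp]: "line_poly (\<lambda>\<Lambda>. poly p (\<Lambda> i))"
  unfolding line_poly_def
proof (intro allI)
  fix \<Lambda> \<Lambda>' :: "nat \<Rightarrow> complex"
  have "(\<lambda>s. poly p (\<Lambda> i + s * \<Lambda>' i)) = poly (pcompose p [:\<Lambda> i, \<Lambda>' i:])"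
    by (auto simp: poly_pcompose)
  then show "poly_fun (\<lambda>s. poly p (\<Lambda> i + s * \<Lambda>' i))" by simp
qed

lemma line_poly_coord [simp]: "line_poly (\<lambda>\<Lambda>. \<Lambda> i)"
  using line_poly_poly[of "[:0,1:]" i] by simp

lemma line_poly_add: "line_poly F \<Longrightarrow> line_poly G \<Longrightarrow> line_poly (\<lambda>\<Lambda>. F \<Lambda> + G \<Lambda>)"
  by (auto simp: line_poly_def intro: poly_fun_add)

lemma line_poly_mult: "line_poly F \<Longrightarrow> line_poly G \<Longrightarrow> line_poly (\<lambda>\<Lambda>. F \<Lambda> * G \<Lambda>)"
  by (auto simp: line_poly_def intro: poly_fun_mult)

lemma line_poly_diff: "line_poly F \<Longrightarrow> line_poly G \<Longrightarrow> line_poly (\<lambda>\<Lambda>. F \<Lambda> - G \<Lambda>)"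
  using line_poly_add[of F "\<lambda>\<Lambda>. -1 * G \<Lambda>"] line_poly_mult[OF line_poly_const[of "-1"], of G] by simp

lemma line_poly_sum: "(\<And>x. x \<in> A \<Longrightarrow> line_poly (F x)) \<Longrightarrow> line_poly (\<lambda>\<Lambda>. \<Sum>x\<in>A. F x \<Lambda>)"
  by (auto simp: line_poly_def intro!: poly_fun_sum)

lemma line_poly_prod: "(\<And>x. x \<in> A \<Longrightarrow> line_poly (F x)) \<Longrightarrow> line_poly (\<lambda>\<Lambda>. \<Prod>x\<in>A. F x \<Lambda>)"
  by (auto simp: line_poly_def intro!: poly_fun_prod)

lemma line_poly_det:
  assumes "\<And>i j. i < n \<Longrightarrow> j < n \<Longrightarrow> line_poly (A i j)"
  shows "line_poly (\<lambda>\<Lambda>. det (mat n n (\<lambda>(i, j). A i j \<Lambda>)))"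
proof -
  have "line_poly (\<lambda>\<Lambda>. \<Sum>p | p permutes {0..<n}. signof p * (\<Prod>i = 0..<n. A i (p i) \<Lambda>))"
    by (intro line_poly_sum line_poly_mult line_poly_prod line_poly_const)
       (auto intro!: assms simp: permutes_in_image)
  moreover have "det (mat n n (\<lambda>(i, j). A i j \<Lambda>)) =
      (\<Sum>p | p permutes {0..<n}. signof p * (\<Prod>i = 0..<n. A i (p i) \<Lambda>))" for \<Lambda>
    by (subst det_def'[of _ n]) (auto intro!: sum.cong prod.cong simp: permutes_in_image)
  ultimately show ?thesis by simp
qed

text \<open>
  Genericity in the sense of Zariski, with functions that are polynomial on lines in the role of polynomials. Its use is
  that finitely many generic conditions can be met by one \<open>\<Lambda>\<close>.
\<close>

definition generic :: "((nat \<Rightarrow> complex) \<Rightarrow> bool) \<Rightarrow> bool" where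
  "generic G \<longleftrightarrow> (\<exists>F. line_poly F \<and> (\<exists>\<Lambda>. F \<Lambda> \<noteq> 0) \<and> (\<forall>\<Lambda>. F \<Lambda> \<noteq> 0 \<longrightarrow> G \<Lambda>))"

lemma genericI: "line_poly F \<Longrightarrow> F \<Lambda> \<noteq> 0 \<Longrightarrow> generic (\<lambda>\<Lambda>. F \<Lambda> \<noteq> 0)"
  by (auto simp: generic_def)

lemma generic_mono: "generic G \<Longrightarrow> (\<And>\<Lambda>. G \<Lambda> \<Longrightarrow> H \<Lambda>) \<Longrightarrow> generic H"
  unfolding generic_def by blast

lemma generic_True [simp]: "generic (\<lambda>_. True)"
  unfolding generic_def by (intro exI[of _ "\<lambda>_. 1"]) auto

text \<open>
  On the line through a point of the first open set and a point of the second one, each of the two polynomials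
  has only finitely many zeros.
\<close>

lemma generic_conj:
  assumes "generic G" "generic H"
  shows "generic (\<lambda>\<Lambda>. G \<Lambda> \<and> H \<Lambda>)"
proof -
  obtain F \<Lambda>0 where F: "line_poly F" "F \<Lambda>0 \<noteq> 0" "\<And>\<Lambda>. F \<Lambda> \<noteq> 0 \<Longrightarrow> G \<Lambda>"
    using assms(1) by (auto simp: generic_def)
  obtain E \<Lambda>1 where E: "line_poly E" "E \<Lambda>1 \<noteq> 0" "\<And>\<Lambda>. E \<Lambda> \<noteq> 0 \<Longrightarrow> H \<Lambda>"
    using assms(2) by (auto simp: generic_def)
  define L where "L = (\<lambda>s i. \<Lambda>0 i + s * (\<Lambda>1 i - \<Lambda>0 i))"
  obtain p where p: "(\<lambda>s. F (L s)) = poly p"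
    using F(1) unfolding line_poly_def poly_fun_def L_def by metis
  obtain q where q: "(\<lambda>s. E (L s)) = poly q"
    using E(1) unfolding line_poly_def poly_fun_def L_def by metis
  have "poly p 0 \<noteq> 0" using F(2) p[THEN fun_cong, of 0] by (simp add: L_def)
  moreover have "poly q 1 \<noteq> 0" using E(2) q[THEN fun_cong, of 1] by (simp add: L_def)
  ultimately have "p * q \<noteq> 0" by auto
  then obtain s where "poly (p * q) s \<noteq> 0" using poly_all_0_iff_0 by blast
  then have "F (L s) * E (L s) \<noteq> 0" using p[THEN fun_cong, of s] q[THEN fun_cong, of s] by simp
  then show ?thesis
    unfolding generic_def using F(1,3) E(1,3)
    by (intro exI[of _ "\<lambda>\<Lambda>. F \<Lambda> * E \<Lambda>"]) (auto intro: line_poly_mult)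
qed

lemma generic_ball:
  assumes "finite A" "\<And>x. x \<in> A \<Longrightarrow> generic (G x)"
  shows "generic (\<lambda>\<Lambda>. \<forall>x\<in>A. G x \<Lambda>)"
  using assms by (induction A rule: finite_induct) (auto intro: generic_conj)

lemma generic_ex: "generic G \<Longrightarrow> \<exists>\<Lambda>. G \<Lambda>"
  by (auto simp: generic_def)

text \<open>
  Nonempty Zariski open sets are dense.
\<close>

lemma line_poly_zero_if_generic:
  assumes "line_poly F" "generic G" "\<And>\<Lambda>. G \<Lambda> \<Longrightarrow> F \<Lambda> = 0"
  shows "F \<Lambda> = 0"
  using generic_ex[OF generic_conj[OF assms(2) genericI[OF assms(1), of \<Lambda>]]] assms(3) by auto

lemma generic_inj_on: "generic (\<lambda>\<Lambda>. inj_on \<Lambda> {..<m})"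
proof -
  have "generic (\<lambda>\<Lambda>. \<Lambda> i - \<Lambda> j \<noteq> 0)" if "i \<noteq> j" for i j
    using that genericI[of "\<lambda>\<Lambda>. \<Lambda> i - \<Lambda> j" "\<lambda>l. if l = i then 1 else 0"]
    by (simp add: line_poly_diff del: right_minus_eq)
  then have "generic (\<lambda>\<Lambda>. \<forall>x\<in>{(i, j). i < m \<and> j < m \<and> i \<noteq> j}. \<Lambda> (fst x) - \<Lambda> (snd x) \<noteq> 0)"
    by (intro generic_ball) (auto intro: finite_subset[of _ "{..<m} \<times> {..<m}"])
  then show ?thesis
    by (rule generic_mono) (force simp: inj_on_def)
qed

text \<open>
  Zariski openness of injectivity. There may be more rows than columns, so that no single minor is at hand; the
  determinant of a product with the adjoint matrix takes its place.
\<close>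

lemma generic_injective:
  fixes M :: "'t \<Rightarrow> nat \<Rightarrow> (nat \<Rightarrow> complex) \<Rightarrow> complex"
  assumes "finite T" and M: "\<And>t q. t \<in> T \<Longrightarrow> q < N \<Longrightarrow> line_poly (M t q)"
    and inj: "\<And>v. (\<And>t. t \<in> T \<Longrightarrow> (\<Sum>q<N. M t q \<Lambda>0 * v q) = 0) \<Longrightarrow> \<forall>q<N. v q = 0"
  shows "generic (\<lambda>\<Lambda>. \<forall>v. (\<forall>t\<in>T. (\<Sum>q<N. M t q \<Lambda> * v q) = 0) \<longrightarrow> (\<forall>q<N. v q = 0))"
proof -
  \<comment> \<open>The matrix \<open>M(\<Lambda>0)\<^sup>* M(\<Lambda>)\<close> is square, and at \<open>\<Lambda>0\<close> it is a nonsingular Gram matrix.\<close>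
  define A where "A = (\<lambda>\<Lambda>. mat N N (\<lambda>(p, q). \<Sum>t\<in>T. cnj (M t p \<Lambda>0) * M t q \<Lambda>))"
  have A [simp]: "A \<Lambda> \<in> carrier_mat N N" for \<Lambda> by (simp add: A_def)
  have lp: "line_poly (\<lambda>\<Lambda>. det (A \<Lambda>))"
    unfolding A_def by (intro line_poly_det line_poly_sum line_poly_mult) (auto intro: M)
  have Av: "(A \<Lambda> *\<^sub>v vec N v) $ p = (\<Sum>t\<in>T. cnj (M t p \<Lambda>0) * (\<Sum>q<N. M t q \<Lambda> * v q))"
    if "p < N" for \<Lambda> v p
  proof -
    have "(A \<Lambda> *\<^sub>v vec N v) $ p = (\<Sum>q<N. \<Sum>t\<in>T. cnj (M t p \<Lambda>0) * M t q \<Lambda> * v q)"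
      using that by (simp add: A_def scalar_prod_def sum_distrib_right lessThan_atLeast0)
    also have "\<dots> = (\<Sum>t\<in>T. \<Sum>q<N. cnj (M t p \<Lambda>0) * M t q \<Lambda> * v q)" by (rule sum.swap)
    finally show ?thesis by (simp add: sum_distrib_left mult.assoc)
  qed
  have "det (A \<Lambda>0) \<noteq> 0"
  proof
    assume "det (A \<Lambda>0) = 0"
    then obtain w where w: "w \<in> carrier_vec N" "w \<noteq> 0\<^sub>v N" "A \<Lambda>0 *\<^sub>v w = 0\<^sub>v N"
      using det_0_iff_vec_prod_zero[OF A] by blast
    define v where "v = (\<lambda>q. w $ q)"
    have wv: "w = vec N v" using w(1) by (auto simp: v_def)
    define y where "y = (\<lambda>t. \<Sum>q<N. M t q \<Lambda>0 * v q)"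
    have "0 = (\<Sum>p<N. cnj (v p) * (A \<Lambda>0 *\<^sub>v w) $ p)" using w(3) by simp
    also have "\<dots> = (\<Sum>p<N. \<Sum>t\<in>T. cnj (M t p \<Lambda>0 * v p) * y t)"
      unfolding wv by (intro sum.cong refl) (simp add: Av y_def sum_distrib_left ac_simps)
    also have "\<dots> = (\<Sum>t\<in>T. cnj (y t) * y t)"
      by (subst sum.swap) (simp add: y_def sum_distrib_right)
    also have "\<dots> = (\<Sum>t\<in>T. of_real ((cmod (y t))\<^sup>2))"
      by (intro sum.cong refl, subst complex_norm_square) simp
    finally have "(\<Sum>t\<in>T. (cmod (y t))\<^sup>2) = 0"
      by (metis of_real_eq_0_iff of_real_sum)
    then have "\<forall>t\<in>T. y t = 0" using \<open>finite T\<close> by (simp add: sum_nonneg_eq_0_iff)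
    then have "\<forall>q<N. v q = 0" using inj[of v] by (simp add: y_def)
    then have "w = 0\<^sub>v N" unfolding wv by auto
    then show False using w by simp
  qed
  then have "generic (\<lambda>\<Lambda>. det (A \<Lambda>) \<noteq> 0)" using genericI[OF lp] by blast
  then show ?thesis
  proof (rule generic_mono, intro allI impI)
    fix \<Lambda> v q
    assume d: "det (A \<Lambda>) \<noteq> 0" and z: "\<forall>t\<in>T. (\<Sum>q<N. M t q \<Lambda> * v q) = 0" and "q < N"
    have "A \<Lambda> *\<^sub>v vec N v = 0\<^sub>v N"
    proof (rule eq_vecI)
      fix p assume "p < dim_vec (0\<^sub>v N :: complex vec)"
      then have p: "p < N" by simp
      show "(A \<Lambda> *\<^sub>v vec N v) $ p = 0\<^sub>v N $ p"
        using p z by (subst Av[OF p]) simp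
    qed (simp add: A_def)
    then have "vec N v = 0\<^sub>v N"
      using d det_0_iff_vec_prod_zero[OF A] by (metis vec_carrier)
    then show "v q = 0" using \<open>q < N\<close> by (metis index_vec index_zero_vec(1))
  qed
qed

section \<open>Underdetermined systems\<close>

lemma underdetermined_system:
  fixes a :: "'j \<Rightarrow> 'i \<Rightarrow> 'f::field"
  assumes "finite J" "finite I" "card J < card I"
  shows "\<exists>c. (\<exists>i\<in>I. c i \<noteq> 0) \<and> (\<forall>j\<in>J. (\<Sum>i\<in>I. c i * a j i) = 0)"
  using assms
proof (induction J arbitrary: I a rule: finite_induct)
  case empty
  then show ?case by (intro exI[of _ "\<lambda>_. 1"]) (auto simp: card_gt_0_iff)
next
  case (insert j0 J)
  show ?case
  proof (cases "\<forall>i\<in>I. a j0 i = 0")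
    case True
    then show ?thesis using insert.IH[of I a] insert.prems insert.hyps by auto
  next
    case False
    then obtain i0 where i0: "i0 \<in> I" "a j0 i0 \<noteq> 0" by blast
    \<comment> \<open>Gaussian elimination with pivot \<open>a j0 i0\<close>.\<close>
    define b where "b = (\<lambda>j i. a j i - a j0 i / a j0 i0 * a j i0)"
    have "card J < card (I - {i0})" using insert.prems insert.hyps i0 by auto
    then obtain c where c: "\<exists>i\<in>I - {i0}. c i \<noteq> 0"
      "\<And>j. j \<in> J \<Longrightarrow> (\<Sum>i\<in>I - {i0}. c i * b j i) = 0"
      using insert.IH[of "I - {i0}" b] insert.prems by auto
    define d where "d = c(i0 := - (\<Sum>i\<in>I - {i0}. c i * a j0 i) / a j0 i0)"
    have split: "(\<Sum>i\<in>I. d i * a j i) = d i0 * a j i0 + (\<Sum>i\<in>I - {i0}. c i * a j i)" for j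
      using insert.prems i0 by (subst sum.remove[of _ i0]) (auto simp: d_def)
    have "(\<Sum>i\<in>I. d i * a j0 i) = 0" using i0 by (subst split) (simp add: d_def)
    moreover have "(\<Sum>i\<in>I. d i * a j i) = 0" if "j \<in> J" for j
      using c(2)[OF that] i0
      by (subst split)
         (simp add: d_def b_def algebra_simps sum_subtractf sum_distrib_left sum_divide_distrib)
    moreover have "\<exists>i\<in>I. d i \<noteq> 0" using c(1) by (auto simp: d_def)
    ultimately show ?thesis by (intro exI[of _ d]) auto
  qed
qed

section \<open>Two-point interpolation with gaps\<close>

lemma rolle_zero_count:
  fixes q :: "real poly"
  assumes "finite S" "\<And>x. x \<in> S \<Longrightarrow> poly q x = 0"
  shows "\<exists>Z. finite Z \<and> (\<forall>z\<in>Z. poly (pderiv q) z = 0 \<and> (\<exists>a\<in>S. \<exists>b\<in>S. a < z \<and> z < b))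
    \<and> card S \<le> card Z + 1"
  using assms
proof (induction S rule: finite_linorder_max_induct)
  case empty
  then show ?case by (intro exI[of _ "{}"]) auto
next
  case (insert b A)
  then obtain Z where Z: "finite Z" "card A \<le> card Z + 1"
    "\<forall>z\<in>Z. poly (pderiv q) z = 0 \<and> (\<exists>a\<in>A. \<exists>b\<in>A. a < z \<and> z < b)" by auto
  show ?case
  proof (cases "A = {}")
    case True
    then show ?thesis by (intro exI[of _ "{}"]) auto
  next
    case False
    define a where "a = Max A"
    have a: "a \<in> A" "\<And>x. x \<in> A \<Longrightarrow> x \<le> a" using False insert.hyps(1) by (auto simp: a_def)
    then have "a < b" using insert.hyps by auto
    then obtain x where x: "a < x" "x < b" "poly q b - poly q a = (b - a) * poly (pderiv q) x"
      using poly_MVT by blast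
    then have x0: "poly (pderiv q) x = 0" using a(1) insert.prems by auto
    have "x \<notin> Z" using Z(3) a x(1) by force
    moreover have "b \<notin> A" using insert.hyps by auto
    ultimately have "card (insert b A) \<le> card (insert x Z) + 1" using Z insert.hyps by simp
    moreover have "\<forall>z\<in>insert x Z. poly (pderiv q) z = 0 \<and>
        (\<exists>a\<in>insert b A. \<exists>c\<in>insert b A. a < z \<and> z < c)"
    proof
      fix z assume "z \<in> insert x Z"
      then consider "z = x" | "z \<in> Z" by blast
      then show "poly (pderiv q) z = 0 \<and> (\<exists>a\<in>insert b A. \<exists>c\<in>insert b A. a < z \<and> z < c)"
      proof cases
        case 1
        then show ?thesis using x x0 a(1) by auto
      next
        case 2
        then show ?thesis using Z(3) by (meson insertI2)
      qed
    qed
    ultimately show ?thesis using Z(1) by (intro exI[of _ "insert x Z"]) simp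
  qed
qed

lemma card_Int_lessThan_Suc:
  "card (A \<inter> {..<Suc k}) = card (A \<inter> {..<k}) + (if k \<in> A then 1 else 0)"
proof -
  have "A \<inter> {..<Suc k} = (if k \<in> A then insert k (A \<inter> {..<k}) else A \<inter> {..<k})"
    by (auto simp: less_Suc_eq)
  then show ?thesis by auto
qed

text \<open>
  Polya's theorem on interpolation at the points \<open>0\<close> (orders in \<open>A\<close>) and \<open>1\<close> (orders in \<open>B\<close>). The conditions
  of order below \<open>k\<close> leave, after \<open>k\<close> applications of Rolle's theorem, enough zeros for every derivative of order
  less than \<open>N\<close> to vanish somewhere. But if \<open>g\<close> is nonzero, one of these derivatives is a nonzero constant.
\<close>

lemma two_point_real:
  fixes g :: "real poly"
  assumes deg: "\<And>p. p \<ge> N \<Longrightarrow> coeff g p = 0"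
    and A: "\<And>k. k \<in> A \<Longrightarrow> coeff g k = 0"
    and B: "\<And>k. k \<in> B \<Longrightarrow> poly ((pderiv ^^ k) g) 1 = 0"
    and polya: "\<And>k. k \<le> N \<Longrightarrow> k \<le> card (A \<inter> {..<k}) + card (B \<inter> {..<k})"
  shows "g = 0"
proof (rule ccontr)
  assume "g \<noteq> 0"
  \<comment> \<open>Rolle's theorem passes zeros of each derivative in \<open>[0, 1]\<close> on to the next one,
    while the prescribed zeros at the two end points come in addition.\<close>
  have zeros: "\<exists>Z. finite Z \<and> Z \<subseteq> {0<..<1} \<and> (\<forall>z\<in>Z. poly ((pderiv ^^ k) g) z = 0) \<and>
      card (A \<inter> {..<k}) + card (B \<inter> {..<k}) \<le> card Z + k" if "k \<le> N" for k
    using that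
  proof (induction k)
    case 0
    show ?case by (intro exI[of _ "{}"]) auto
  next
    case (Suc k)
    then obtain Z where Z: "finite Z" "Z \<subseteq> {0<..<1}" "\<forall>z\<in>Z. poly ((pderiv ^^ k) g) z = 0"
      "card (A \<inter> {..<k}) + card (B \<inter> {..<k}) \<le> card Z + k" by auto
    define S where "S = Z \<union> (if k \<in> A then {0} else {}) \<union> (if k \<in> B then {1} else {})"
    have "poly ((pderiv ^^ k) g) 0 = 0" if "k \<in> A"
      using A[OF that] by (simp add: poly_0_coeff_0 coeff_higher_pderiv)
    then have S0: "poly ((pderiv ^^ k) g) x = 0" if "x \<in> S" for x
      using that Z(3) B by (auto simp: S_def split: if_splits)
    have "finite S" using Z by (auto simp: S_def)
    then obtain Z' where Z': "finite Z'" "card S \<le> card Z' + 1"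
      "\<forall>z\<in>Z'. poly (pderiv ((pderiv ^^ k) g)) z = 0 \<and> (\<exists>a\<in>S. \<exists>b\<in>S. a < z \<and> z < b)"
      using rolle_zero_count[of S "(pderiv ^^ k) g"] S0 by blast
    have "S \<subseteq> {0..1}" using Z(2) by (auto simp: S_def split: if_splits)
    then have "Z' \<subseteq> {0<..<1}" using Z'(3) by fastforce
    moreover have "0 \<notin> Z" "1 \<notin> Z" using Z(2) by auto
    then have "card S = card Z + (if k \<in> A then 1 else 0) + (if k \<in> B then 1 else 0)"
      using Z(1) by (auto simp: S_def)
    then have "card (A \<inter> {..<Suc k}) + card (B \<inter> {..<Suc k}) \<le> card Z' + Suc k"
      using Z(4) Z'(2) by (auto simp: card_Int_lessThan_Suc)
    ultimately show ?case using Z' by (intro exI[of _ Z']) auto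
  qed
  define k where "k = degree g"
  have "k < N" using deg[of "degree g"] \<open>g \<noteq> 0\<close> unfolding k_def
    by (metis leading_coeff_0_iff not_less)
  then obtain Z where Z: "finite Z" "\<forall>z\<in>Z. poly ((pderiv ^^ k) g) z = 0"
      "card (A \<inter> {..<k}) + card (B \<inter> {..<k}) \<le> card Z + k" using zeros[of k] by auto
  have "k + 1 \<le> card (A \<inter> {..<Suc k}) + card (B \<inter> {..<Suc k})"
    using polya[of "Suc k"] \<open>k < N\<close> by simp
  then have "Z \<noteq> {} \<or> k \<in> A \<or> k \<in> B" using Z(3) by (auto simp: card_Int_lessThan_Suc split: if_splits)
  moreover have "poly ((pderiv ^^ k) g) 0 = 0" if "k \<in> A"
    using A[OF that] by (simp add: poly_0_coeff_0 coeff_higher_pderiv)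
  ultimately obtain z where z: "poly ((pderiv ^^ k) g) z = 0" using Z(2) B by blast
  have "degree ((pderiv ^^ k) g) = 0" by (simp add: degree_higher_pderiv k_def)
  then obtain c where c: "(pderiv ^^ k) g = [:c:]" by (rule degree_eq_zeroE)
  then have "(pderiv ^^ k) g = 0" using z by simp
  then have "coeff ((pderiv ^^ k) g) 0 = 0" by simp
  then have "lead_coeff g = 0" by (simp add: coeff_higher_pderiv k_def pochhammer_eq_0_iff)
  then show False using \<open>g \<noteq> 0\<close> by simp
qed

lemma two_point_complex:
  fixes f :: "complex poly"
  assumes deg: "\<And>p. p \<ge> N \<Longrightarrow> coeff f p = 0"
    and A: "\<And>k. k \<in> A \<Longrightarrow> coeff f k = 0"
    and B: "\<And>k. k \<in> B \<Longrightarrow> poly ((pderiv ^^ k) f) 1 = 0"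
    and polya: "\<And>k. k \<le> N \<Longrightarrow> k \<le> card (A \<inter> {..<k}) + card (B \<inter> {..<k})"
  shows "f = 0"
proof -
  have *: "map_poly h f = 0"
    if h: "\<And>a b. h (a + b) = h a + h b" "\<And>n a. h (of_nat n * a) = of_nat n * h a"
    for h :: "complex \<Rightarrow> real"
  proof -
    have h0 [simp]: "h 0 = 0" using h(2)[of 0 0] by simp
    have pd: "pderiv (map_poly h p) = map_poly h (pderiv p)" for p
      by (intro poly_eqI) (simp add: coeff_pderiv coeff_map_poly h(2) del: of_nat_Suc)
    have hp: "(pderiv ^^ k) (map_poly h p) = map_poly h ((pderiv ^^ k) p)" for k p
      by (induction k) (simp_all add: pd)
    have "map_poly h (pCons a p) = pCons (h a) (map_poly h p)" for a p
      by (intro poly_eqI) (auto simp: coeff_map_poly coeff_pCons split: nat.splits)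
    then have ev: "poly (map_poly h p) 1 = h (poly p 1)" for p
      by (induction p) (simp_all add: h(1))
    show ?thesis
      by (rule two_point_real[of N _ A B]) (auto simp: coeff_map_poly deg A hp ev B polya)
  qed
  have "Re (coeff f n) = 0" for n
    using arg_cong[OF *[of Re], of "\<lambda>p. coeff p n"] by (simp add: coeff_map_poly)
  moreover have "Im (coeff f n) = 0" for n
    using arg_cong[OF *[of Im], of "\<lambda>p. coeff p n"] by (simp add: coeff_map_poly)
  ultimately show ?thesis by (intro poly_eqI) (simp add: complex_eq_iff)
qed

section \<open>Subspaces of polynomials\<close>

definition poly_subspace :: "complex poly set \<Rightarrow> bool" where
  "poly_subspace V \<longleftrightarrow> 0 \<in> V \<and> (\<forall>P\<in>V. \<forall>Q\<in>V. P + Q \<in> V) \<and> (\<forall>c. \<forall>P\<in>V. smult c P \<in> V)"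

text \<open>
  For a subspace, the number of these degrees is the dimension; it is used in place of the dimension.
\<close>

definition degs :: "complex poly set \<Rightarrow> nat set" where
  "degs V = degree ` (V - {0})"

lemma poly_subspace_0: "poly_subspace V \<Longrightarrow> 0 \<in> V"
  and poly_subspace_add: "poly_subspace V \<Longrightarrow> P \<in> V \<Longrightarrow> Q \<in> V \<Longrightarrow> P + Q \<in> V"
  and poly_subspace_smult: "poly_subspace V \<Longrightarrow> P \<in> V \<Longrightarrow> smult c P \<in> V"
  by (auto simp: poly_subspace_def)

lemma poly_subspace_diff: "poly_subspace V \<Longrightarrow> P \<in> V \<Longrightarrow> Q \<in> V \<Longrightarrow> P - Q \<in> V"
  using poly_subspace_add[of V P "smult (-1) Q"] poly_subspace_smult[of V Q "-1"] by simp

lemma poly_subspace_sum: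
  "poly_subspace V \<Longrightarrow> (\<And>x. x \<in> A \<Longrightarrow> f x \<in> V) \<Longrightarrow> sum f A \<in> V"
  by (induction A rule: infinite_finite_induct)
     (auto intro: poly_subspace_0 poly_subspace_add)

lemma degs_basis_exists:
  assumes "poly_subspace V"
  obtains B where "\<And>d. d \<in> degs V \<Longrightarrow> B d \<in> V \<and> degree (B d) = d \<and> lead_coeff (B d) = 1"
proof -
  have "\<exists>P. P \<in> V \<and> degree P = d \<and> lead_coeff P = 1" if d: "d \<in> degs V" for d
  proof -
    obtain P where P: "P \<in> V" "P \<noteq> 0" "degree P = d" using d by (auto simp: degs_def)
    then show ?thesis using poly_subspace_smult[OF assms P(1), of "inverse (lead_coeff P)"]
      by (intro exI[of _ "smult (inverse (lead_coeff P)) P"]) auto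
  qed
  then show ?thesis using that by metis
qed

lemma degs_basis_spans:
  assumes V: "poly_subspace V" and fin: "finite (degs V)" and "P \<in> V"
    and B: "\<And>d. d \<in> degs V \<Longrightarrow> B d \<in> V \<and> degree (B d) = d \<and> lead_coeff (B d) = 1"
  shows "\<exists>c. P = (\<Sum>d\<in>degs V. smult (c d) (B d))"
  using \<open>P \<in> V\<close>
proof (induction "if P = 0 then 0 else Suc (degree P)" arbitrary: P rule: less_induct)
  case less
  show ?case
  proof (cases "P = 0")
    case True
    then show ?thesis by (intro exI[of _ "\<lambda>_. 0"]) auto
  next
    case False
    define d where "d = degree P"
    have d: "d \<in> degs V" using False less.prems by (auto simp: degs_def d_def)
    define Q where "Q = P - smult (lead_coeff P) (B d)"
    have "Q \<in> V" unfolding Q_def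
      using d B less.prems V by (intro poly_subspace_diff poly_subspace_smult) auto
    have "degree Q \<le> d" unfolding Q_def using B[OF d]
      by (intro degree_diff_le) (auto simp: d_def intro: order_trans[OF degree_smult_le])
    moreover have "coeff (B d) d = 1" using B[OF d] by auto
    then have "coeff Q d = 0" by (simp add: Q_def flip: d_def)
    ultimately have "Q = 0 \<or> degree Q < d"
      by (metis le_neq_implies_less leading_coeff_0_iff)
    then have "(if Q = 0 then 0 else Suc (degree Q)) < (if P = 0 then 0 else Suc (degree P))"
      using False by (auto simp: d_def)
    then obtain c where c: "Q = (\<Sum>d\<in>degs V. smult (c d) (B d))"
      using less.hyps \<open>Q \<in> V\<close> by blast
    have "P = Q + smult (lead_coeff P) (B d)" by (simp add: Q_def)
    also have "\<dots> = (\<Sum>e\<in>degs V. smult (c e + (if e = d then lead_coeff P else 0)) (B e))"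
      using d fin unfolding c
      by (simp add: smult_add_left sum.distrib if_distrib[of "\<lambda>a. smult a _"] cong: if_cong)
    finally show ?thesis
      by (intro exI[of _ "\<lambda>e. c e + (if e = d then lead_coeff P else 0)"])
  qed
qed

lemma degs_basis_independent:
  assumes "finite D" and B: "\<And>d. d \<in> D \<Longrightarrow> degree (B d) = d \<and> lead_coeff (B d) = 1"
    and "(\<Sum>d\<in>D. smult (c d) (B d)) = (0::complex poly)" and "d \<in> D"
  shows "c d = 0"
proof (rule ccontr)
  assume "c d \<noteq> 0"
  define E where "E = {e\<in>D. c e \<noteq> 0}"
  define e where "e = Max E"
  have "finite E" "E \<noteq> {}" using assms \<open>c d \<noteq> 0\<close> by (auto simp: E_def)
  then have e: "e \<in> E" "\<And>x. x \<in> E \<Longrightarrow> x \<le> e" by (auto simp: e_def)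
  have "0 = coeff (\<Sum>d\<in>D. smult (c d) (B d)) e" using assms(3) by simp
  also have "\<dots> = (\<Sum>d\<in>D. c d * coeff (B d) e)" by (simp add: coeff_sum)
  also have "\<dots> = (\<Sum>d\<in>{e}. c d * coeff (B d) e)"
  proof (rule sum.mono_neutral_right)
    show "\<forall>i\<in>D - {e}. c i * coeff (B i) e = 0"
    proof
      fix i assume i: "i \<in> D - {e}"
      show "c i * coeff (B i) e = 0"
      proof (cases "c i = 0")
        case False
        then have "i \<in> E" using i by (simp add: E_def)
        then have "degree (B i) < e" using e(2)[of i] i B[of i] by auto
        then show ?thesis by (simp add: coeff_eq_0)
      qed simp
    qed
  qed (use e assms in \<open>auto simp: E_def\<close>)
  also have "\<dots> = c e" using B[of e] e(1) by (auto simp: E_def)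
  finally show False using e(1) by (simp add: E_def)
qed

section \<open>Generic Birkhoff interpolation\<close>

text \<open>
  The falling factorial \<open>p (p - 1) \<dots> (p - j + 1)\<close>.
\<close>

definition falling :: "nat \<Rightarrow> nat \<Rightarrow> complex" where
  "falling j p = poly ((pderiv ^^ j) (monom 1 p)) 1"

lemma poly_higher_pderiv_monom:
  "x ^ j * poly ((pderiv ^^ j) (monom c p)) x = c * falling j p * (x::complex) ^ p"
proof (cases "j \<le> p")
  case True
  define a :: complex where "a = pochhammer (of_nat (Suc (p - j))) j"
  have "(pderiv ^^ j) (monom c p) = monom (a * c) (p - j)" for c
    using True by (intro poly_eqI) (auto simp: coeff_higher_pderiv a_def)
  then show ?thesis using True by (simp add: falling_def poly_monom flip: power_add)
next
  case False
  then have "(pderiv ^^ j) (monom c p) = 0" for c :: complex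
    by (intro poly_eqI) (auto simp: coeff_higher_pderiv)
  then show ?thesis by (simp add: falling_def)
qed

lemma poly_higher_pderiv_sum:
  assumes "\<And>p. p \<ge> N \<Longrightarrow> coeff P p = 0"
  shows "x ^ j * poly ((pderiv ^^ j) P) x = (\<Sum>p<N. coeff P p * falling j p * (x::complex) ^ p)"
proof -
  have "P = (\<Sum>p<N. monom (coeff P p) p)"
    using assms by (intro poly_eqI) (auto simp: coeff_sum not_less)
  then have "x ^ j * poly ((pderiv ^^ j) P) x =
      x ^ j * poly ((pderiv ^^ j) (\<Sum>p<N. monom (coeff P p) p)) x" by simp
  also have "\<dots> = (\<Sum>p<N. coeff P p * falling j p * x ^ p)"
    by (simp add: higher_pderiv_sum poly_sum sum_distrib_left poly_higher_pderiv_monom)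
  finally show ?thesis .
qed

text \<open>
  The derivatives of the orders in \<open>J\<close> at a far away point separate the elements of \<open>V\<close>. After
  rescaling, a basis of \<open>V\<close> with distinct degrees tends to monomials as the point goes to infinity, and then
  the point becomes \<open>1\<close>. For a combination of these monomials the missing coefficients are vanishing conditions
  at \<open>0\<close>, so the two-point theorem applies in the limit.
\<close>

lemma one_row_injective:
  assumes V: "poly_subspace V" and deg: "degs V \<subseteq> {..<N}" and "finite J"
    and dim: "\<And>k. k \<le> N \<Longrightarrow> card (degs V \<inter> {..<k}) \<le> card (J \<inter> {..<k})"
  shows "\<exists>\<mu>. \<forall>P\<in>V. (\<forall>j\<in>J. poly ((pderiv ^^ j) P) \<mu> = 0) \<longrightarrow> P = 0"
proof -
  have fin: "finite (degs V)" using deg finite_subset by blast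
  obtain B where B: "\<And>d. d \<in> degs V \<Longrightarrow> B d \<in> V \<and> degree (B d) = d \<and> lead_coeff (B d) = 1"
    using degs_basis_exists[OF V] by blast
  define A where "A = {..<N} - degs V"
  define T where "T = Inl ` J \<union> (Inr ` A :: (nat + nat) set)"
  \<comment> \<open>Row \<open>j\<close> of this matrix holds \<open>s ^ q\<close> times the \<open>j\<close>-th derivatives of the \<open>B q\<close> at \<open>1/s\<close>,
    up to a power of \<open>s\<close>; at \<open>s = 0\<close> only the leading monomials survive.\<close>
  define M where "M = (\<lambda>t q (\<Lambda>::nat \<Rightarrow> complex). case t of
      Inl j \<Rightarrow> (\<Sum>p\<le>q. coeff (B q) p * falling j p * \<Lambda> 0 ^ (q - p))
    | Inr p \<Rightarrow> if p = q then 1 else 0)"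
  have "finite T" using \<open>finite J\<close> by (auto simp: T_def A_def)
  moreover have "line_poly (M t q)" for t q
  proof -
    have "line_poly (\<lambda>\<Lambda>. \<Lambda> 0 ^ e)" for e
      using line_poly_poly[of "monom 1 e" 0] by (simp add: poly_monom)
    then show ?thesis unfolding M_def
      by (cases t) (auto intro!: line_poly_sum line_poly_mult)
  qed
  moreover have "\<forall>q<N. v q = 0"
    if v: "\<And>t. t \<in> T \<Longrightarrow> (\<Sum>q<N. M t q (\<lambda>_. 0) * v q) = 0" for v
  proof -
    define f where "f = (\<Sum>q<N. monom (v q) q)"
    have cf: "coeff f p = (if p < N then v p else 0)" for p
      by (auto simp: f_def coeff_sum)
    have vA: "v p = 0" if "p \<in> A" for p
    proof -
      have "(\<Sum>q<N. M (Inr p) q (\<lambda>_. 0) * v q) = 0" using that by (intro v) (simp add: T_def)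
      then show ?thesis using that by (simp add: M_def A_def if_distrib[of "\<lambda>a. a * _"] cong: if_cong)
    qed
    have "f = 0"
    proof (rule two_point_complex[of N _ A J])
      fix j assume j: "j \<in> J"
      have "poly ((pderiv ^^ j) f) 1 = (\<Sum>q<N. v q * falling j q)"
        using poly_higher_pderiv_sum[of N f 1 j] by (simp add: cf)
      also have "\<dots> = (\<Sum>q<N. M (Inl j) q (\<lambda>_. 0) * v q)"
      proof (intro sum.cong refl)
        fix q assume "q \<in> {..<N}"
        then consider "q \<in> degs V" | "q \<in> A" by (auto simp: A_def)
        then show "v q * falling j q = M (Inl j) q (\<lambda>_. 0) * v q"
        proof cases
          case 1
          have "(\<Sum>p\<le>q. coeff (B q) p * falling j p * 0 ^ (q - p)) =
              (\<Sum>p\<le>q. if p = q then coeff (B q) p * falling j p else 0)"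
            by (intro sum.cong refl) (auto simp: power_0_left)
          moreover have "coeff (B q) q = 1" using B[OF 1] by auto
          ultimately show ?thesis by (simp add: M_def)
        qed (simp add: vA)
      qed
      also have "\<dots> = 0" using j by (intro v) (simp add: T_def)
      finally show "poly ((pderiv ^^ j) f) 1 = 0" .
    next
      fix k assume k: "k \<le> N"
      have "A \<inter> {..<k} = {..<k} - degs V \<inter> {..<k}" using k by (auto simp: A_def)
      then have "card (A \<inter> {..<k}) = k - card (degs V \<inter> {..<k})"
        by (simp add: card_Diff_subset)
      then show "k \<le> card (A \<inter> {..<k}) + card (J \<inter> {..<k})" using dim[OF k] by linarith
    qed (auto simp: cf vA)
    then show ?thesis using cf by (metis coeff_0)
  qed
  ultimately have "generic (\<lambda>\<Lambda>. \<forall>v. (\<forall>t\<in>T. (\<Sum>q<N. M t q \<Lambda> * v q) = 0) \<longrightarrow> (\<forall>q<N. v q = 0))"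
    by (intro generic_injective) auto
  moreover have "generic (\<lambda>\<Lambda>. \<Lambda> 0 \<noteq> 0)"
    using genericI[of "\<lambda>\<Lambda>. \<Lambda> 0" "\<lambda>_. 1"] by simp
  ultimately obtain \<Lambda> where inj: "\<And>v. (\<forall>t\<in>T. (\<Sum>q<N. M t q \<Lambda> * v q) = 0) \<Longrightarrow> (\<forall>q<N. v q = 0)"
    and "\<Lambda> 0 \<noteq> 0" using generic_ex[OF generic_conj] by blast
  define x where "x = inverse (\<Lambda> 0)"
  have x: "\<Lambda> 0 = inverse x" "x \<noteq> 0" using \<open>\<Lambda> 0 \<noteq> 0\<close> by (auto simp: x_def)
  show ?thesis
  proof (intro exI[of _ x] ballI impI)
    fix P assume P: "P \<in> V" "\<forall>j\<in>J. poly ((pderiv ^^ j) P) x = 0"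
    then obtain b where b: "P = (\<Sum>d\<in>degs V. smult (b d) (B d))"
      using degs_basis_spans[OF V fin P(1) B] by auto
    define v where "v = (\<lambda>q. if q \<in> degs V then b q * x ^ q else 0)"
    have "\<forall>q<N. v q = 0"
    proof (rule inj, rule ballI)
      fix t assume "t \<in> T"
      then consider j where "j \<in> J" "t = Inl j" | p where "p \<in> A" "t = Inr p"
        by (auto simp: T_def)
      then show "(\<Sum>q<N. M t q \<Lambda> * v q) = 0"
      proof cases
        case 1
        have "(\<Sum>q<N. M t q \<Lambda> * v q) = (\<Sum>d\<in>degs V. M t d \<Lambda> * v d)"
          using deg by (intro sum.mono_neutral_right) (auto simp: v_def)
        also have "\<dots> = (\<Sum>d\<in>degs V. b d * (x ^ j * poly ((pderiv ^^ j) (B d)) x))"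
        proof (intro sum.cong refl)
          fix d assume d: "d \<in> degs V"
          have "M t d \<Lambda> * x ^ d = (\<Sum>p\<le>d. coeff (B d) p * falling j p * x ^ p)"
            unfolding M_def 1 x(1) by (simp add: sum_distrib_right) (intro sum.cong refl, use x(2) in \<open>simp add: power_diff field_simps\<close>)
          also have "\<dots> = (\<Sum>p<Suc d. coeff (B d) p * falling j p * x ^ p)"
            by (simp add: lessThan_Suc_atMost)
          also have "\<dots> = x ^ j * poly ((pderiv ^^ j) (B d)) x"
            using B[OF d] by (subst poly_higher_pderiv_sum[of "Suc d"]) (auto intro: coeff_eq_0)
          finally show "M t d \<Lambda> * v d = b d * (x ^ j * poly ((pderiv ^^ j) (B d)) x)"
            using d by (simp add: v_def)
        qed
        also have "\<dots> = x ^ j * poly ((pderiv ^^ j) P) x"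
          unfolding b by (simp add: higher_pderiv_sum higher_pderiv_smult poly_sum sum_distrib_left ac_simps)
        finally show ?thesis using P(2) 1 by simp
      next
        case 2
        have "(\<Sum>q<N. M t q \<Lambda> * v q) = (\<Sum>q<N. if q = p then v p else 0)"
          unfolding 2 M_def by (intro sum.cong) auto
        then show ?thesis using 2 by (simp add: v_def A_def)
      qed
    qed
    then have "b d = 0" if "d \<in> degs V" for d
      using that deg x(2) by (auto simp: v_def)
    then show "P = 0" unfolding b by simp
  qed
qed

definition vanishes_at :: "(nat \<times> nat) set \<Rightarrow> (nat \<Rightarrow> complex) \<Rightarrow> complex poly \<Rightarrow> bool" where
  "vanishes_at T \<Lambda> P \<longleftrightarrow> (\<forall>(i, j)\<in>T. poly ((pderiv ^^ j) P) (\<Lambda> i) = 0)"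

text \<open>
  The conditions are imposed on polynomials of degree less than \<open>N\<close>; a zero of order \<open>c\<close> at the origin is
  kept as a separate condition, since it carries the induction on the number of points.
\<close>

definition determines :: "nat \<Rightarrow> nat \<Rightarrow> (nat \<times> nat) set \<Rightarrow> (nat \<Rightarrow> complex) \<Rightarrow> bool" where
  "determines c N T \<Lambda> \<longleftrightarrow>
     (\<forall>P. (\<forall>p\<ge>N. coeff P p = 0) \<and> (\<forall>p<c. coeff P p = 0) \<and> vanishes_at T \<Lambda> P \<longrightarrow> P = 0)"

text \<open>
  The conditions form a matrix acting on coefficient vectors, whose entries are polynomials in \<open>\<Lambda>\<close>; so
  \<open>generic_injective\<close> applies.
\<close>

lemma generic_determines:
  assumes "finite T" and det: "determines c N T \<Lambda>0"
  shows "generic (determines c N T)"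
proof -
  define S where "S = Inl ` T \<union> (Inr ` {..<c} :: ((nat \<times> nat) + nat) set)"
  define M where "M = (\<lambda>t q (\<Lambda>::nat \<Rightarrow> complex). case t of
      Inl (i, j) \<Rightarrow> poly ((pderiv ^^ j) (monom 1 q)) (\<Lambda> i)
    | Inr p \<Rightarrow> if p = q then 1 else 0)"
  have MI: "(\<Sum>q<N. M (Inl (i, j)) q \<Lambda> * v q) = poly ((pderiv ^^ j) (\<Sum>q<N. monom (v q) q)) (\<Lambda> i)"
    for i j \<Lambda> v
  proof -
    have m: "monom (v q) q = smult (v q) (monom 1 q)" for q by (simp add: smult_monom)
    show ?thesis
      by (subst m) (simp add: M_def higher_pderiv_sum poly_sum higher_pderiv_smult mult.commute)
  qed
  have MR: "(\<Sum>q<N. M (Inr p) q \<Lambda> * v q) = coeff (\<Sum>q<N. monom (v q) q) p" for p \<Lambda> v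
    by (simp add: M_def coeff_sum if_distrib[of "\<lambda>a. a * _"] eq_commute[of p] cong: if_cong)
  have van: "(\<forall>t\<in>S. (\<Sum>q<N. M t q \<Lambda> * v q) = 0) \<longleftrightarrow>
      (\<forall>p<c. coeff (\<Sum>q<N. monom (v q) q) p = 0) \<and> vanishes_at T \<Lambda> (\<Sum>q<N. monom (v q) q)" for \<Lambda> v
    unfolding S_def ball_Un ball_simps vanishes_at_def using MI MR by (auto split: prod.splits)
  have cf: "coeff (\<Sum>q<N. monom (v q) q) p = (if p < N then v p else 0)" for v :: "nat \<Rightarrow> complex" and p
    by (auto simp: coeff_sum)
  have "generic (\<lambda>\<Lambda>. \<forall>v. (\<forall>t\<in>S. (\<Sum>q<N. M t q \<Lambda> * v q) = 0) \<longrightarrow> (\<forall>q<N. v q = 0))"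
  proof (rule generic_injective)
    show "finite S" using assms by (simp add: S_def)
    show "line_poly (M t q)" for t q by (cases t) (auto simp: M_def split: prod.splits)
    fix v assume "\<And>t. t \<in> S \<Longrightarrow> (\<Sum>q<N. M t q \<Lambda>0 * v q) = 0"
    then have "(\<Sum>q<N. monom (v q) q) = 0"
      using det van[of \<Lambda>0 v] by (auto simp: determines_def cf)
    then show "\<forall>q<N. v q = 0" using cf[of v] by (metis coeff_0)
  qed
  then show ?thesis
  proof (rule generic_mono)
    fix \<Lambda>
    assume inj: "\<forall>v. (\<forall>t\<in>S. (\<Sum>q<N. M t q \<Lambda> * v q) = 0) \<longrightarrow> (\<forall>q<N. v q = 0)"
    show "determines c N T \<Lambda>"
      unfolding determines_def
    proof (intro allI impI, elim conjE)
      fix P assume P: "\<forall>p\<ge>N. coeff P p = 0" "\<forall>p<c. coeff P p = 0" "vanishes_at T \<Lambda> P"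
      have eq: "(\<Sum>q<N. monom (coeff P q) q) = P"
        using P(1) by (intro poly_eqI) (auto simp: coeff_sum)
      then have "\<forall>q<N. coeff P q = 0" using inj van[of \<Lambda> "coeff P"] P by simp
      then show "P = 0" using P(1) by (intro poly_eqI) (metis coeff_0 not_less)
    qed
  qed
qed

text \<open>
  Generic solvability of Birkhoff interpolation under the Polya condition, by induction on the number of
  points. Let \<open>V\<close> be the space of solutions for all points but the last. The conditions of the last point with
  orders below \<open>k\<close> can be traded for the same number of additional zeros at the origin. By induction, this bounds
  the dimension of the part of \<open>V\<close> of degree below \<open>k\<close> by the number of these conditions, which is what
  \<open>one_row_injective\<close> needs.
\<close>

lemma generic_birkhoff:
  assumes "finite T" "T \<subseteq> {..<m} \<times> UNIV"
    and "\<And>l. l \<le> N \<Longrightarrow> l \<le> c + card {t\<in>T. snd t < l}"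
  shows "generic (determines c N T)"
  using assms
proof (induction m arbitrary: T c N)
  case 0
  then have "T = {}" by auto
  then have "N \<le> c" using 0(3)[of N] by simp
  then have "determines c N T (\<lambda>_. 0)"
    unfolding determines_def
  proof (intro allI impI poly_eqI)
    fix P :: "complex poly" and p
    assume "(\<forall>p\<ge>N. coeff P p = 0) \<and> (\<forall>p<c. coeff P p = 0) \<and> vanishes_at T (\<lambda>_. 0) P"
    then show "coeff P p = coeff 0 p" using \<open>N \<le> c\<close> by (cases "p < c") auto
  qed
  then show ?case using generic_determines 0 by blast
next
  case (Suc m)
  define T' where "T' = {t\<in>T. fst t < m}"
  define J where "J = {j. (m, j) \<in> T}"
  have "J = snd ` {t\<in>T. fst t = m}" by (force simp: J_def)
  then have "finite J" using Suc.prems(1) by simp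
  have split: "card {t\<in>T. snd t < l} = card {t\<in>T'. snd t < l} + card (J \<inter> {..<l})" for l
  proof -
    have "{t\<in>T. snd t < l} = {t\<in>T'. snd t < l} \<union> Pair m ` (J \<inter> {..<l})"
      using Suc.prems(2) by (force simp: T'_def J_def less_Suc_eq)
    moreover have "card (Pair m ` (J \<inter> {..<l})) = card (J \<inter> {..<l})"
      by (rule card_image) (auto simp: inj_on_def)
    moreover have "card ({t\<in>T'. snd t < l} \<union> Pair m ` (J \<inter> {..<l})) =
        card {t\<in>T'. snd t < l} + card (Pair m ` (J \<inter> {..<l}))"
      by (rule card_Un_disjoint) (auto simp: T'_def Suc.prems(1))
    ultimately show ?thesis by simp
  qed
  have "generic (\<lambda>\<Lambda>. \<forall>k\<in>{..N}. determines (c + card (J \<inter> {..<k})) k T' \<Lambda>)"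
  proof (rule generic_ball)
    fix k assume k: "k \<in> {..N}"
    show "generic (determines (c + card (J \<inter> {..<k})) k T')"
    proof (rule Suc.IH)
      fix l assume l: "l \<le> k"
      have "card (J \<inter> {..<l}) \<le> card (J \<inter> {..<k})" using l by (intro card_mono) auto
      then show "l \<le> c + card (J \<inter> {..<k}) + card {t\<in>T'. snd t < l}"
        using Suc.prems(3)[of l] l k split[of l] by simp
    qed (use Suc.prems in \<open>auto simp: T'_def\<close>)
  qed simp
  then obtain \<Lambda> where \<Lambda>: "\<And>k. k \<le> N \<Longrightarrow> determines (c + card (J \<inter> {..<k})) k T' \<Lambda>"
    using generic_ex by fastforce
  define V where "V = {P. (\<forall>p\<ge>N. coeff P p = 0) \<and> (\<forall>p<c. coeff P p = 0) \<and> vanishes_at T' \<Lambda> P}"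
  have V: "poly_subspace V"
    unfolding poly_subspace_def V_def vanishes_at_def case_prod_unfold
    by (auto simp: higher_pderiv_add higher_pderiv_smult)
  have degV: "degs V \<subseteq> {..<N}"
  proof
    fix d assume "d \<in> degs V"
    then obtain P where "P \<in> V" "P \<noteq> 0" "d = degree P" by (auto simp: degs_def)
    then have "coeff P d \<noteq> 0" "\<forall>p\<ge>N. coeff P p = 0" by (auto simp: V_def)
    then show "d \<in> {..<N}" by (metis lessThan_iff not_less)
  qed
  then have fin: "finite (degs V)" using finite_subset by blast
  obtain B where B: "\<And>d. d \<in> degs V \<Longrightarrow> B d \<in> V \<and> degree (B d) = d \<and> lead_coeff (B d) = 1"
    using degs_basis_exists[OF V] by blast
  have dim: "card (degs V \<inter> {..<k}) \<le> card (J \<inter> {..<k})" if k: "k \<le> N" for k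
  proof (rule ccontr)
    \<comment> \<open>Too many elements of \<open>V\<close> of degree below \<open>k\<close>: a combination of them also vanishes to the
      higher order \<open>c + card (J \<inter> {..<k})\<close> at \<open>0\<close>, against the choice of \<open>\<Lambda>\<close>.\<close>
    assume "\<not> ?thesis"
    then have "card {c..<c + card (J \<inter> {..<k})} < card (degs V \<inter> {..<k})" by simp
    then have "\<exists>b. (\<exists>d\<in>degs V \<inter> {..<k}. b d \<noteq> 0) \<and> (\<forall>p\<in>{c..<c + card (J \<inter> {..<k})}.
        (\<Sum>d\<in>degs V \<inter> {..<k}. b d * coeff (B d) p) = 0)"
      by (intro underdetermined_system) (use fin in auto)
    then obtain b where b: "\<exists>d\<in>degs V \<inter> {..<k}. b d \<noteq> 0"
      "\<And>p. p \<in> {c..<c + card (J \<inter> {..<k})} \<Longrightarrow> (\<Sum>d\<in>degs V \<inter> {..<k}. b d * coeff (B d) p) = 0"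
      by blast
    define P where "P = (\<Sum>d\<in>degs V \<inter> {..<k}. smult (b d) (B d))"
    have "P \<in> V" unfolding P_def using B by (auto intro!: poly_subspace_sum poly_subspace_smult V)
    moreover have "coeff P p = 0" if "p \<ge> k" for p
      unfolding P_def using that B by (auto simp: coeff_sum intro!: sum.neutral coeff_eq_0)
    moreover have "coeff P p = 0" if "p \<in> {c..<c + card (J \<inter> {..<k})}" for p
      unfolding P_def using b(2)[OF that] by (simp add: coeff_sum)
    moreover have "coeff P p = 0" if "p < c" for p
      using that \<open>P \<in> V\<close> by (simp add: V_def)
    moreover have "vanishes_at T' \<Lambda> P" using \<open>P \<in> V\<close> by (simp add: V_def)
    ultimately have "P = 0"
      using \<Lambda>[OF k] unfolding determines_def by (meson atLeastLessThan_iff not_less)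
    then have "(\<Sum>d\<in>degs V \<inter> {..<k}. smult (b d) (B d)) = 0" by (simp add: P_def)
    then have "b d = 0" if "d \<in> degs V \<inter> {..<k}" for d
      by (rule degs_basis_independent[rotated 2]) (use that B fin in blast)+
    then show False using b(1) by blast
  qed
  obtain \<mu> where \<mu>: "\<And>P. P \<in> V \<Longrightarrow> (\<forall>j\<in>J. poly ((pderiv ^^ j) P) \<mu> = 0) \<Longrightarrow> P = 0"
    using one_row_injective[OF V degV \<open>finite J\<close> dim] by blast
  have "determines c N T (\<Lambda>(m := \<mu>))"
    unfolding determines_def
  proof (intro allI impI, elim conjE)
    fix P assume P: "\<forall>p\<ge>N. coeff P p = 0" "\<forall>p<c. coeff P p = 0" "vanishes_at T (\<Lambda>(m := \<mu>)) P"
    have "vanishes_at T' \<Lambda> P" using P(3) by (force simp: vanishes_at_def T'_def)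
    moreover have "\<forall>j\<in>J. poly ((pderiv ^^ j) P) \<mu> = 0"
      using P(3) by (force simp: vanishes_at_def J_def)
    ultimately show "P = 0" using \<mu>[of P] P by (auto simp: V_def)
  qed
  then show ?case using generic_determines Suc.prems(1) by blast
qed

section \<open>Prescribing a dope matrix exactly\<close>

text \<open>
  At generic points the \<open>n\<close> conditions have a solution of degree \<open>n\<close>. A further zero would be a further
  condition, and with it the set of conditions is large enough to force the solution to be zero.
\<close>

lemma exact_pattern_realizable:
  assumes S: "S \<subseteq> {..<m} \<times> {..<n}" "card S = n"
    and polya: "\<And>l. l \<le> n \<Longrightarrow> l \<le> card {t\<in>S. snd t < l}"
  obtains \<Lambda> :: "nat \<Rightarrow> complex" and P where "inj_on \<Lambda> {..<m}" "degree P = n" "P \<noteq> 0"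
    "\<And>i j. i < m \<Longrightarrow> j < n \<Longrightarrow> poly ((pderiv ^^ j) P) (\<Lambda> i) = 0 \<longleftrightarrow> (i, j) \<in> S"
proof -
  let ?U = "{..<m} \<times> {..<n}"
  have fin: "finite S" using S finite_subset by blast
  have "generic (determines 0 n S)"
    using S polya fin by (intro generic_birkhoff[of _ m]) auto
  moreover have "generic (\<lambda>\<Lambda>. \<forall>t\<in>?U - S. determines 0 (n + 1) (insert t S) \<Lambda>)"
  proof (intro generic_ball generic_birkhoff[of _ m])
    fix t l assume t: "t \<in> ?U - S" and l: "l \<le> n + 1"
    show "l \<le> 0 + card {u\<in>insert t S. snd u < l}"
    proof (cases "l \<le> n")
      case True
      have "card {u\<in>S. snd u < l} \<le> card {u\<in>insert t S. snd u < l}"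
        using fin by (intro card_mono) auto
      then show ?thesis using polya[OF True] by simp
    next
      case False
      then have "{u\<in>insert t S. snd u < l} = insert t S" using S t by auto
      then show ?thesis using t l S(2) fin by auto
    qed
  qed (use S fin in auto)
  ultimately obtain \<Lambda> where \<Lambda>: "inj_on \<Lambda> {..<m}" "determines 0 n S \<Lambda>"
      "\<And>t. t \<in> ?U - S \<Longrightarrow> determines 0 (n + 1) (insert t S) \<Lambda>"
    using generic_ex[OF generic_conj[OF generic_inj_on[of m] generic_conj]] by blast
  have "\<exists>c. (\<exists>q\<in>{..n}. c q \<noteq> 0) \<and>
      (\<forall>t\<in>S. (\<Sum>q\<in>{..n}. c q * poly ((pderiv ^^ snd t) (monom 1 q)) (\<Lambda> (fst t))) = 0)"
    by (intro underdetermined_system) (use fin S(2) in auto)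
  then obtain c where c: "\<exists>q\<in>{..n}. c q \<noteq> 0"
    "\<And>t. t \<in> S \<Longrightarrow> (\<Sum>q\<in>{..n}. c q * poly ((pderiv ^^ snd t) (monom 1 q)) (\<Lambda> (fst t))) = 0"
    by blast
  define P where "P = (\<Sum>q\<le>n. smult (c q) (monom 1 q))"
  have cf: "coeff P p = (if p \<le> n then c p else 0)" for p
    by (simp add: P_def coeff_sum if_distrib[of "\<lambda>a. _ * a"] cong: if_cong)
  have "P \<noteq> 0" using c(1) cf by (metis atMost_iff coeff_0)
  have van: "vanishes_at S \<Lambda> P"
    using c(2) by (force simp: vanishes_at_def P_def higher_pderiv_sum higher_pderiv_smult poly_sum)
  have "coeff P n \<noteq> 0"
  proof
    assume "coeff P n = 0"
    then have "\<forall>p\<ge>n. coeff P p = 0" by (metis cf le_antisym)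
    then show False using \<Lambda>(2) van \<open>P \<noteq> 0\<close> by (auto simp: determines_def)
  qed
  moreover have "degree P \<le> n" by (rule degree_le) (auto simp: cf)
  ultimately have deg: "degree P = n" by (simp add: le_antisym le_degree)
  show ?thesis
  proof (rule that[OF \<Lambda>(1) deg \<open>P \<noteq> 0\<close>])
    fix i j assume ij: "i < m" "j < n"
    show "poly ((pderiv ^^ j) P) (\<Lambda> i) = 0 \<longleftrightarrow> (i, j) \<in> S"
    proof
      assume z: "poly ((pderiv ^^ j) P) (\<Lambda> i) = 0"
      show "(i, j) \<in> S"
      proof (rule ccontr)
        assume "(i, j) \<notin> S"
        then have "determines 0 (n + 1) (insert (i, j) S) \<Lambda>" using \<Lambda>(3) ij by blast
        moreover have "vanishes_at (insert (i, j) S) \<Lambda> P"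
          using van z by (simp add: vanishes_at_def)
        ultimately show False using \<open>P \<noteq> 0\<close> by (auto simp: determines_def cf)
      qed
    qed (use van in \<open>auto simp: vanishes_at_def\<close>)
  qed
qed

lemma finite_dope_matrices: "finite (dope_matrices m n)"
proof (rule finite_subset)
  show "dope_matrices m n \<subseteq> (\<lambda>f. mat m (n + 1) f) ` (({0..<m} \<times> {0..<n + 1}) \<rightarrow>\<^sub>E {0, 1})"
  proof
    fix M assume "M \<in> dope_matrices m n"
    then obtain P \<Lambda> where M: "M = dope_matrix P \<Lambda>" "degree P = n" "length \<Lambda> = m"
      by (auto simp: dope_matrices_def)
    let ?f = "restrict (\<lambda>(i, j). if poly ((pderiv ^^ j) P) (\<Lambda> ! i) = 0 then 1 else (0::nat))
      ({0..<m} \<times> {0..<n + 1})"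
    have "M = mat m (n + 1) ?f" unfolding M(1) dope_matrix_def M(2,3)
      by (intro eq_matI) (auto split: if_splits)
    moreover have "?f \<in> ({0..<m} \<times> {0..<n + 1}) \<rightarrow>\<^sub>E {0, 1}"
      by (auto split: if_splits)
    ultimately show "M \<in> (\<lambda>f. mat m (n + 1) f) ` (({0..<m} \<times> {0..<n + 1}) \<rightarrow>\<^sub>E {0, 1})" by blast
  qed
qed (intro finite_imageI finite_PiE, auto)

section \<open>Cyclic shifts and the number of Polya patterns\<close>

definition polya_patterns :: "nat \<Rightarrow> nat \<Rightarrow> (nat \<times> nat) set set" where
  "polya_patterns m n = {S. S \<subseteq> {..<m} \<times> {..<n} \<and> card S = n \<and>
     (\<forall>l\<le>n. l \<le> card {t\<in>S. snd t < l})}"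

lemma finite_polya_patterns: "finite (polya_patterns m n)"
  by (rule finite_subset[of _ "Pow ({..<m} \<times> {..<n})"]) (auto simp: polya_patterns_def)

lemma card_polya_patterns_le: "card (polya_patterns m n) \<le> card (dope_matrices m n)"
proof (rule surj_card_le[OF finite_dope_matrices])
  show "polya_patterns m n \<subseteq> (\<lambda>M. {(i, j). i < m \<and> j < n \<and> M $$ (i, j) = 1}) ` dope_matrices m n"
  proof
    fix S assume "S \<in> polya_patterns m n"
    then have S: "S \<subseteq> {..<m} \<times> {..<n}" "card S = n" "\<And>l. l \<le> n \<Longrightarrow> l \<le> card {t\<in>S. snd t < l}"
      by (auto simp: polya_patterns_def)
    obtain \<Lambda> :: "nat \<Rightarrow> complex" and P where P: "inj_on \<Lambda> {..<m}" "degree P = n" "P \<noteq> 0"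
      "\<And>i j. i < m \<Longrightarrow> j < n \<Longrightarrow> poly ((pderiv ^^ j) P) (\<Lambda> i) = 0 \<longleftrightarrow> (i, j) \<in> S"
      using exact_pattern_realizable[OF S] by blast
    define M where "M = dope_matrix P (map \<Lambda> [0..<m])"
    have "M \<in> dope_matrices m n"
      using P(1-3) unfolding dope_matrices_def M_def
      by (auto simp: distinct_map atLeast0LessThan intro!: exI[of _ P] exI[of _ "map \<Lambda> [0..<m]"])
    moreover have "S = {(i, j). i < m \<and> j < n \<and> M $$ (i, j) = 1}"
      using S(1) P(2,4) by (auto simp: M_def dope_matrix_def split: if_splits)
    ultimately show "S \<in> (\<lambda>M. {(i, j). i < m \<and> j < n \<and> M $$ (i, j) = 1}) ` dope_matrices m n"
      by blast
  qed
qed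

text \<open>
  The cycle lemma, for the numbers of positions of \<open>S\<close> in the columns \<open>0, \<dots>, n - 1\<close>.
\<close>

lemma cyclic_shift_polya:
  assumes S: "S \<subseteq> {..<m} \<times> {..<n}" "card S = n" and "n > 0"
  shows "\<exists>r<n. \<exists>S'\<in>polya_patterns m n.
    S = (\<lambda>(i, j). (i, if j + r < n then j + r else j + r - n)) ` S'"
proof -
  have fin: "finite S" using S finite_subset by blast
  define c where "c = (\<lambda>l. card {t\<in>S. snd t < l})"
  \<comment> \<open>The shift starts at a column where the excess \<open>c r - r\<close> is smallest.\<close>
  define h where "h = (\<lambda>r. int (c r) - int r)"
  define r where "r = arg_min_on h {..<n}"
  have ne: "{..<n} \<noteq> {}" using \<open>n > 0\<close> by auto
  have r: "r < n" "\<And>s. s < n \<Longrightarrow> int (c r) - int r \<le> int (c s) - int s"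
    using arg_min_if_finite(1)[OF _ ne, of h] arg_min_least[OF _ ne, of _ h]
    by (auto simp: r_def h_def)
  have "{t\<in>S. snd t < n} = S" using S(1) by auto
  then have cn: "c n = n" using S(2) by (simp add: c_def)
  have "c 0 = 0" by (simp add: c_def)
  then have rn: "int (c r) - int r \<le> int (c s) - int s" if "s \<le> n" for s
    using r(2)[of s] r(2)[of 0] that cn \<open>n > 0\<close> by (cases "s = n") auto
  define rot where "rot = (\<lambda>(i::nat, j). (i, if j + r < n then j + r else j + r - n))"
  define S' where "S' = {t \<in> {..<m} \<times> {..<n}. rot t \<in> S}"
  have pre: "(i, if r \<le> j then j - r else j + n - r) \<in> S' \<and>
      rot (i, if r \<le> j then j - r else j + n - r) = (i, j)" if "(i, j) \<in> S" for i j
    using that S(1) r(1) by (auto simp: S'_def rot_def)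
  have img: "S = rot ` S'"
  proof
    show "S \<subseteq> rot ` S'" using pre by (force simp: image_iff)
  qed (auto simp: S'_def)
  have "inj_on rot S'"
    unfolding inj_on_def S'_def rot_def by (auto split: if_splits)
  then have card: "card S' = n" using img S(2) card_image by fastforce
  have fin': "finite S'" by (simp add: S'_def)
  have "l \<le> card {t\<in>S'. snd t < l}" if l: "l \<le> n" for l
  proof -
    define W where "W = {t\<in>S. (r \<le> snd t \<and> snd t < r + l) \<or> snd t + n < r + l}"
    have "W \<subseteq> rot ` {t\<in>S'. snd t < l}"
    proof
      fix t assume "t \<in> W"
      then obtain i j where t: "t = (i, j)" "(i, j) \<in> S"
        "(r \<le> j \<and> j < r + l) \<or> j + n < r + l" by (cases t) (auto simp: W_def)
      have "(if r \<le> j then j - r else j + n - r) < l" using t(3) l r(1) by auto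
      then show "t \<in> rot ` {t\<in>S'. snd t < l}"
        using pre[OF t(2)] unfolding t(1) image_iff
        by (intro bexI[of _ "(i, if r \<le> j then j - r else j + n - r)"]) auto
    qed
    then have "card W \<le> card {t\<in>S'. snd t < l}" using fin' by (intro surj_card_le) auto
    moreover have "l \<le> card W"
    proof (cases "r + l \<le> n")
      case True
      have "{t\<in>S. snd t < r + l} \<subseteq> {t\<in>S. snd t < r} \<union> W" by (auto simp: W_def)
      then have "c (r + l) \<le> c r + card W"
        unfolding c_def using fin
        by (intro order_trans[OF card_mono card_Un_le]) (auto simp: W_def)
      then show ?thesis using rn[OF True] by simp
    next
      case False
      define s where "s = r + l - n"
      have s: "s \<le> r" "s \<le> n" "int s = int r + int l - int n" using False l r(1) by (auto simp: s_def)
      have W: "W = {t\<in>S. r \<le> snd t} \<union> {t\<in>S. snd t < s}" using False S(1) by (auto simp: W_def s_def)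
      have "card W = card {t\<in>S. r \<le> snd t} + c s"
        unfolding W c_def by (rule card_Un_disjoint) (use fin s in auto)
      moreover have "card S \<le> c r + card {t\<in>S. r \<le> snd t}"
        unfolding c_def using fin by (intro order_trans[OF card_mono card_Un_le]) auto
      ultimately show ?thesis using rn[OF s(2)] s(3) S(2) by linarith
    qed
    ultimately show ?thesis by linarith
  qed
  then have "S' \<in> polya_patterns m n" using card by (auto simp: polya_patterns_def S'_def)
  then show ?thesis using img r(1) unfolding rot_def by blast
qed

lemma binomial_le_card_dope_matrices:
  assumes "n > 0"
  shows "(m * n choose n) \<le> n * card (dope_matrices m n)"
proof -
  let ?rot = "\<lambda>r (i::nat, j). (i, if j + r < n then j + r else j + r - n)"
  let ?A = "{S. S \<subseteq> {..<m} \<times> {..<n} \<and> card S = n}"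
  have "m * n choose n = card ?A" using n_subsets[of "{..<m} \<times> {..<n}" n] by simp
  also have "\<dots> \<le> card ({..<n} \<times> polya_patterns m n)"
  proof (rule surj_card_le)
    show "?A \<subseteq> (\<lambda>(r, S). ?rot r ` S) ` ({..<n} \<times> polya_patterns m n)"
    proof
      fix S assume "S \<in> ?A"
      then obtain r S' where "r < n" "S' \<in> polya_patterns m n" "S = ?rot r ` S'"
        using cyclic_shift_polya[of S m n] assms by blast
      then show "S \<in> (\<lambda>(r, S). ?rot r ` S) ` ({..<n} \<times> polya_patterns m n)"
        by (intro image_eqI[of _ _ "(r, S')"]) auto
    qed
  qed (simp add: finite_polya_patterns)
  also have "\<dots> \<le> n * card (dope_matrices m n)"
    using card_polya_patterns_le[of m n] by (simp add: card_cartesian_product)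
  finally show ?thesis .
qed

section \<open>Polynomials whose derivatives have only simple and distinct roots\<close>

lemma antiderivative_exists: "\<exists>Q. pderiv Q = (P :: complex poly)"
proof
  show "pderiv (\<Sum>p\<le>degree P. monom (coeff P p / of_nat (Suc p)) (Suc p)) = P"
    by (intro poly_eqI)
       (auto simp: coeff_pderiv coeff_sum coeff_eq_0 not_le simp del: of_nat_Suc)
qed

text \<open>
  The roots of the derivatives are simple, as the case \<open>j' = j + 1\<close> shows. The set \<open>B\<close>
  contains points that are already in use and must not be among the roots.
\<close>

definition separated_derivs :: "complex set \<Rightarrow> complex poly \<Rightarrow> bool" where
  "separated_derivs B U \<longleftrightarrow>
     (\<forall>j<degree U. \<forall>z\<in>B. poly ((pderiv ^^ j) U) z \<noteq> 0) \<and>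
     (\<forall>j j' z. j < j' \<longrightarrow> j' \<le> degree U \<longrightarrow> poly ((pderiv ^^ j) U) z = 0 \<longrightarrow>
        poly ((pderiv ^^ j') U) z \<noteq> 0)"

lemma higher_pderiv_nonzero:
  fixes P :: "complex poly"
  assumes "P \<noteq> 0" "j \<le> degree P"
  shows "(pderiv ^^ j) P \<noteq> 0"
proof
  assume "(pderiv ^^ j) P = 0"
  then have "coeff ((pderiv ^^ j) P) (degree P - j) = 0" by simp
  moreover have "pochhammer (Suc (degree P - j)) j > 0" by (rule pochhammer_pos) simp
  then have "pochhammer (of_nat (Suc (degree P - j))) j \<noteq> (0 :: complex)"
    by (subst pochhammer_of_nat) (simp del: of_nat_Suc)
  ultimately show False using assms by (simp add: coeff_higher_pderiv del: of_nat_Suc)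
qed

text \<open>
  Integration keeps the derivatives and adds one new polynomial \<open>Q + c\<close>. It must not vanish at finitely many
  points, and each of these points excludes one value of the constant \<open>c\<close>.
\<close>

lemma separated_derivs_antiderivative:
  assumes U: "separated_derivs B U" "U \<noteq> 0" and "finite B"
  shows "\<exists>Q. degree Q = Suc (degree U) \<and> finite {c. \<not> separated_derivs B (Q + [:c:])}"
proof -
  obtain Q where Q: "pderiv Q = U" using antiderivative_exists by blast
  have "degree Q \<noteq> 0" using Q U(2) pderiv_eq_0_iff by blast
  then have deg: "degree Q = Suc (degree U)" using Q degree_pderiv[of Q] by simp
  define Z where "Z = B \<union> (\<Union>j\<le>degree U. {z. poly ((pderiv ^^ j) U) z = 0})"
  have "finite Z" unfolding Z_def using \<open>finite B\<close> higher_pderiv_nonzero[OF U(2)]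
    by (auto intro: poly_roots_finite)
  moreover have "separated_derivs B (Q + [:c:])" if c: "c \<notin> (\<lambda>z. - poly Q z) ` Z" for c
  proof -
    have deg': "degree (Q + [:c:]) = Suc (degree U)"
      using deg by (subst degree_add_eq_left) auto
    have pd: "(pderiv ^^ Suc j) (Q + [:c:]) = (pderiv ^^ j) U" for j
      by (simp add: funpow_Suc_right pderiv_add pderiv_pCons Q del: funpow.simps)
    have nz: "poly (Q + [:c:]) z \<noteq> 0" if "z \<in> Z" for z
      using c that by (auto simp: image_iff add_eq_0_iff)
    show ?thesis
      unfolding separated_derivs_def deg'
    proof (intro conjI allI impI ballI)
      fix j z assume "j < Suc (degree U)" "z \<in> B"
      then show "poly ((pderiv ^^ j) (Q + [:c:])) z \<noteq> 0"
      proof (cases j)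
        case 0
        then show ?thesis using nz[of z] \<open>z \<in> B\<close> by (simp add: Z_def)
      next
        case (Suc i)
        then show ?thesis using U(1) \<open>z \<in> B\<close> \<open>j < Suc (degree U)\<close>
          unfolding Suc pd separated_derivs_def by simp
      qed
    next
      fix j j' z assume j: "j < j'" "j' \<le> Suc (degree U)"
        and z: "poly ((pderiv ^^ j) (Q + [:c:])) z = 0"
      obtain i' where i': "j' = Suc i'" using j(1) by (cases j') auto
      show "poly ((pderiv ^^ j') (Q + [:c:])) z \<noteq> 0"
      proof (cases j)
        case 0
        have "z \<notin> Z" using nz[of z] z 0 by auto
        then show ?thesis using j unfolding i' pd by (auto simp: Z_def)
      next
        case (Suc i)
        then show ?thesis using U(1) j z unfolding Suc i' pd separated_derivs_def by auto
      qed
    qed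
  qed
  then have "{c. \<not> separated_derivs B (Q + [:c:])} \<subseteq> (\<lambda>z. - poly Q z) ` Z" by blast
  ultimately show ?thesis using deg finite_subset by blast
qed

lemma separated_derivs_exists:
  assumes "finite B"
  shows "\<exists>U. separated_derivs B U \<and> U \<noteq> 0 \<and> degree U = k"
proof (induction k)
  case 0
  then show ?case by (intro exI[of _ 1]) (auto simp: separated_derivs_def)
next
  case (Suc k)
  then obtain U where "separated_derivs B U" "U \<noteq> 0" "degree U = k" by blast
  then obtain Q where Q: "degree Q = Suc k" "finite {c. \<not> separated_derivs B (Q + [:c:])}"
    using separated_derivs_antiderivative assms by blast
  then obtain c where c: "separated_derivs B (Q + [:c:])"
    using ex_new_if_finite[OF infinite_UNIV_char_0] by blast
  have "degree (Q + [:c:]) = Suc k" using Q(1) by (subst degree_add_eq_left) auto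
  then show ?case using c by (metis degree_0 nat.distinct(1))
qed

lemma card_roots_separated:
  assumes "separated_derivs B U" "j < degree U"
  shows "card {z. poly ((pderiv ^^ j) U) z = 0} = degree U - j"
proof -
  let ?p = "(pderiv ^^ j) U"
  have "U \<noteq> 0" using assms(2) by auto
  then have "?p \<noteq> 0" using higher_pderiv_nonzero assms(2) by simp
  have "\<not> (poly ?p z = 0 \<and> poly (pderiv ?p) z = 0)" for z
    using assms unfolding separated_derivs_def by (metis Suc_leI funpow.simps(2) lessI o_apply)
  then have "rsquarefree ?p" by (simp add: rsquarefree_roots)
  then have "?p = smult (lead_coeff ?p) (\<Prod>z|poly ?p z = 0. [:-z, 1:])"
    by (rule complex_poly_decompose_rsquarefree[symmetric])
  then have "degree ?p = degree (\<Prod>z|poly ?p z = 0. [:-z, 1:])"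
    using \<open>?p \<noteq> 0\<close> by (metis degree_smult_eq leading_coeff_0_iff)
  also have "\<dots> = card {z. poly ?p z = 0}" by (subst degree_prod_sum_eq) auto
  finally show ?thesis by (simp add: degree_higher_pderiv)
qed

lemma iterated_antiderivative:
  "\<exists>P. (pderiv ^^ a) P = U \<and> (\<forall>j<a. poly ((pderiv ^^ j) P) (\<mu> j :: complex) = 0)"
proof (induction a arbitrary: \<mu>)
  case 0
  then show ?case by auto
next
  case (Suc a)
  obtain Q where Q: "(pderiv ^^ a) Q = U" "\<forall>j<a. poly ((pderiv ^^ j) Q) (\<mu> (Suc j)) = 0"
    using Suc[of "\<lambda>j. \<mu> (Suc j)"] by blast
  obtain R where R: "pderiv R = Q" using antiderivative_exists by blast
  define P where "P = R - [:poly R (\<mu> 0):]"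
  have pd: "(pderiv ^^ Suc j) P = (pderiv ^^ j) Q" for j
    by (simp add: funpow_Suc_right P_def pderiv_diff pderiv_pCons R del: funpow.simps)
  have "poly ((pderiv ^^ j) P) (\<mu> j) = 0" if "j < Suc a" for j
  proof (cases j)
    case (Suc i)
    then show ?thesis using that Q(2) unfolding Suc pd by simp
  qed (simp add: P_def)
  then show ?case using pd Q(1) by blast
qed

section \<open>Dope matrices with two independent parts\<close>

text \<open>
  The first \<open>m1\<close> rows carry one zero in each of the first \<open>a\<close> columns, and the next \<open>m2\<close> rows carry one zero in
  the columns from \<open>a\<close> on. Let \<open>P1\<close> be a polynomial of degree \<open>a\<close> with exactly the zeros required in the first part,
  and \<open>P0\<close> an iterated integral of \<open>U0\<close> with these zeros. In \<open>P = P0 + (c / \<kappa>) P1\<close> the constant \<open>c\<close>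
  shifts the derivative \<open>U\<close> of order \<open>a\<close>. All but finitely many values of \<open>c\<close> avoid further zeros in the
  first part and make the roots of the derivatives of \<open>U\<close> simple and distinct, so that the points of the second
  part can be placed on prescribed ones. The remaining points are arbitrary.
\<close>

lemma dope_matrix_two_parts:
  assumes n: "a + k = n" "0 < k" and m: "m1 + m2 \<le> m"
    and \<iota>: "\<And>j. j < a \<Longrightarrow> \<iota> j < m1"
    and f: "\<And>p. p < m2 \<Longrightarrow> f p < k" "\<And>j. j < k \<Longrightarrow> card {p. p < m2 \<and> f p = j} \<le> k - j"
  obtains M where "M \<in> dope_matrices m n"
    "\<And>i j. i < m1 \<Longrightarrow> j < a \<Longrightarrow> M $$ (i, j) = (if i = \<iota> j then 1 else 0)"
    "\<And>p j. p < m2 \<Longrightarrow> j < k \<Longrightarrow> M $$ (m1 + p, a + j) = (if f p = j then 1 else 0)"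
proof -
  define S where "S = (\<lambda>j. (\<iota> j, j)) ` {..<a}"
  have inj: "inj_on (\<lambda>j. (\<iota> j, j)) A" for A by (auto simp: inj_on_def)
  have S: "S \<subseteq> {..<m1} \<times> {..<a}" "card S = a" using \<iota> by (auto simp: S_def card_image inj)
  have "l \<le> card {t\<in>S. snd t < l}" if "l \<le> a" for l
  proof -
    have "{t\<in>S. snd t < l} = (\<lambda>j. (\<iota> j, j)) ` {..<l}" using that by (auto simp: S_def)
    then show ?thesis by (simp add: card_image inj)
  qed
  then obtain \<Lambda> :: "nat \<Rightarrow> complex" and P1 where P1: "inj_on \<Lambda> {..<m1}" "degree P1 = a" "P1 \<noteq> 0"
    "\<And>i j. i < m1 \<Longrightarrow> j < a \<Longrightarrow> poly ((pderiv ^^ j) P1) (\<Lambda> i) = 0 \<longleftrightarrow> (i, j) \<in> S"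
    using exact_pattern_realizable[OF S] by blast
  have "degree ((pderiv ^^ a) P1) = 0" using P1(2) by (simp add: degree_higher_pderiv)
  then obtain \<kappa> where \<kappa>: "(pderiv ^^ a) P1 = [:\<kappa>:]" by (rule degree_eq_zeroE)
  have "\<kappa> \<noteq> 0" using higher_pderiv_nonzero[of P1 a] P1(2,3) \<kappa> by auto
  define B where "B = \<Lambda> ` {..<m1}"
  have "finite B" by (simp add: B_def)
  obtain U' where "separated_derivs B U'" "U' \<noteq> 0" "degree U' = k - 1"
    using separated_derivs_exists \<open>finite B\<close> by blast
  then obtain U0 where U0: "degree U0 = k" "finite {c. \<not> separated_derivs B (U0 + [:c:])}"
    using separated_derivs_antiderivative[of B U'] \<open>finite B\<close> n(2) by auto
  obtain P0 where P0: "(pderiv ^^ a) P0 = U0" "\<And>j. j < a \<Longrightarrow> poly ((pderiv ^^ j) P0) (\<Lambda> (\<iota> j)) = 0"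
    using iterated_antiderivative[of a U0 "\<lambda>j. \<Lambda> (\<iota> j)"] by blast
  let ?bad = "{c. \<not> separated_derivs B (U0 + [:c:])} \<union>
    (\<lambda>(i, j). - \<kappa> * poly ((pderiv ^^ j) P0) (\<Lambda> i) / poly ((pderiv ^^ j) P1) (\<Lambda> i)) ` ({..<m1} \<times> {..<a})"
  have "finite ?bad" using U0(2) by simp
  then obtain c where c: "c \<notin> ?bad" using ex_new_if_finite[OF infinite_UNIV_char_0] by blast
  define U where "U = U0 + [:c:]"
  define P where "P = P0 + smult (c / \<kappa>) P1"
  have U: "separated_derivs B U" using c by (simp add: U_def)
  have degU: "degree U = k" unfolding U_def using U0(1) n(2) by (subst degree_add_eq_left) auto
  have PU: "(pderiv ^^ a) P = U"
    using \<open>\<kappa> \<noteq> 0\<close> by (simp add: P_def U_def higher_pderiv_add higher_pderiv_smult P0 \<kappa>)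
  then have PU': "(pderiv ^^ (a + j)) P = (pderiv ^^ j) U" for j
    by (simp add: funpow_add add.commute[of a])
  have "degree P - a = k" using PU degU degree_higher_pderiv[of a P] by simp
  then have degP: "degree P = n" using n by simp
  then have "P \<noteq> 0" using n by auto
  have P_zero: "poly ((pderiv ^^ j) P) (\<Lambda> i) = 0 \<longleftrightarrow> i = \<iota> j" if ij: "i < m1" "j < a" for i j
  proof
    assume z: "poly ((pderiv ^^ j) P) (\<Lambda> i) = 0"
    show "i = \<iota> j"
    proof (rule ccontr)
      assume "i \<noteq> \<iota> j"
      then have "poly ((pderiv ^^ j) P1) (\<Lambda> i) \<noteq> 0" using P1(4)[OF ij] by (auto simp: S_def)
      moreover have "poly ((pderiv ^^ j) P0) (\<Lambda> i) + c / \<kappa> * poly ((pderiv ^^ j) P1) (\<Lambda> i) = 0"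
        using z by (simp add: P_def higher_pderiv_add higher_pderiv_smult)
      ultimately have "c = - \<kappa> * poly ((pderiv ^^ j) P0) (\<Lambda> i) / poly ((pderiv ^^ j) P1) (\<Lambda> i)"
        using \<open>\<kappa> \<noteq> 0\<close> by (simp add: field_simps add_eq_0_iff)
      then show False using c ij by (force simp: image_iff)
    qed
  next
    assume "i = \<iota> j"
    then have "poly ((pderiv ^^ j) P1) (\<Lambda> i) = 0" using P1(4)[OF ij] ij by (auto simp: S_def)
    then show "poly ((pderiv ^^ j) P) (\<Lambda> i) = 0"
      using P0(2)[OF ij(2)] \<open>i = \<iota> j\<close> by (simp add: P_def higher_pderiv_add higher_pderiv_smult)
  qed
  define R where "R = (\<lambda>j. {z. poly ((pderiv ^^ j) U) z = 0})"
  have "U \<noteq> 0" using degU n(2) by auto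
  then have finR: "finite (R j)" if "j < k" for j
    using higher_pderiv_nonzero that degU unfolding R_def by (intro poly_roots_finite) auto
  have "\<exists>g. g ` {p. p < m2 \<and> f p = j} \<subseteq> R j \<and> inj_on g {p. p < m2 \<and> f p = j}" if "j < k" for j
    using f(2)[OF that] card_roots_separated[OF U, of j] finR[OF that] that degU
    by (intro card_le_inj) (auto simp: R_def)
  then obtain g where g: "\<And>j. j < k \<Longrightarrow> g j ` {p. p < m2 \<and> f p = j} \<subseteq> R j"
    "\<And>j. j < k \<Longrightarrow> inj_on (g j) {p. p < m2 \<and> f p = j}" by metis
  define \<zeta> where "\<zeta> = (\<lambda>p. g (f p) p)"
  have \<zeta>R: "\<zeta> p \<in> R (f p)" if "p < m2" for p using g(1)[of "f p"] f(1)[OF that] that by (auto simp: \<zeta>_def)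
  have R_disj: "z \<notin> R j'" if "z \<in> R j" "j \<noteq> j'" "j < k" "j' < k" for z j j'
    using that U degU unfolding separated_derivs_def R_def
    by (metis (mono_tags, lifting) less_imp_le linorder_neqE_nat mem_Collect_eq)
  have \<zeta>_inj: "inj_on \<zeta> {..<m2}"
  proof (rule inj_onI)
    fix p q assume pq: "p \<in> {..<m2}" "q \<in> {..<m2}" "\<zeta> p = \<zeta> q"
    have "f p = f q"
    proof (rule ccontr)
      assume "f p \<noteq> f q"
      then have "\<zeta> p \<notin> R (f q)" using pq \<zeta>R[of p] f(1) by (intro R_disj) auto
      then show False using pq \<zeta>R[of q] by simp
    qed
    then show "p = q" using pq inj_onD[OF g(2)[of "f p"], of p q] f(1) by (simp add: \<zeta>_def)
  qed
  have \<zeta>B: "\<zeta> p \<notin> B" if "p < m2" for p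
    using \<zeta>R[OF that] f(1)[OF that] U degU by (auto simp: separated_derivs_def R_def)
  have "finite (B \<union> \<zeta> ` {..<m2})" using \<open>finite B\<close> by (intro finite_UnI finite_imageI) auto
  from Diff_infinite_finite[OF this infinite_UNIV_char_0]
  obtain E where E: "finite E" "card E = m - m1 - m2" "E \<subseteq> UNIV - (B \<union> \<zeta> ` {..<m2})"
    using infinite_arbitrarily_large[of "UNIV - (B \<union> \<zeta> ` {..<m2})" "m - m1 - m2"] by auto
  then obtain es where es: "set es = E" "distinct es" using finite_distinct_list by blast
  define L where "L = map \<Lambda> [0..<m1] @ map \<zeta> [0..<m2] @ es"
  have "length es = m - m1 - m2" using E(2) es distinct_card by metis
  then have lenL: "length L = m" using m by (simp add: L_def)
  have "B \<inter> \<zeta> ` {..<m2} = {}" using \<zeta>B by auto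
  moreover have "E \<inter> (B \<union> \<zeta> ` {..<m2}) = {}" using E(3) by blast
  ultimately have "distinct L" unfolding L_def using P1(1) \<zeta>_inj es
    by (simp add: distinct_map atLeast0LessThan flip: B_def) blast
  have L1: "L ! i = \<Lambda> i" if "i < m1" for i using that by (simp add: L_def nth_append)
  have L2: "L ! (m1 + p) = \<zeta> p" if "p < m2" for p using that by (simp add: L_def nth_append)
  show ?thesis
  proof (rule that[of "dope_matrix P L"])
    show "dope_matrix P L \<in> dope_matrices m n"
      using lenL \<open>distinct L\<close> degP \<open>P \<noteq> 0\<close>
      by (auto simp: dope_matrices_def intro!: exI[of _ P] exI[of _ L])
    fix i j assume "i < m1" "j < a"
    then show "dope_matrix P L $$ (i, j) = (if i = \<iota> j then 1 else 0)"
      using m n degP lenL P_zero[of i j] by (simp add: dope_matrix_def L1)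
  next
    fix p j assume pj: "p < m2" "j < k"
    have "poly ((pderiv ^^ j) U) (\<zeta> p) = 0 \<longleftrightarrow> f p = j"
      using \<zeta>R[OF pj(1)] R_disj[of "\<zeta> p" "f p" j] f(1)[OF pj(1)] pj by (auto simp: R_def)
    then show "dope_matrix P L $$ (m1 + p, a + j) = (if f p = j then 1 else 0)"
      using m n degP lenL pj by (simp add: dope_matrix_def L2 PU')
  qed
qed

text \<open>
  The possible columns \<open>a + j\<close> of the zeros in the second part: \<open>k - j\<close> is the number of roots of the derivative of
  order \<open>j\<close> of a polynomial of degree \<open>k\<close>, if these roots are simple.
\<close>

definition bounded_words :: "nat \<Rightarrow> nat \<Rightarrow> nat list set" where
  "bounded_words k l = {fs. length fs = l \<and> set fs \<subseteq> {..<k} \<and> (\<forall>j<k. count_list fs j \<le> k - j)}"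

lemma finite_bounded_words: "finite (bounded_words k l)"
  by (rule finite_subset[OF _ finite_lists_length_eq[of "{..<k}" l]]) (auto simp: bounded_words_def)

text \<open>
  Injective choices of \<open>l\<close> labelled roots are counted easily, and at most \<open>k ^ l\<close> of them use the same orders.
\<close>

lemma card_bounded_words_ge:
  assumes "l \<le> (\<Sum>j<k. k - j)"
  shows "((\<Sum>j<k. k - j) - l) ^ l \<le> card (bounded_words k l) * k ^ l"
proof -
  define Z where "Z = Sigma {..<k} (\<lambda>j. {..<k - j})"
  have "finite Z" by (simp add: Z_def)
  have cZ: "card Z = (\<Sum>j<k. k - j)" by (simp add: Z_def card_SigmaI)
  let ?L = "{xs. length xs = l \<and> distinct xs \<and> set xs \<subseteq> Z}"
  let ?B = "{ys. set ys \<subseteq> {..<k} \<and> length ys = l}"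
  have "((\<Sum>j<k. k - j) - l) ^ l = (\<Prod>i\<in>{card Z - l + 1..card Z}. card Z - l)"
    using assms cZ by simp
  also have "\<dots> \<le> \<Prod>{card Z - l + 1..card Z}" by (intro prod_mono) auto
  also have "\<dots> = card ?L"
    using assms \<open>finite Z\<close> cZ by (subst card_lists_distinct_length_eq) auto
  also have "\<dots> \<le> card (bounded_words k l \<times> ?B)"
  proof (rule card_inj_on_le)
    show "inj_on (\<lambda>xs. (map fst xs, map snd xs)) ?L"
      by (rule inj_onI) (metis (lifting) Pair_inject zip_map_fst_snd)
    show "finite (bounded_words k l \<times> ?B)"
      using finite_bounded_words finite_lists_length_eq[of "{..<k}" l] by auto
    show "(\<lambda>xs. (map fst xs, map snd xs)) ` ?L \<subseteq> bounded_words k l \<times> ?B"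
    proof (intro image_subsetI)
      fix xs assume xs: "xs \<in> ?L"
      have "count_list (map fst xs) j \<le> k - j" if "j < k" for j
      proof -
        have "count_list (map fst xs) j = length (filter (\<lambda>x. fst x = j) xs)"
          by (induction xs) auto
        also have "\<dots> = card (set (filter (\<lambda>x. fst x = j) xs))"
          using xs distinct_card[of "filter (\<lambda>x. fst x = j) xs"] by simp
        also have "\<dots> \<le> card (Pair j ` {..<k - j})"
          using xs by (intro card_mono) (auto simp: Z_def)
        also have "\<dots> = k - j" by (simp add: card_image inj_on_def)
        finally show ?thesis .
      qed
      then show "(map fst xs, map snd xs) \<in> bounded_words k l \<times> ?B"
        using xs by (fastforce simp: bounded_words_def Z_def)
    qed
  qed
  also have "\<dots> = card (bounded_words k l) * k ^ l"
    using card_lists_length_eq[of "{..<k}" l] by (simp add: card_cartesian_product)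
  finally show ?thesis .
qed

text \<open>
  Both parts can be read off from the matrix.
\<close>

lemma two_parts_le_card_dope_matrices:
  assumes n: "a + k = n" "0 < k" and m: "m1 + m2 \<le> m"
  shows "m1 ^ a * card (bounded_words k m2) \<le> card (dope_matrices m n)"
proof -
  define decode where "decode = (\<lambda>M :: nat mat.
     (restrict (\<lambda>j. THE i. i < m1 \<and> M $$ (i, j) = 1) {..<a},
      map (\<lambda>p. THE j. j < k \<and> M $$ (m1 + p, a + j) = 1) [0..<m2]))"
  have "card (({..<a} \<rightarrow>\<^sub>E {..<m1}) \<times> bounded_words k m2) \<le> card (dope_matrices m n)"
  proof (rule surj_card_le[OF finite_dope_matrices], rule subsetI)
    fix x assume "x \<in> ({..<a} \<rightarrow>\<^sub>E {..<m1}) \<times> bounded_words k m2"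
    then obtain \<iota> fs where x: "x = (\<iota>, fs)" "\<iota> \<in> {..<a} \<rightarrow>\<^sub>E {..<m1}" "fs \<in> bounded_words k m2" by auto
    have fs: "length fs = m2" "\<And>p. p < m2 \<Longrightarrow> fs ! p < k"
      using x(3) nth_mem by (fastforce simp: bounded_words_def)+
    have "card {p. p < m2 \<and> fs ! p = j} \<le> k - j" if "j < k" for j
      using x(3) that fs(1) unfolding bounded_words_def
      by (auto simp: count_list_eq_length_filter length_filter_conv_card eq_commute)
    then obtain M where M: "M \<in> dope_matrices m n"
      "\<And>i j. i < m1 \<Longrightarrow> j < a \<Longrightarrow> M $$ (i, j) = (if i = \<iota> j then 1 else 0)"
      "\<And>p j. p < m2 \<Longrightarrow> j < k \<Longrightarrow> M $$ (m1 + p, a + j) = (if fs ! p = j then 1 else 0)"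
      using dope_matrix_two_parts[OF n m, of \<iota> "\<lambda>p. fs ! p"] x(2) fs(2) by auto
    have "restrict (\<lambda>j. THE i. i < m1 \<and> M $$ (i, j) = 1) {..<a} = \<iota>"
    proof
      fix j
      show "restrict (\<lambda>j. THE i. i < m1 \<and> M $$ (i, j) = 1) {..<a} j = \<iota> j"
      proof (cases "j < a")
        case True
        then have "\<iota> j < m1" using x(2) by auto
        then have "(THE i. i < m1 \<and> M $$ (i, j) = 1) = \<iota> j"
          using M(2)[OF _ True] by (intro the_equality) (auto split: if_splits)
        then show ?thesis using True by simp
      next
        case False
        then show ?thesis using PiE_arb[OF x(2), of j] by simp
      qed
    qed
    moreover have "map (\<lambda>p. THE j. j < k \<and> M $$ (m1 + p, a + j) = 1) [0..<m2] = fs"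
    proof (rule nth_equalityI)
      fix p assume "p < length (map (\<lambda>p. THE j. j < k \<and> M $$ (m1 + p, a + j) = 1) [0..<m2])"
      then have p: "p < m2" by simp
      have "(THE j. j < k \<and> M $$ (m1 + p, a + j) = 1) = fs ! p"
        using M(3)[OF p] fs(2)[OF p] by (intro the_equality) (auto split: if_splits)
      then show "map (\<lambda>p. THE j. j < k \<and> M $$ (m1 + p, a + j) = 1) [0..<m2] ! p = fs ! p"
        using p by simp
    qed (simp add: fs)
    ultimately have "x = decode M" using x(1) by (simp add: decode_def)
    then show "x \<in> decode ` dope_matrices m n" using M(1) by blast
  qed
  then show ?thesis by (simp add: card_cartesian_product card_PiE)
qed

section \<open>Products of linear forms\<close>

definition linear_form :: "(complex poly \<Rightarrow> complex) \<Rightarrow> bool" where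
  "linear_form l \<longleftrightarrow> (\<forall>P Q. l (P + Q) = l P + l Q) \<and> (\<forall>c P. l (smult c P) = c * l P)"

lemma linear_form_add: "linear_form l \<Longrightarrow> l (P + Q) = l P + l Q"
  and linear_form_smult: "linear_form l \<Longrightarrow> l (smult c P) = c * l P"
  by (auto simp: linear_form_def)

lemma linear_form_diff: "linear_form l \<Longrightarrow> l (P - Q) = l P - l Q"
  using linear_form_add[of l P "smult (-1) Q"] linear_form_smult[of l "-1" Q] by simp

text \<open>
  Polynomial functions of the coefficients of a polynomial.
\<close>

inductive polynomial_form :: "(complex poly \<Rightarrow> complex) \<Rightarrow> bool" where
  const: "polynomial_form (\<lambda>_. c)"
| lin: "linear_form l \<Longrightarrow> polynomial_form l"
| add: "polynomial_form p \<Longrightarrow> polynomial_form q \<Longrightarrow> polynomial_form (\<lambda>x. p x + q x)"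
| mult: "polynomial_form p \<Longrightarrow> polynomial_form q \<Longrightarrow> polynomial_form (\<lambda>x. p x * q x)"

lemma polynomial_form_sum:
  "(\<And>a. a \<in> A \<Longrightarrow> polynomial_form (f a)) \<Longrightarrow> polynomial_form (\<lambda>x. \<Sum>a\<in>A. f a x)"
  by (induction A rule: infinite_finite_induct) (auto intro: polynomial_form.intros)

lemma polynomial_form_prod:
  "(\<And>a. a \<in> A \<Longrightarrow> polynomial_form (f a)) \<Longrightarrow> polynomial_form (\<lambda>x. \<Prod>a\<in>A. f a x)"
  by (induction A rule: infinite_finite_induct) (auto intro: polynomial_form.intros)

lemma polynomial_form_translate:
  "polynomial_form p \<Longrightarrow> polynomial_form (\<lambda>x. p (x + v))"
proof (induction rule: polynomial_form.induct)
  case (lin l)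
  then have "(\<lambda>x. l (x + v)) = (\<lambda>x. l x + l v)" by (auto simp: linear_form_add)
  then show ?case using lin by (auto intro: polynomial_form.intros)
qed (auto intro: polynomial_form.intros)

lemma polynomial_form_project:
  "polynomial_form p \<Longrightarrow> linear_form l \<Longrightarrow> polynomial_form (\<lambda>x. p (x - smult (l x) w))"
proof (induction rule: polynomial_form.induct)
  case (lin k)
  then have "linear_form (\<lambda>x. k (x - smult (l x) w))"
    by (simp add: linear_form_def linear_form_diff algebra_simps smult_add_left smult_smult[symmetric]
        del: smult_smult)
  then show ?case by (rule polynomial_form.lin)
qed (auto intro: polynomial_form.intros)

text \<open>
  The map \<open>x \<mapsto> x - l(x) w\<close> is the projection onto the kernel of \<open>l\<close> along \<open>w\<close> when \<open>l w = 1\<close>. Hence a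
  polynomial function that vanishes on the hyperplane is divisible by \<open>l\<close>.
\<close>

lemma polynomial_form_divide:
  assumes "polynomial_form p" and l: "linear_form l"
  shows "\<exists>q. polynomial_form q \<and> (\<forall>x. p x - p (x - smult (l x) w) = l x * q x)"
  using assms(1)
proof (induction rule: polynomial_form.induct)
  case (const c)
  show ?case by (intro exI[of _ "\<lambda>_. 0"]) (auto intro: polynomial_form.const)
next
  case (lin k)
  then show ?case
    by (intro exI[of _ "\<lambda>_. k w"])
       (auto intro: polynomial_form.const simp: linear_form_diff linear_form_smult)
next
  case (add p q)
  obtain p' where p': "polynomial_form p'" "\<forall>x. p x - p (x - smult (l x) w) = l x * p' x"
    using add.IH(1) by (elim exE conjE)
  obtain q' where q': "polynomial_form q'" "\<forall>x. q x - q (x - smult (l x) w) = l x * q' x"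
    using add.IH(2) by (elim exE conjE)
  show ?case
  proof (intro exI conjI allI)
    show "polynomial_form (\<lambda>x. p' x + q' x)" using p'(1) q'(1) by (rule polynomial_form.add)
    fix x
    have "p x + q x - (p (x - smult (l x) w) + q (x - smult (l x) w)) =
        (p x - p (x - smult (l x) w)) + (q x - q (x - smult (l x) w))" by (rule add_diff_add)
    also have "\<dots> = l x * (p' x + q' x)"
      unfolding p'(2)[rule_format] q'(2)[rule_format] by (rule distrib_left[symmetric])
    finally show "p x + q x - (p (x - smult (l x) w) + q (x - smult (l x) w)) = l x * (p' x + q' x)" .
  qed
next
  case (mult p q)
  obtain p' where p': "polynomial_form p'" "\<forall>x. p x - p (x - smult (l x) w) = l x * p' x"
    using mult.IH(1) by (elim exE conjE)
  obtain q' where q': "polynomial_form q'" "\<forall>x. q x - q (x - smult (l x) w) = l x * q' x"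
    using mult.IH(2) by (elim exE conjE)
  show ?case
  proof (intro exI conjI allI)
    show "polynomial_form (\<lambda>x. p x * q' x + p' x * q (x - smult (l x) w))"
      by (intro polynomial_form.add polynomial_form.mult polynomial_form_project mult.hyps p'(1) q'(1) l)
    fix x
    have "p x * q x - p (x - smult (l x) w) * q (x - smult (l x) w) =
        p x * (q x - q (x - smult (l x) w)) + (p x - p (x - smult (l x) w)) * q (x - smult (l x) w)"
      by (simp add: right_diff_distrib left_diff_distrib)
    also have "\<dots> = p x * (l x * q' x) + (l x * p' x) * q (x - smult (l x) w)"
      unfolding p'(2)[rule_format] q'(2)[rule_format] ..
    also have "\<dots> = l x * (p x * q' x + p' x * q (x - smult (l x) w))"
      by (simp add: distrib_left mult.left_commute mult.assoc)
    finally show "p x * q x - p (x - smult (l x) w) * q (x - smult (l x) w) =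
        l x * (p x * q' x + p' x * q (x - smult (l x) w))" .
  qed
qed

lemma polynomial_form_line:
  "polynomial_form p \<Longrightarrow> poly_fun (\<lambda>s. p (x + smult s u))"
proof (induction rule: polynomial_form.induct)
  case (lin l)
  have "(\<lambda>s. l (x + smult s u)) = poly [:l x, l u:]"
    by (auto simp: linear_form_add[OF lin] linear_form_smult[OF lin])
  then show ?case by simp
qed (auto intro: poly_fun_add poly_fun_mult)

lemma polynomial_form_plane:
  "polynomial_form p \<Longrightarrow> \<exists>B. \<forall>s r. p (x + smult r w + smult s u) = poly (poly B [:s:]) r"
proof (induction rule: polynomial_form.induct)
  case (const c)
  show ?case by (intro exI[of _ "[:[:c:]:]"]) auto
next
  case (lin l)
  show ?case
    by (intro exI[of _ "[:[:l x, l w:], [:l u:]:]"])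
       (auto simp: linear_form_add[OF lin] linear_form_smult[OF lin])
next
  case (add p q)
  obtain B where "\<forall>s r. p (x + smult r w + smult s u) = poly (poly B [:s:]) r"
    using add.IH(1) by (elim exE)
  moreover obtain C where "\<forall>s r. q (x + smult r w + smult s u) = poly (poly C [:s:]) r"
    using add.IH(2) by (elim exE)
  ultimately show ?case by (intro exI[of _ "B + C"]) auto
next
  case (mult p q)
  obtain B where "\<forall>s r. p (x + smult r w + smult s u) = poly (poly B [:s:]) r"
    using mult.IH(1) by (elim exE)
  moreover obtain C where "\<forall>s r. q (x + smult r w + smult s u) = poly (poly C [:s:]) r"
    using mult.IH(2) by (elim exE)
  ultimately show ?case by (intro exI[of _ "B * C"]) auto
qed

text \<open>
  Evaluating the coefficients first: this gives access to the degree in \<open>s\<close> for a fixed \<open>r\<close>.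
\<close>

lemma poly_map_poly_eval:
  "poly (map_poly (\<lambda>c. poly c r) B) s = poly (poly B [:s:]) r"
  by (induction B) (simp_all add: map_poly_pCons)

text \<open>
  Every product of distinct entries of \<open>ls\<close> has this property. Unlike the span of these products, the space of all
  functions with this property is easily seen to be compatible with division by an entry of \<open>ls\<close>.
\<close>

definition line_bounded ::
  "complex poly set \<Rightarrow> (complex poly \<Rightarrow> complex) list \<Rightarrow> (complex poly \<Rightarrow> complex) \<Rightarrow> bool" where
  "line_bounded V ls p \<longleftrightarrow> polynomial_form p \<and> (\<forall>x\<in>V. \<forall>u\<in>V. \<exists>q.
     degree q \<le> length (filter (\<lambda>l. l u \<noteq> 0) ls) \<and> (\<forall>s. p (x + smult s u) = poly q s))"

lemma line_bounded_translate:
  assumes V: "poly_subspace V" and "line_bounded V ls p" "v \<in> V"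
  shows "line_bounded V ls (\<lambda>x. p (x + v))"
  unfolding line_bounded_def
proof (intro conjI ballI)
  show "polynomial_form (\<lambda>x. p (x + v))"
    using assms(2) by (auto simp: line_bounded_def intro: polynomial_form_translate)
  fix x u assume "x \<in> V" "u \<in> V"
  moreover have "x + v \<in> V" using poly_subspace_add[OF V] \<open>x \<in> V\<close> assms(3) by simp
  ultimately obtain q where q: "degree q \<le> length (filter (\<lambda>l. l u \<noteq> 0) ls)"
    "\<forall>s. p (x + v + smult s u) = poly q s"
    using assms(2) \<open>u \<in> V\<close> unfolding line_bounded_def by blast
  have eq: "x + smult s u + v = x + v + smult s u" for s by (simp add: ac_simps)
  show "\<exists>q. degree q \<le> length (filter (\<lambda>l. l u \<noteq> 0) ls) \<and>
      (\<forall>s. p (x + smult s u + v) = poly q s)"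
    unfolding eq using q by (intro exI[of _ q] conjI)
qed

lemma line_bounded_divide:
  assumes V: "poly_subspace V" and l: "linear_form l" and w: "w \<in> V" "l w = 1"
    and p: "line_bounded V (l # ls) p" and q: "polynomial_form q"
    and pq: "\<And>x. x \<in> V \<Longrightarrow> p x = l x * q x"
  shows "line_bounded V ls q"
  unfolding line_bounded_def
proof (intro conjI ballI)
  show "polynomial_form q" by fact
  fix x u assume x: "x \<in> V" and u: "u \<in> V"
  let ?N = "length (filter (\<lambda>l. l u \<noteq> 0) ls)"
  have off: "degree Q \<le> ?N"
    if Q: "\<And>s. q (y + smult s u) = poly Q s" and y: "y \<in> V" and nz: "l u \<noteq> 0 \<or> l y \<noteq> 0" for y Q
  proof -
    obtain P where P: "degree P \<le> length (filter (\<lambda>l. l u \<noteq> 0) (l # ls))"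
      "\<And>s. p (y + smult s u) = poly P s"
      using p y u unfolding line_bounded_def by blast
    have "poly P s = poly ([:l y, l u:] * Q) s" for s
      using pq[of "y + smult s u"] y u V
      by (simp add: P(2)[symmetric] Q[symmetric] poly_subspace_add poly_subspace_smult
          linear_form_add[OF l] linear_form_smult[OF l] distrib_left distrib_right)
    then have eq: "P = [:l y, l u:] * Q" by (simp add: poly_eq_poly_eq_iff[symmetric] fun_eq_iff)
    show ?thesis
    proof (cases "Q = 0")
      case False
      then have "degree P = degree [:l y, l u:] + degree Q"
        unfolding eq using nz by (intro degree_mult_eq) auto
      then show ?thesis using P(1) by (auto split: if_splits)
    qed simp
  qed
  show "\<exists>Q. degree Q \<le> ?N \<and> (\<forall>s. q (x + smult s u) = poly Q s)"
  proof (cases "l u \<noteq> 0 \<or> l x \<noteq> 0")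
    case True
    obtain Q where "(\<lambda>s. q (x + smult s u)) = poly Q"
      using polynomial_form_line[OF q] unfolding poly_fun_def by blast
    then have Q: "q (x + smult s u) = poly Q s" for s by (rule fun_cong)
    show ?thesis using off[OF Q x True] Q by blast
  next
    case False
    \<comment> \<open>On a line inside the hyperplane the bound is the limit of the bounds on parallel lines.\<close>
    obtain B where B: "\<And>s r. q (x + smult r w + smult s u) = poly (poly B [:s:]) r"
      using polynomial_form_plane[OF q] by blast
    define Q where "Q = (\<lambda>r. map_poly (\<lambda>c. poly c r) B)"
    have Q: "q (x + smult r w + smult s u) = poly (Q r) s" for s r
      by (simp add: B Q_def poly_map_poly_eval)
    have "degree (Q r) \<le> ?N" if "r \<noteq> 0" for r
    proof (rule off)
      show "q (x + smult r w + smult s u) = poly (Q r) s" for s by (rule Q)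
      show "x + smult r w \<in> V" using V x w by (intro poly_subspace_add poly_subspace_smult)
      show "l u \<noteq> 0 \<or> l (x + smult r w) \<noteq> 0"
        using False that w by (simp add: linear_form_add[OF l] linear_form_smult[OF l])
    qed
    then have zero: "poly (coeff B e) r = 0" if "e > ?N" "r \<noteq> 0" for e r
      using that coeff_eq_0[of "Q r" e] by (force simp: Q_def coeff_map_poly)
    have "coeff B e = 0" if "e > ?N" for e
    proof (rule ccontr)
      assume "coeff B e \<noteq> 0"
      then have "finite {r. poly (coeff B e) r = 0}" by (rule poly_roots_finite)
      then have "finite (insert 0 {r. poly (coeff B e) r = 0})" by simp
      moreover have "insert 0 {r. poly (coeff B e) r = 0} = UNIV" using zero[OF that] by auto
      ultimately show False using infinite_UNIV_char_0[where 'a = complex] by simp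
    qed
    then have "degree (Q 0) \<le> ?N" by (intro degree_le) (simp add: Q_def coeff_map_poly)
    then show ?thesis using Q[of 0] by (intro exI[of _ "Q 0"]) auto
  qed
qed

lemma sum_binomial_Pascal:
  "(\<Sum>k\<le>e. N choose k) + (\<Sum>k\<le>Suc e. N choose k) = (\<Sum>k\<le>Suc e. Suc N choose k)"
  by (induction e) auto

lemma degs_psubset:
  assumes V: "poly_subspace V" "finite (degs V)" and V': "poly_subspace V'" "V' \<subset> V"
  shows "degs V' \<subset> degs V"
proof
  show "degs V' \<subseteq> degs V" using V'(2) by (auto simp: degs_def)
  show "degs V' \<noteq> degs V"
  proof
    assume eq: "degs V' = degs V"
    obtain B where B: "\<And>d. d \<in> degs V' \<Longrightarrow> B d \<in> V' \<and> degree (B d) = d \<and> lead_coeff (B d) = 1"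
      using degs_basis_exists[OF V'(1)] by blast
    have "P \<in> V'" if P: "P \<in> V" for P
    proof -
      obtain c where c: "P = (\<Sum>d\<in>degs V. smult (c d) (B d))"
        using degs_basis_spans[OF V P, of B] B V'(2) unfolding eq by blast
      show ?thesis unfolding c using B eq
        by (intro poly_subspace_sum poly_subspace_smult V') auto
    qed
    then show False using V'(2) by blast
  qed
qed

text \<open>
  Evaluation at the points of \<open>X\<close> is injective on the space of line-bounded functions, so the bound is one for its
  dimension. The recursion is that of deletion and restriction. A function that vanishes on the
  kernel \<open>V'\<close> of the first form \<open>l\<close> is \<open>l\<close> times a function for the other forms; this combines points \<open>X1\<close>
  for \<open>V'\<close> with points \<open>X2\<close> for the other forms on \<open>V\<close>. Translation moves \<open>X2\<close> off the hyperplane.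
\<close>

lemma line_bounded_unisolvent:
  assumes "\<And>l. l \<in> set ls \<Longrightarrow> linear_form l" "poly_subspace V" "finite (degs V)"
  shows "\<exists>X\<subseteq>V. finite X \<and> card X \<le> (\<Sum>k\<le>card (degs V). length ls choose k) \<and>
    (\<forall>p. line_bounded V ls p \<longrightarrow> (\<forall>x\<in>X. p x = 0) \<longrightarrow> (\<forall>x\<in>V. p x = 0))"
  using assms
proof (induction ls arbitrary: V)
  case Nil
  have "p u = 0" if p: "line_bounded V [] p" "p 0 = 0" "u \<in> V" for p u
  proof -
    obtain q where q: "degree q \<le> 0" "\<And>s. p (0 + smult s u) = poly q s"
      using p(1,3) poly_subspace_0[OF Nil(2)] unfolding line_bounded_def by force
    then obtain c where "q = [:c:]" by (auto elim: degree_eq_zeroE)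
    then show ?thesis using q(2)[of 0] q(2)[of 1] p(2) by simp
  qed
  moreover have "1 \<le> (\<Sum>k\<le>card (degs V). 0 choose k)"
    using member_le_sum[of 0 "{..card (degs V)}" "\<lambda>k. 0 choose k"] by simp
  ultimately show ?case using poly_subspace_0[OF Nil(2)] by (intro exI[of _ "{0}"]) auto
next
  case (Cons l ls)
  have l: "linear_form l" using Cons.prems by simp
  note V = Cons.prems(2,3)
  obtain X2 where X2: "X2 \<subseteq> V" "finite X2" "card X2 \<le> (\<Sum>k\<le>card (degs V). length ls choose k)"
    "\<And>p. line_bounded V ls p \<Longrightarrow> (\<forall>x\<in>X2. p x = 0) \<Longrightarrow> (\<forall>x\<in>V. p x = 0)"
    using Cons.IH[of V] Cons.prems by auto
  show ?case
  proof (cases "\<forall>x\<in>V. l x = 0")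
    case True
    then have "line_bounded V ls p" if "line_bounded V (l # ls) p" for p
      using that unfolding line_bounded_def by simp
    moreover have "(\<Sum>k\<le>card (degs V). length ls choose k) \<le>
        (\<Sum>k\<le>card (degs V). length (l # ls) choose k)"
    proof (rule sum_mono)
      show "length ls choose k \<le> length (l # ls) choose k" for k by (cases k) auto
    qed
    ultimately show ?thesis using X2 by (intro exI[of _ X2]) auto
  next
    case False
    then obtain w0 where w0: "w0 \<in> V" "l w0 \<noteq> 0" by blast
    define w where "w = smult (1 / l w0) w0"
    have w: "w \<in> V" "l w = 1"
      using w0 V by (auto simp: w_def linear_form_smult[OF l] intro: poly_subspace_smult)
    define V' where "V' = {x\<in>V. l x = 0}"
    have "l 0 = 0" using linear_form_smult[OF l, of 0 0] by simp
    then have V': "poly_subspace V'"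
      using V unfolding poly_subspace_def V'_def
      by (auto simp: linear_form_add[OF l] linear_form_smult[OF l])
    have "w \<notin> V'" "V' \<subseteq> V" using w by (auto simp: V'_def)
    then have "V' \<subset> V" using w by blast
    then have psub: "degs V' \<subset> degs V" by (rule degs_psubset[OF V V'])
    then have fin': "finite (degs V')" and "card (degs V') < card (degs V)"
      using V finite_subset psubset_card_mono by blast+
    then obtain e where e: "card (degs V) = Suc e" "card (degs V') \<le> e"
      by (cases "card (degs V)") auto
    obtain X1 where X1: "X1 \<subseteq> V'" "finite X1" "card X1 \<le> (\<Sum>k\<le>card (degs V'). length ls choose k)"
      "\<And>p. line_bounded V' ls p \<Longrightarrow> (\<forall>x\<in>X1. p x = 0) \<Longrightarrow> (\<forall>x\<in>V'. p x = 0)"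
      using Cons.IH[of V'] Cons.prems V' fin' by auto
    have "finite ((\<lambda>x. - l x) ` X2)" using X2 by simp
    then obtain r where "r \<notin> (\<lambda>x. - l x) ` X2"
      using ex_new_if_finite[OF infinite_UNIV_char_0] by blast
    then have r: "l (x + smult r w) \<noteq> 0" if "x \<in> X2" for x
      using that w by (auto simp: linear_form_add[OF l] linear_form_smult[OF l] image_iff add_eq_0_iff)
    have rw: "smult r w \<in> V" using w V by (auto intro: poly_subspace_smult)
    define X where "X = X1 \<union> (\<lambda>x. x + smult r w) ` X2"
    have "X \<subseteq> V" using X1 X2 rw V by (auto simp: X_def V'_def intro: poly_subspace_add)
    moreover have "finite X" using X1 X2 by (simp add: X_def)
    moreover have "card X \<le> (\<Sum>k\<le>card (degs V). length (l # ls) choose k)"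
    proof -
      have "card X \<le> card X1 + card X2"
        unfolding X_def by (meson card_Un_le card_image_le X2(2) add_left_mono order_trans)
      also have "card X1 \<le> (\<Sum>k\<le>e. length ls choose k)"
        using X1(3) sum_mono2[of "{..e}" "{..card (degs V')}" "\<lambda>k. length ls choose k"] e by simp
      also have "(\<Sum>k\<le>e. length ls choose k) + card X2 \<le>
          (\<Sum>k\<le>e. length ls choose k) + (\<Sum>k\<le>Suc e. length ls choose k)"
        using X2(3) e by simp
      finally show ?thesis unfolding sum_binomial_Pascal using e by simp
    qed
    moreover have "\<forall>x\<in>V. p x = 0" if p: "line_bounded V (l # ls) p" "\<forall>x\<in>X. p x = 0" for p
    proof -
      have "line_bounded V' ls p"
        unfolding line_bounded_def
      proof (intro conjI ballI)
        show "polynomial_form p" using p(1) by (simp add: line_bounded_def)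
        fix x u assume "x \<in> V'" "u \<in> V'"
        then have xu: "x \<in> V" "u \<in> V" "l u = 0" by (auto simp: V'_def)
        then show "\<exists>q. degree q \<le> length (filter (\<lambda>l. l u \<noteq> 0) ls) \<and>
            (\<forall>s. p (x + smult s u) = poly q s)"
          using p(1)[unfolded line_bounded_def, THEN conjunct2, rule_format, OF xu(1,2)] by simp
      qed
      then have p0: "p x = 0" if "x \<in> V'" for x using X1(4)[of p] p(2) that by (auto simp: X_def)
      obtain q where q: "polynomial_form q" "\<And>x. p x - p (x - smult (l x) w) = l x * q x"
        using polynomial_form_divide[OF _ l] p(1) unfolding line_bounded_def by blast
      have pq: "p x = l x * q x" if "x \<in> V" for x
      proof -
        have "x - smult (l x) w \<in> V'" unfolding V'_def
          using that w V by (auto simp: linear_form_diff[OF l] linear_form_smult[OF l]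
              intro: poly_subspace_diff poly_subspace_smult)
        then show ?thesis using q(2)[of x] p0 by simp
      qed
      have "line_bounded V ls q"
        by (rule line_bounded_divide[OF V(1) l w p(1) q(1) pq])
      then have "line_bounded V ls (\<lambda>x. q (x + smult r w))"
        by (rule line_bounded_translate[OF V(1) _ rw])
      moreover have "q (x + smult r w) = 0" if "x \<in> X2" for x
      proof -
        have "x + smult r w \<in> V" using that X2(1) rw V by (auto intro: poly_subspace_add)
        then show ?thesis using pq[of "x + smult r w"] r[OF that] p(2) that by (auto simp: X_def)
      qed
      ultimately have q0: "\<forall>x\<in>V. q (x + smult r w) = 0" by (intro X2(4)) auto
      have "q x = 0" if "x \<in> V" for x
        using q0[rule_format, of "x - smult r w"] that rw V by (simp add: poly_subspace_diff)
      then show ?thesis using pq by simp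
    qed
    ultimately show ?thesis by (intro exI[of _ X]) auto
  qed
qed

section \<open>The number of zero patterns\<close>

text \<open>
  The functions \<open>f\<^sub>A\<close> whose independence bounds the number of patterns.
\<close>

definition nonzero_product :: "(nat \<times> nat) set \<Rightarrow> (nat \<Rightarrow> complex) \<Rightarrow> complex poly \<Rightarrow> complex" where
  "nonzero_product A \<Lambda> P = (\<Prod>(i, j)\<in>A. poly ((pderiv ^^ j) P) (\<Lambda> i))"

lemma linear_form_eval: "linear_form (\<lambda>P. poly ((pderiv ^^ j) P) z)"
  by (simp add: linear_form_def higher_pderiv_add higher_pderiv_smult)

lemma nonzero_product_combination_line_bounded:
  assumes "finite I" and \<A>: "\<A> \<subseteq> Pow I" and xs: "set xs = I"
  shows "line_bounded V (map (\<lambda>(i, j) P. poly ((pderiv ^^ j) P) (\<Lambda> i)) xs)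
    (\<lambda>P. \<Sum>A\<in>\<A>. c A * nonzero_product A \<Lambda> P)"
  unfolding line_bounded_def
proof (intro conjI ballI)
  let ?l = "\<lambda>(i, j) P. poly ((pderiv ^^ j) P) (\<Lambda> i)"
  have lin: "linear_form (?l t)" for t
    using linear_form_eval by (cases t) simp
  show "polynomial_form (\<lambda>P. \<Sum>A\<in>\<A>. c A * nonzero_product A \<Lambda> P)"
    unfolding nonzero_product_def
    by (intro polynomial_form_sum polynomial_form.mult polynomial_form_prod polynomial_form.const)
       (use lin polynomial_form.lin in \<open>auto split: prod.splits simp: linear_form_eval\<close>)
  fix x u :: "complex poly"
  let ?N = "length (filter (\<lambda>l. l u \<noteq> 0) (map ?l xs))"
  have fin: "finite \<A>" using assms finite_subset by blast
  define q where "q = (\<lambda>A. \<Prod>t\<in>A. [:?l t x, ?l t u:])"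
  have q: "nonzero_product A \<Lambda> (x + smult s u) = poly (q A) s" for A s
    unfolding nonzero_product_def q_def poly_prod
    by (intro prod.cong refl) (auto simp: higher_pderiv_add higher_pderiv_smult)
  have deg: "degree (q A) \<le> ?N" if "A \<in> \<A>" for A
  proof -
    have A: "A \<subseteq> I" "finite A" using that \<A> \<open>finite I\<close> finite_subset by blast+
    have "degree (q A) \<le> (\<Sum>t\<in>A. degree [:?l t x, ?l t u:])"
      unfolding q_def
      using degree_prod_sum_le[OF A(2), of "\<lambda>t. [:?l t x, ?l t u:]", unfolded o_def] .
    also have "\<dots> \<le> (\<Sum>t\<in>A. if ?l t u \<noteq> 0 then 1 else 0)" by (intro sum_mono) auto
    also have "\<dots> \<le> (\<Sum>t\<in>I. if ?l t u \<noteq> 0 then 1 else 0)"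
      using A \<open>finite I\<close> by (intro sum_mono2) auto
    also have "\<dots> = card {t\<in>I. ?l t u \<noteq> 0}"
      using \<open>finite I\<close> by (simp add: sum.If_cases Int_def)
    also have "{t\<in>I. ?l t u \<noteq> 0} = set (filter (\<lambda>t. ?l t u \<noteq> 0) xs)" using xs by auto
    also have "card \<dots> \<le> length (filter (\<lambda>t. ?l t u \<noteq> 0) xs)" by (rule card_length)
    also have "\<dots> = ?N" by (simp add: filter_map o_def)
    finally show ?thesis .
  qed
  show "\<exists>q. degree q \<le> ?N \<and> (\<forall>s. (\<Sum>A\<in>\<A>. c A * nonzero_product A \<Lambda> (x + smult s u)) = poly q s)"
  proof (intro exI conjI allI)
    show "degree (\<Sum>A\<in>\<A>. smult (c A) (q A)) \<le> ?N"
      using deg fin by (intro degree_sum_le order_trans[OF degree_smult_le]) auto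
    show "(\<Sum>A\<in>\<A>. c A * nonzero_product A \<Lambda> (x + smult s u)) =
        poly (\<Sum>A\<in>\<A>. smult (c A) (q A)) s" for s
      by (simp add: poly_sum q)
  qed
qed

lemma nonzero_product_combination_line_poly:
  "line_poly (\<lambda>\<Lambda>. \<Sum>A\<in>\<A>. c A * nonzero_product A \<Lambda> P)"
  unfolding nonzero_product_def
  by (intro line_poly_sum line_poly_mult line_poly_prod line_poly_const) (auto split: prod.splits)

lemma nonzero_product_combination_degree:
  assumes "\<A> \<subseteq> Pow ({..<m} \<times> {..<n})" "degree P \<le> n"
  shows "\<exists>q. degree q \<le> (\<Sum>j<n. n - j) \<and>
    (\<forall>z. (\<Sum>A\<in>\<A>. c A * nonzero_product A (\<Lambda>(i := z)) P) = poly q z)"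
proof (intro exI conjI allI)
  let ?I = "{..<m} \<times> {..<n}"
  define q where "q = (\<lambda>A. \<Prod>t\<in>A. if fst t = i then (pderiv ^^ snd t) P
     else [:poly ((pderiv ^^ snd t) P) (\<Lambda> (fst t)):])"
  have fin: "finite \<A>" using assms finite_subset by blast
  have deg: "degree (q A) \<le> (\<Sum>j<n. n - j)" if "A \<in> \<A>" for A
  proof -
    have A: "A \<subseteq> ?I" "finite A" using that assms finite_subset by blast+
    have "degree (q A) \<le> (\<Sum>t\<in>A. degree (if fst t = i then (pderiv ^^ snd t) P
       else [:poly ((pderiv ^^ snd t) P) (\<Lambda> (fst t)):]))"
      unfolding q_def using degree_prod_sum_le[OF A(2)] by (simp add: o_def)
    also have "\<dots> \<le> (\<Sum>t\<in>A. if fst t = i then n - snd t else 0)"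
      using assms(2) by (intro sum_mono) (auto simp: degree_higher_pderiv intro: diff_le_mono)
    also have "\<dots> \<le> (\<Sum>t\<in>?I. if fst t = i then n - snd t else 0)"
      using A by (intro sum_mono2) auto
    also have "\<dots> = (\<Sum>i'<m. \<Sum>j<n. if i' = i then n - j else 0)"
      by (simp add: sum.cartesian_product case_prod_unfold)
    also have "\<dots> = (\<Sum>i'<m. if i' = i then \<Sum>j<n. n - j else 0)"
      by (intro sum.cong) auto
    also have "\<dots> \<le> (\<Sum>j<n. n - j)" by simp
    finally show ?thesis .
  qed
  show "degree (\<Sum>A\<in>\<A>. smult (c A) (q A)) \<le> (\<Sum>j<n. n - j)"
    using deg fin by (intro degree_sum_le order_trans[OF degree_smult_le]) auto
  have "nonzero_product A (\<Lambda>(i := z)) P = poly (q A) z" for A z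
    unfolding nonzero_product_def q_def poly_prod by (intro prod.cong refl) auto
  then show "(\<Sum>A\<in>\<A>. c A * nonzero_product A (\<Lambda>(i := z)) P) = poly (\<Sum>A\<in>\<A>. smult (c A) (q A)) z" for z
    by (simp add: poly_sum)
qed

text \<open>
  The coordinates are released from the grid one at a time: in each of them \<open>h\<close> has more zeros than its degree
  allows.
\<close>

lemma zero_from_grid:
  fixes h :: "(nat \<Rightarrow> complex) \<Rightarrow> complex"
  assumes local: "\<And>\<Lambda> \<Lambda>'. (\<And>i. i < m \<Longrightarrow> \<Lambda> i = \<Lambda>' i) \<Longrightarrow> h \<Lambda> = h \<Lambda>'"
    and deg: "\<And>\<Lambda> i. \<exists>q. degree q \<le> d \<and> (\<forall>z. h (\<Lambda>(i := z)) = poly q z)"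
    and G: "finite G" "d < card G"
    and zero: "\<And>\<Lambda>. \<Lambda> \<in> {..<m} \<rightarrow>\<^sub>E G \<Longrightarrow> h \<Lambda> = 0"
  shows "h \<Lambda> = 0"
proof -
  have "h \<Lambda> = 0" if "k \<le> m" "\<And>i. k \<le> i \<Longrightarrow> i < m \<Longrightarrow> \<Lambda> i \<in> G" for k \<Lambda>
    using that
  proof (induction k arbitrary: \<Lambda>)
    case 0
    have "h \<Lambda> = h (restrict \<Lambda> {..<m})" by (rule local) simp
    also have "\<dots> = 0" using 0 by (intro zero) auto
    finally show ?case .
  next
    case (Suc k)
    obtain q where q: "degree q \<le> d" "\<And>z. h (\<Lambda>(k := z)) = poly q z" using deg by blast
    have "h (\<Lambda>(k := z)) = 0" if "z \<in> G" for z
    proof (rule Suc.IH)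
      show "k \<le> m" using Suc.prems(1) by simp
      show "(\<Lambda>(k := z)) i \<in> G" if "k \<le> i" "i < m" for i
        using that \<open>z \<in> G\<close> Suc.prems(2)[of i] by (cases "i = k") auto
    qed
    then have sub: "G \<subseteq> {z. poly q z = 0}" using q by auto
    have "q = 0"
    proof (rule ccontr)
      assume "q \<noteq> 0"
      then have "card G \<le> degree q"
        using card_poly_roots_bound[of q] card_mono[OF poly_roots_finite sub] by fastforce
      then show False using q(1) G(2) by simp
    qed
    then show ?case using q(2)[of "\<Lambda> k"] by simp
  qed
  from this[of m \<Lambda>] show ?thesis by simp
qed

text \<open>
  The points for a fixed \<open>\<Lambda>\<close> depend on \<open>\<Lambda>\<close>. Points \<open>x b\<close> at which the evaluations have the largest possible rank
  for some \<open>\<Lambda>\<close> still have this rank for generic \<open>\<Lambda>\<close>, where they therefore test every combination.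
  The values at these points are polynomials in \<open>\<Lambda>\<close>, which are tested on a grid.
\<close>

lemma nonzero_products_unisolvent:
  fixes m n :: nat
  defines "V \<equiv> {P :: complex poly. degree P \<le> n}"
  assumes \<A>: "\<A> \<subseteq> Pow ({..<m} \<times> {..<n})"
  shows "\<exists>Y. finite Y \<and> snd ` Y \<subseteq> V \<and>
    card Y \<le> (\<Sum>k\<le>n + 1. m * n choose k) * ((\<Sum>j<n. n - j) + 1) ^ m \<and>
    (\<forall>c. (\<forall>(\<Lambda>, P)\<in>Y. (\<Sum>A\<in>\<A>. c A * nonzero_product A \<Lambda> P) = 0) \<longrightarrow>
      (\<forall>\<Lambda>. \<forall>P\<in>V. (\<Sum>A\<in>\<A>. c A * nonzero_product A \<Lambda> P) = 0))"
proof -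
  define I where "I = {..<m} \<times> {..<n}"
  define D where "D = (\<Sum>k\<le>n + 1. m * n choose k)"
  define d where "d = (\<Sum>j<n. n - j)"
  have "finite I" by (simp add: I_def)
  then have fin: "finite \<A>" using \<A> finite_subset unfolding I_def by blast
  define g where "g = (\<lambda>c \<Lambda> P. \<Sum>A\<in>\<A>. c A * nonzero_product A \<Lambda> P)"
  have V: "poly_subspace V"
    unfolding poly_subspace_def V_def
    by (auto intro: degree_add_le order_trans[OF degree_smult_le])
  have degsV: "degs V \<subseteq> {..n}" by (auto simp: degs_def V_def)
  then have finV: "finite (degs V)" using finite_subset by blast
  have cardV: "card (degs V) \<le> n + 1" using card_mono[OF _ degsV] by simp
  obtain xs where xs: "set xs = I" "distinct xs" using \<open>finite I\<close> finite_distinct_list by blast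
  have lenxs: "length xs = m * n" using distinct_card[OF xs(2)] xs(1) by (simp add: I_def)
  have points: "\<exists>X\<subseteq>V. finite X \<and> card X \<le> D \<and>
      (\<forall>c. (\<forall>x\<in>X. g c \<Lambda> x = 0) \<longrightarrow> (\<forall>x\<in>V. g c \<Lambda> x = 0))" for \<Lambda>
  proof -
    let ?ls = "map (\<lambda>(i, j) P. poly ((pderiv ^^ j) P) (\<Lambda> i)) xs"
    have "linear_form l" if "l \<in> set ?ls" for l
      using that linear_form_eval by auto
    then obtain X where X: "X \<subseteq> V" "finite X" "card X \<le> (\<Sum>k\<le>card (degs V). length ?ls choose k)"
      "\<And>p. line_bounded V ?ls p \<Longrightarrow> (\<forall>x\<in>X. p x = 0) \<Longrightarrow> (\<forall>x\<in>V. p x = 0)"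
      using line_bounded_unisolvent[OF _ V finV, of ?ls] by blast
    have "line_bounded V ?ls (g c \<Lambda>)" for c
      unfolding g_def
      using nonzero_product_combination_line_bounded[OF \<open>finite I\<close> _ xs(1)] \<A> unfolding I_def by blast
    moreover have "(\<Sum>k\<le>card (degs V). length ?ls choose k) \<le> D"
      unfolding D_def using cardV lenxs by (simp del: sum.atMost_Suc) (intro sum_mono2, auto)
    ultimately show ?thesis using X by (intro exI[of _ X]) auto
  qed
  \<comment> \<open>The largest rank that the evaluations reach for any \<open>\<Lambda>\<close>; it is then the generic rank.\<close>
  define M where "M = (\<lambda>r x C \<Lambda>. mat r r (\<lambda>(b, a). g (C a) \<Lambda> (x b)))"
  define R where "R = (\<lambda>r. \<exists>\<Lambda> x C. (\<forall>b<r. x b \<in> V) \<and> det (M r x C \<Lambda>) \<noteq> 0)"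
  have g_lin: "(\<Sum>a\<in>S. e a * g (C a) \<Lambda> P) = g (\<lambda>A. \<Sum>a\<in>S. e a * C a A) \<Lambda> P" for S e C \<Lambda> P
    unfolding g_def by (simp add: sum_distrib_left sum_distrib_right sum.swap[of _ \<A>] mult.assoc)
  have "R 0" unfolding R_def M_def by (intro exI) auto
  have R_le: "r \<le> D" if "R r" for r
  proof (rule ccontr)
    assume "\<not> r \<le> D"
    obtain \<Lambda> x C where x: "\<And>b. b < r \<Longrightarrow> x b \<in> V" "det (M r x C \<Lambda>) \<noteq> 0"
      using \<open>R r\<close> unfolding R_def by blast
    obtain X where X: "finite X" "card X \<le> D" "\<And>c. (\<forall>x\<in>X. g c \<Lambda> x = 0) \<Longrightarrow> (\<forall>x\<in>V. g c \<Lambda> x = 0)"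
      using points[of \<Lambda>] by blast
    have "\<exists>e. (\<exists>a\<in>{..<r}. e a \<noteq> 0) \<and> (\<forall>y\<in>X. (\<Sum>a\<in>{..<r}. e a * g (C a) \<Lambda> y) = 0)"
      using X \<open>\<not> r \<le> D\<close> by (intro underdetermined_system) auto
    then obtain e where e: "\<exists>a\<in>{..<r}. e a \<noteq> 0" "\<forall>y\<in>X. (\<Sum>a\<in>{..<r}. e a * g (C a) \<Lambda> y) = 0"
      by blast
    have z: "\<forall>y\<in>V. (\<Sum>a\<in>{..<r}. e a * g (C a) \<Lambda> y) = 0"
      using e(2) X(3) unfolding g_lin by blast
    have "M r x C \<Lambda> *\<^sub>v vec r e = 0\<^sub>v r"
      by (rule eq_vecI)
         (use z x(1) in \<open>auto simp: M_def scalar_prod_def lessThan_atLeast0 mult.commute\<close>)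
    moreover have "vec r e \<noteq> 0\<^sub>v r"
    proof
      assume "vec r e = 0\<^sub>v r"
      then have "e a = 0" if "a < r" for a using that by (metis index_vec index_zero_vec(1))
      then show False using e(1) by blast
    qed
    moreover have "M r x C \<Lambda> \<in> carrier_mat r r" by (simp add: M_def)
    ultimately have "det (M r x C \<Lambda>) = 0"
      using det_0_iff_vec_prod_zero vec_carrier[of r e] by blast
    then show False using x(2) by simp
  qed
  define r where "r = Greatest R"
  have "R r" unfolding r_def using \<open>R 0\<close> R_le by (rule GreatestI_nat)
  have notR: "\<not> R (Suc r)" using Greatest_le_nat[of R "Suc r" D] R_le unfolding r_def by auto
  obtain \<Lambda>0 x C where x: "\<And>b. b < r \<Longrightarrow> x b \<in> V" "det (M r x C \<Lambda>0) \<noteq> 0"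
    using \<open>R r\<close> unfolding R_def by blast
  have at_generic: "g c \<Lambda> P = 0"
    if \<Lambda>: "det (M r x C \<Lambda>) \<noteq> 0" and c: "\<And>b. b < r \<Longrightarrow> g c \<Lambda> (x b) = 0" and "P \<in> V" for \<Lambda> c P
  proof (rule ccontr)
    assume nz: "g c \<Lambda> P \<noteq> 0"
    let ?M = "M (Suc r) (x(r := P)) (C(r := c)) \<Lambda>"
    have "?M = four_block_mat (M r x C \<Lambda>) (0\<^sub>m r 1)
        (mat 1 r (\<lambda>(b, a). g (C a) \<Lambda> P)) (mat 1 1 (\<lambda>_. g c \<Lambda> P))"
      by (rule eq_matI) (auto simp: M_def c less_Suc_eq)
    then have "det ?M = det (M r x C \<Lambda>) * det (mat 1 1 (\<lambda>_. g c \<Lambda> P))"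
      by (simp add: det_four_block_mat_upper_right_zero[of _ r _ 1] M_def)
    also have "det (mat 1 1 (\<lambda>_. g c \<Lambda> P)) = g c \<Lambda> P" by (subst det_single) auto
    also have "det (M r x C \<Lambda>) * g c \<Lambda> P \<noteq> 0" using \<Lambda> nz by simp
    finally have "det ?M \<noteq> 0" .
    moreover have "\<forall>b<Suc r. (x(r := P)) b \<in> V"
      using x(1) \<open>P \<in> V\<close> by (auto simp: less_Suc_eq)
    ultimately have "R (Suc r)" unfolding R_def by blast
    then show False using notR by simp
  qed
  define G :: "complex set" where "G = of_nat ` {..d}"
  have G: "finite G" "card G = d + 1" by (auto simp: G_def card_image inj_on_def)
  define Y where "Y = (\<lambda>(b, \<Lambda>). (\<Lambda>, x b)) ` ({..<r} \<times> ({..<m} \<rightarrow>\<^sub>E G))"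
  show ?thesis
  proof (intro exI[of _ Y] conjI allI impI ballI)
    show "finite Y" unfolding Y_def using G by (intro finite_imageI finite_SigmaI finite_PiE) auto
    show "snd ` Y \<subseteq> V" using x(1) by (auto simp: Y_def)
    have "card Y \<le> card ({..<r} \<times> ({..<m} \<rightarrow>\<^sub>E G))"
      unfolding Y_def using G by (intro card_image_le finite_SigmaI finite_PiE) auto
    also have "\<dots> = r * (d + 1) ^ m" by (simp add: card_cartesian_product card_PiE G)
    also have "\<dots> \<le> D * (d + 1) ^ m" using R_le[OF \<open>R r\<close>] by simp
    finally show "card Y \<le> (\<Sum>k\<le>n + 1. m * n choose k) * ((\<Sum>j<n. n - j) + 1) ^ m"
      unfolding D_def d_def .
  next
    fix c \<Lambda> P
    assume c: "\<forall>(\<Lambda>, P)\<in>Y. (\<Sum>A\<in>\<A>. c A * nonzero_product A \<Lambda> P) = 0" and P: "P \<in> V"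
    have "g c \<Lambda> (x b) = 0" if b: "b < r" for b \<Lambda>
    proof (rule zero_from_grid[where h = "\<lambda>\<Lambda>. g c \<Lambda> (x b)" and m = m and d = d and G = G])
      fix \<Lambda> \<Lambda>' :: "nat \<Rightarrow> complex" assume eq: "\<And>i. i < m \<Longrightarrow> \<Lambda> i = \<Lambda>' i"
      have "nonzero_product A \<Lambda> (x b) = nonzero_product A \<Lambda>' (x b)" if "A \<in> \<A>" for A
        unfolding nonzero_product_def
      proof (intro prod.cong refl)
        fix t assume "t \<in> A"
        then have "t \<in> {..<m} \<times> {..<n}" using that \<A> by blast
        then have "fst t < m" by auto
        then show "(case t of (i, j) \<Rightarrow> poly ((pderiv ^^ j) (x b)) (\<Lambda> i)) =
            (case t of (i, j) \<Rightarrow> poly ((pderiv ^^ j) (x b)) (\<Lambda>' i))"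
          by (simp add: eq case_prod_unfold)
      qed
      then show "g c \<Lambda> (x b) = g c \<Lambda>' (x b)" unfolding g_def by (intro sum.cong refl) simp
    next
      show "\<exists>q. degree q \<le> d \<and> (\<forall>z. g c (\<Lambda>(i := z)) (x b) = poly q z)" for \<Lambda> i
        unfolding g_def d_def using x(1)[OF b] \<A>
        by (intro nonzero_product_combination_degree[of _ m]) (auto simp: V_def)
    next
      fix \<Lambda> assume "\<Lambda> \<in> {..<m} \<rightarrow>\<^sub>E G"
      then have "(\<Lambda>, x b) \<in> Y" using b by (force simp: Y_def)
      then show "g c \<Lambda> (x b) = 0" using c by (auto simp: g_def)
    qed (use G in auto)
    then have gen: "g c \<Lambda> P = 0" if "det (M r x C \<Lambda>) \<noteq> 0" for \<Lambda>
      using at_generic[OF that _ P] by blast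
    have lp: "line_poly (\<lambda>\<Lambda>. g c \<Lambda> P)" for c P
      unfolding g_def by (rule nonzero_product_combination_line_poly)
    then have "line_poly (\<lambda>\<Lambda>. det (M r x C \<Lambda>))"
      unfolding M_def by (intro line_poly_det)
    then have "generic (\<lambda>\<Lambda>. det (M r x C \<Lambda>) \<noteq> 0)" using x(2) by (rule genericI)
    then have "g c \<Lambda> P = 0" using line_poly_zero_if_generic[OF lp] gen by blast
    then show "(\<Sum>A\<in>\<A>. c A * nonzero_product A \<Lambda> P) = 0" by (simp add: g_def)
  qed
qed

text \<open>
  If \<open>\<A>\<close> were larger, a nontrivial combination of the products would vanish at all test points and hence everywhere.
  Evaluate it at the pair that realizes a smallest \<open>A\<close> with a nonzero coefficient: all other terms vanish.
\<close>

lemma card_nonzero_patterns_le: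
  assumes \<A>: "\<A> \<subseteq> Pow ({..<m} \<times> {..<n})"
    and real: "\<And>A. A \<in> \<A> \<Longrightarrow> \<exists>\<Lambda> P. degree P \<le> n \<and>
      (\<forall>i<m. \<forall>j<n. poly ((pderiv ^^ j) P) (\<Lambda> i :: complex) \<noteq> 0 \<longleftrightarrow> (i, j) \<in> A)"
  shows "card \<A> \<le> (\<Sum>k\<le>n + 1. m * n choose k) * ((\<Sum>j<n. n - j) + 1) ^ m"
proof (rule ccontr)
  assume contr: "\<not> ?thesis"
  have fin: "finite \<A>" using \<A> finite_subset by blast
  obtain Y where Y: "finite Y" "snd ` Y \<subseteq> {P. degree P \<le> n}"
    "card Y \<le> (\<Sum>k\<le>n + 1. m * n choose k) * ((\<Sum>j<n. n - j) + 1) ^ m"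
    "\<And>c. (\<forall>(\<Lambda>, P)\<in>Y. (\<Sum>A\<in>\<A>. c A * nonzero_product A \<Lambda> P) = 0) \<Longrightarrow>
      (\<forall>\<Lambda>. \<forall>P\<in>{P. degree P \<le> n}. (\<Sum>A\<in>\<A>. c A * nonzero_product A \<Lambda> P) = 0)"
    using nonzero_products_unisolvent[OF \<A>] by blast
  have "\<exists>c. (\<exists>A\<in>\<A>. c A \<noteq> 0) \<and>
      (\<forall>y\<in>Y. (\<Sum>A\<in>\<A>. c A * (\<lambda>(\<Lambda>, P). nonzero_product A \<Lambda> P) y) = 0)"
    using Y(1,3) fin contr by (intro underdetermined_system) auto
  then obtain c where c: "\<exists>A\<in>\<A>. c A \<noteq> 0"
    "\<forall>(\<Lambda>, P)\<in>Y. (\<Sum>A\<in>\<A>. c A * nonzero_product A \<Lambda> P) = 0" by (auto simp: case_prod_unfold)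
  then have zero: "(\<Sum>A\<in>\<A>. c A * nonzero_product A \<Lambda> P) = 0" if "degree P \<le> n" for \<Lambda> P
    using Y(4) that by blast
  define \<B> where "\<B> = {A\<in>\<A>. c A \<noteq> 0}"
  have "finite \<B>" "\<B> \<noteq> {}" using fin c(1) by (auto simp: \<B>_def)
  then have "arg_min_on card \<B> \<in> \<B>" by (rule arg_min_if_finite(1))
  then obtain A where A: "A \<in> \<B>" "\<And>B. B \<in> \<B> \<Longrightarrow> card A \<le> card B"
    using arg_min_least[OF \<open>finite \<B>\<close> \<open>\<B> \<noteq> {}\<close>, of _ card] by blast
  obtain \<Lambda> :: "nat \<Rightarrow> complex" and P where P: "degree P \<le> n"
    "\<And>i j. i < m \<Longrightarrow> j < n \<Longrightarrow> poly ((pderiv ^^ j) P) (\<Lambda> i) \<noteq> 0 \<longleftrightarrow> (i, j) \<in> A"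
    using real A(1) unfolding \<B>_def by blast
  have fin_sub: "finite B" if "B \<in> \<A>" for B using that \<A> finite_subset by blast
  have "c B * nonzero_product B \<Lambda> P = 0" if "B \<in> \<A> - {A}" for B
  proof (cases "c B = 0")
    case False
    have "\<not> B \<subseteq> A"
    proof
      assume "B \<subseteq> A"
      moreover have "card A \<le> card B" using A(2)[of B] False that by (auto simp: \<B>_def)
      ultimately have "B = A"
        using card_seteq[of A B] fin_sub A(1) by (auto simp: \<B>_def)
      then show False using that by simp
    qed
    then obtain i j where ij: "(i, j) \<in> B" "(i, j) \<notin> A" by auto
    then have "i < m" "j < n" using that \<A> by auto
    then have "poly ((pderiv ^^ j) P) (\<Lambda> i) = 0" using P(2) ij(2) by blast
    then show ?thesis
      unfolding nonzero_product_def using ij(1) that fin_sub[of B]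
      by (auto intro!: prod_zero bexI[of _ "(i, j)"])
  qed simp
  then have "(\<Sum>B\<in>\<A> - {A}. c B * nonzero_product B \<Lambda> P) = 0" by (intro sum.neutral ballI)
  then have "(\<Sum>B\<in>\<A>. c B * nonzero_product B \<Lambda> P) = c A * nonzero_product A \<Lambda> P"
    using A(1) fin by (subst sum.remove[of _ A]) (auto simp: \<B>_def)
  moreover have "nonzero_product A \<Lambda> P \<noteq> 0"
  proof -
    have "A \<in> \<A>" using A(1) by (simp add: \<B>_def)
    then have "poly ((pderiv ^^ snd t) P) (\<Lambda> (fst t)) \<noteq> 0" if "t \<in> A" for t
      using P(2)[of "fst t" "snd t"] that \<A> by fastforce
    then show ?thesis
      unfolding nonzero_product_def using fin_sub[OF \<open>A \<in> \<A>\<close>] by (auto simp: case_prod_unfold)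
  qed
  ultimately show False using zero[OF P(1), of \<Lambda>] A(1) by (simp add: \<B>_def)
qed

lemma card_dope_matrices_le:
  "card (dope_matrices m n) \<le> (\<Sum>k\<le>n + 1. m * n choose k) * ((\<Sum>j<n. n - j) + 1) ^ m"
proof -
  define nz where "nz = (\<lambda>M :: nat mat. {(i, j). i < m \<and> j < n \<and> M $$ (i, j) = 0})"
  have entries: "dim_row M = m" "dim_col M = n + 1"
    "\<And>i j. i < m \<Longrightarrow> j \<le> n \<Longrightarrow> M $$ (i, j) = 0 \<or> M $$ (i, j) = 1"
    "\<And>i. i < m \<Longrightarrow> M $$ (i, n) = 0" if M_in: "M \<in> dope_matrices m n" for M
  proof -
    obtain P L where M: "M = dope_matrix P L" "P \<noteq> 0" "degree P = n" "length L = m"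
      using M_in by (auto simp: dope_matrices_def)
    show "dim_row M = m" "dim_col M = n + 1" using M by (auto simp: dope_matrix_def)
    show "M $$ (i, j) = 0 \<or> M $$ (i, j) = 1" if "i < m" "j \<le> n" for i j
      using that M by (auto simp: dope_matrix_def)
    have "degree ((pderiv ^^ n) P) = 0" using M by (simp add: degree_higher_pderiv)
    then obtain c where c: "(pderiv ^^ n) P = [:c:]" by (rule degree_eq_zeroE)
    have "(pderiv ^^ n) P \<noteq> 0" using M by (intro higher_pderiv_nonzero) auto
    then have "poly ((pderiv ^^ n) P) z \<noteq> 0" for z by (simp add: c)
    then show "M $$ (i, n) = 0" if "i < m" for i
      using that M by (simp add: dope_matrix_def)
  qed
  have "inj_on nz (dope_matrices m n)"
  proof (rule inj_onI)
    fix M M' assume M: "M \<in> dope_matrices m n" "M' \<in> dope_matrices m n" "nz M = nz M'"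
    show "M = M'"
    proof (rule eq_matI)
      fix i j assume "i < dim_row M'" "j < dim_col M'"
      then have ij: "i < m" "j \<le> n" using entries(1,2)[OF M(2)] by auto
      show "M $$ (i, j) = M' $$ (i, j)"
      proof (cases "j = n")
        case True
        then show ?thesis using entries(4) M ij by simp
      next
        case False
        then have "M $$ (i, j) = 0 \<longleftrightarrow> M' $$ (i, j) = 0"
        proof -
          have "(i, j) \<in> nz M \<longleftrightarrow> (i, j) \<in> nz M'" using M(3) by simp
          then show ?thesis using ij False by (simp add: nz_def)
        qed
        then show ?thesis using entries(3)[OF M(1) ij] entries(3)[OF M(2) ij] by auto
      qed
    qed (use entries(1,2) M in auto)
  qed
  then have "card (dope_matrices m n) = card (nz ` dope_matrices m n)"
    by (simp add: card_image)
  also have "\<dots> \<le> (\<Sum>k\<le>n + 1. m * n choose k) * ((\<Sum>j<n. n - j) + 1) ^ m"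
  proof (rule card_nonzero_patterns_le)
    show "nz ` dope_matrices m n \<subseteq> Pow ({..<m} \<times> {..<n})" by (auto simp: nz_def)
    fix A assume "A \<in> nz ` dope_matrices m n"
    then obtain P L where A: "A = nz (dope_matrix P L)" "degree P = n" "length L = m"
      by (auto simp: dope_matrices_def)
    show "\<exists>\<Lambda> P. degree P \<le> n \<and>
      (\<forall>i<m. \<forall>j<n. poly ((pderiv ^^ j) P) (\<Lambda> i :: complex) \<noteq> 0 \<longleftrightarrow> (i, j) \<in> A)"
      using A by (intro exI[of _ "\<lambda>i. L ! i"] exI[of _ P]) (auto simp: nz_def dope_matrix_def)
  qed
  finally show ?thesis .
qed

section \<open>Asymptotics\<close>

lemma two_times_sum_degrees: "2 * (\<Sum>j<n. n - j) = n * (n + 1)" for n :: nat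
proof -
  have "(\<Sum>j<n. n - j) = (\<Sum>j<n. Suc (n - Suc j))" by (intro sum.cong) auto
  also have "\<dots> = (\<Sum>j<n. Suc j)" by (rule sum.nat_diff_reindex)
  also have "2 * \<dots> = n * (n + 1)" by (induction n) auto
  finally show ?thesis .
qed

lemma ln_binomial_bounds:
  assumes "n \<ge> 1" "m \<ge> 1"
  shows "n * ln m \<le> ln (m * n choose n)" "ln (m * n choose n) \<le> n * ln m + n"
proof -
  have pos: "0 < m * n choose n" using assms by simp
  have "real m ^ n = (real (m * n) / real n) ^ n" using assms by simp
  also have "\<dots> \<le> real (m * n choose n)"
    using assms by (intro binomial_ge_n_over_k_pow_k) auto
  finally have "ln (real m ^ n) \<le> ln (m * n choose n)"
    using assms by (subst ln_le_cancel_iff) auto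
  then show "n * ln m \<le> ln (m * n choose n)" using assms by (simp add: ln_realpow)
  have "real n ^ n /\<^sub>R fact n \<le> exp (real n)"
    using sum_le_suminf[OF summable_exp_generic[of "real n"], of "{n}"] by (simp add: exp_def)
  then have "real n ^ n \<le> exp (real n) * fact n" by (simp add: field_simps)
  then have "real (m * n choose n) * real n ^ n \<le> real (m * n choose n) * (exp (real n) * fact n)"
    by (intro mult_left_mono) auto
  also have "\<dots> = real ((m * n choose n) * fact n) * exp (real n)" by simp
  also have "\<dots> \<le> real ((m * n) ^ n) * exp (real n)"
    by (intro mult_right_mono of_nat_mono binomial_fact_pow) auto
  also have "\<dots> = (real m ^ n * exp (real n)) * real n ^ n" by (simp add: power_mult_distrib)
  finally have "real (m * n choose n) \<le> real m ^ n * exp (real n)"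
    using assms by (simp add: mult_le_cancel_right)
  then have "ln (m * n choose n) \<le> ln (real m ^ n * exp (real n))"
    using assms pos by (subst ln_le_cancel_iff) auto
  also have "\<dots> = n * ln m + n" using assms by (simp add: ln_mult ln_realpow)
  finally show "ln (m * n choose n) \<le> n * ln m + n" .
qed

lemma ln_pow_mult_binomial:
  assumes "n \<ge> 1" "m \<ge> 1"
  shows "ln (real (n ^ e * (m * n choose n))) = e * ln n + ln (m * n choose n)"
  using assms by (simp add: ln_mult ln_realpow)

lemma card_dope_matrices_le_binomial:
  assumes "n \<ge> 2" "m \<ge> 2"
  shows "card (dope_matrices m n) \<le> (n + 2) * m * (n ^ (2 * m) * (m * n choose n))"
proof -
  have "(m * n choose k) \<le> m * (m * n choose n)" if "k \<le> n + 1" for k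
  proof (cases "k \<le> n")
    case True
    have "2 * n \<le> m * n" using assms by simp
    then have "(m * n choose k) \<le> (m * n choose n)" using True by (rule binomial_mono[rotated])
    then show ?thesis using assms by (metis le_trans mult_le_mono1 nat_mult_1 one_le_numeral)
  next
    case False
    have "Suc n * (m * n choose Suc n) = (m * n - n) * (m * n choose n)"
      by (metis binomial_absorb_comp binomial_absorption)
    also have "\<dots> \<le> (Suc n * m) * (m * n choose n)"
      by (intro mult_right_mono) (auto simp: mult.commute)
    also have "\<dots> = Suc n * (m * (m * n choose n))" by (rule mult.assoc)
    finally have "(m * n choose Suc n) \<le> m * (m * n choose n)" by (simp only: Suc_mult_le_cancel1)
    moreover have "k = Suc n" using False that by simp
    ultimately show ?thesis by simp
  qed
  then have "(\<Sum>k\<le>n + 1. m * n choose k) \<le> (\<Sum>k\<le>n + 1. m * (m * n choose n))"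
    by (intro sum_mono) auto
  also have "\<dots> = (n + 2) * m * (m * n choose n)" by (simp add: algebra_simps)
  finally have D: "(\<Sum>k\<le>n + 1. m * n choose k) \<le> (n + 2) * m * (m * n choose n)" .
  have "2 * n \<le> n * n" using assms by (intro mult_right_mono) auto
  then have "n + 2 \<le> n * n" using assms by linarith
  then have "(\<Sum>j<n. n - j) + 1 \<le> n ^ 2"
    using two_times_sum_degrees[of n] by (simp add: power2_eq_square)
  then have "((\<Sum>j<n. n - j) + 1) ^ m \<le> (n ^ 2) ^ m" by (rule power_mono) simp
  then have "(\<Sum>k\<le>n + 1. m * n choose k) * ((\<Sum>j<n. n - j) + 1) ^ m \<le>
      (n + 2) * m * (m * n choose n) * (n ^ 2) ^ m"
    by (intro mult_mono[OF D]) simp_all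
  also have "\<dots> = (n + 2) * m * (n ^ (2 * m) * (m * n choose n))"
    unfolding power_mult[of n 2 m] by (simp only: mult_ac)
  finally show ?thesis using card_dope_matrices_le[of m n] by (rule order_trans[rotated])
qed

lemma card_dope_matrices_pos:
  assumes "n \<ge> 1" "m \<ge> 1"
  shows "card (dope_matrices m n) \<ge> 1"
proof (rule ccontr)
  assume "\<not> ?thesis"
  then have "card (dope_matrices m n) = 0" by simp
  then have "(m * n choose n) \<le> 0" using binomial_le_card_dope_matrices[of n m] assms by simp
  moreover have "n \<le> m * n" using assms by simp
  then have "0 < m * n choose n" by (rule zero_less_binomial)
  ultimately show False by simp
qed

lemma ln_card_dope_matrices_upper:
  assumes "\<epsilon> > 0"
  shows "\<exists>N. \<forall>n\<ge>N. \<forall>m\<ge>2. 2 * m \<le> n * (n + 1) \<longrightarrow>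
    ln (card (dope_matrices m n)) \<le> (1 + \<epsilon>) * ln (real (n ^ (2 * m) * (m * n choose n)))"
proof -
  have "eventually (\<lambda>n. 4 * ln (real n) \<le> \<epsilon> * (real n * ln 2)) at_top"
    using assms by real_asymp
  then obtain N where N: "\<And>n. n \<ge> N \<Longrightarrow> 4 * ln (real n) \<le> \<epsilon> * (real n * ln 2)"
    by (auto simp: eventually_at_top_linorder)
  show ?thesis
  proof (intro exI[of _ "max N 2"] allI impI)
    fix n m :: nat assume nm: "max N 2 \<le> n" "2 \<le> m" "2 * m \<le> n * (n + 1)"
    let ?C = "m * n choose n"
    have n2: "n \<ge> 2" using nm by simp
    then have "2 * n \<le> n * n" by (intro mult_right_mono) auto
    then have nn: "n + 2 \<le> n * n" using n2 by linarith
    have "n * (n + 1) \<le> 2 * (n * n)" using nn by simp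
    then have mn: "m \<le> n * n" using nm(3) by linarith
    have C: "n * ln 2 \<le> ln ?C"
    proof -
      have "n * ln 2 \<le> n * ln m" using nm by (intro mult_left_mono) auto
      also have "\<dots> \<le> ln ?C" using nm by (intro ln_binomial_bounds(1)) auto
      finally show ?thesis .
    qed
    have "ln (card (dope_matrices m n)) \<le> ln (real ((n + 2) * m * (n ^ (2 * m) * ?C)))"
      using card_dope_matrices_le_binomial[OF n2 nm(2)] card_dope_matrices_pos[of n m] nm n2
      by (subst ln_le_cancel_iff) (auto simp del: of_nat_mult of_nat_add)
    also have "\<dots> = ln (real (n + 2)) + ln (real m) + ln (real (n ^ (2 * m) * ?C))"
    proof -
      have ln3: "ln (real (a * b * c)) = ln (real a) + ln (real b) + ln (real c)"
        if "a > 0" "b > 0" "c > 0" for a b c :: nat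
        using that by (simp add: ln_mult)
      show ?thesis by (rule ln3) (use nm n2 in auto)
    qed
    also have "ln (real (n + 2)) \<le> ln (real (n * n))"
      using nn n2 by (subst ln_le_cancel_iff) (auto simp del: of_nat_mult of_nat_add)
    also have "ln (real m) \<le> ln (real (n * n))"
      using mn nm n2 by (subst ln_le_cancel_iff) (auto simp del: of_nat_mult)
    also have "ln (real (n * n)) = 2 * ln n" using n2 by (simp add: ln_mult)
    also have "2 * ln (real n) + 2 * ln (real n) \<le> \<epsilon> * ln ?C"
    proof -
      have "4 * ln (real n) \<le> \<epsilon> * (real n * ln 2)" using N nm by simp
      also have "\<dots> \<le> \<epsilon> * ln ?C" using C assms by (intro mult_left_mono) simp_all
      finally show ?thesis by simp
    qed
    also have "ln ?C \<le> ln (real (n ^ (2 * m) * ?C))"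
      using n2 nm by (simp add: ln_mult ln_realpow)
    finally show "ln (card (dope_matrices m n)) \<le> (1 + \<epsilon>) * ln (real (n ^ (2 * m) * ?C))"
      using assms by (simp add: algebra_simps)
  qed
qed

text \<open>
  The hypothesis on \<open>b\<close> says that, even after \<open>m2\<close> of the \<open>k (k + 1) / 2\<close> roots have been used, there are at least
  \<open>b\<close> of them left per order on average.
\<close>

lemma two_parts_ln_le:
  fixes a k n m1 m2 m :: nat and b :: real
  assumes n: "a + k = n" "0 < k" and m: "m1 + m2 \<le> m" and m1: "m1 > 0 \<or> a = 0"
    and b: "real m2 + b * k \<le> k * (k + 1) / 2" "b > 0"
  shows "a * ln m1 + m2 * ln b \<le> ln (card (dope_matrices m n))"
proof -
  let ?T = "\<Sum>j<k. k - j" and ?W = "card (bounded_words k m2)"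
  have T: "real ?T = k * (k + 1) / 2"
    using two_times_sum_degrees[of k, THEN arg_cong[of _ _ real]] by simp
  have bk: "b * k > 0" using b n by simp
  then have "real m2 \<le> real ?T" using b T by linarith
  then have m2: "m2 \<le> ?T" by linarith
  have "(b * k) ^ m2 \<le> real (?T - m2) ^ m2"
  proof (rule power_mono)
    have "real (?T - m2) = real ?T - real m2" using m2 by (rule of_nat_diff)
    then show "b * k \<le> real (?T - m2)" using b(1) T by linarith
  qed (use bk in simp)
  also have "\<dots> \<le> real ?W * real k ^ m2"
    using of_nat_mono[OF card_bounded_words_ge[OF m2], where 'a = real] by simp
  finally have "b ^ m2 \<le> real ?W" using n by (simp add: power_mult_distrib)
  then have "real m1 ^ a * b ^ m2 \<le> real (m1 ^ a * ?W)" by (simp add: mult_left_mono)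
  also have "\<dots> \<le> card (dope_matrices m n)"
    using two_parts_le_card_dope_matrices[OF n m] by (simp only: of_nat_le_iff)
  finally have le: "real m1 ^ a * b ^ m2 \<le> card (dope_matrices m n)" .
  have pos: "real m1 ^ a > 0" "b ^ m2 > 0" using m1 b by auto
  then have prod: "real m1 ^ a * b ^ m2 > 0" by (rule mult_pos_pos)
  then have "real (card (dope_matrices m n)) > 0" using le by linarith
  then have "ln (real m1 ^ a * b ^ m2) \<le> ln (card (dope_matrices m n))"
    using le prod by simp
  moreover have "ln (real m1 ^ a * b ^ m2) = a * ln m1 + m2 * ln b"
    using pos b m1 by (auto simp: ln_mult ln_realpow)
  ultimately show ?thesis by simp
qed

lemma ln_card_dope_matrices_few_points:
  assumes "0 < \<epsilon>" "\<epsilon> < 1"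
  shows "\<exists>N. \<forall>n\<ge>N. \<forall>m\<ge>2. real m \<le> sqrt n \<longrightarrow>
    (1 - \<epsilon>) * ln (real (n ^ m * (m * n choose n))) \<le> ln (card (dope_matrices m n))"
proof -
  have "eventually (\<lambda>n. (sqrt (real n) + 1) * ln (real n) \<le> \<epsilon> * (real n * ln 2)) at_top"
    using assms by real_asymp
  then obtain N where N: "\<And>n. n \<ge> N \<Longrightarrow> (sqrt (real n) + 1) * ln (real n) \<le> \<epsilon> * (real n * ln 2)"
    by (auto simp: eventually_at_top_linorder)
  show ?thesis
  proof (intro exI[of _ "max N 1"] allI impI)
    fix n m :: nat assume nm: "max N 1 \<le> n" "2 \<le> m" "real m \<le> sqrt n"
    let ?C = "m * n choose n" and ?c = "card (dope_matrices m n)"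
    have n1: "n \<ge> 1" using nm by simp
    have c: "?c \<ge> 1" using card_dope_matrices_pos nm by simp
    have "n * ln 2 \<le> n * ln m" using nm by (intro mult_left_mono) auto
    also have "\<dots> \<le> ln ?C" using nm by (intro ln_binomial_bounds(1)) auto
    finally have C: "n * ln 2 \<le> ln ?C" .
    have "ln ?C \<le> ln (real (n * ?c))"
      using binomial_le_card_dope_matrices[of n m] nm c by (subst ln_le_cancel_iff) (auto simp del: of_nat_mult)
    also have "\<dots> = ln n + ln ?c" using n1 c by (simp add: ln_mult)
    finally have 1: "ln ?C - ln n \<le> ln ?c" by simp
    have "(real m + 1) * ln n \<le> (sqrt n + 1) * ln n"
      using nm n1 by (intro mult_right_mono) auto
    also have "\<dots> \<le> \<epsilon> * (n * ln 2)" using N[of n] nm by simp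
    also have "\<dots> \<le> \<epsilon> * ln ?C" using C assms by (intro mult_left_mono) auto
    finally have 2: "(real m + 1) * ln n \<le> \<epsilon> * ln ?C" .
    have "(1 - \<epsilon>) * (m * ln n + ln ?C) = m * ln n + ln ?C - \<epsilon> * ln ?C - \<epsilon> * (m * ln n)"
      by (simp add: algebra_simps)
    also have "\<dots> \<le> ln ?C - ln n"
    proof -
      have "0 \<le> \<epsilon> * (m * ln n)" using assms n1 by simp
      moreover have "(real m + 1) * ln n = m * ln n + ln n" by (simp add: algebra_simps)
      ultimately show ?thesis using 2 by linarith
    qed
    finally show "(1 - \<epsilon>) * ln (real (n ^ m * ?C)) \<le> ln ?c"
      using 1 n1 nm by (subst ln_pow_mult_binomial) auto
  qed
qed

text \<open>
  With \<open>L = ln n\<close> and \<open>K = ln m\<close>, the logarithm of \<open>n ^ m (m n choose n)\<close> is at most \<open>m L + n K + n\<close>, and \<open>two_parts_ln_le\<close> yields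
  \<open>a ln m1 + m2 ln b\<close> with \<open>b = \<delta>\<^sup>2 n / 4\<close>. Here \<open>ln b\<close> and, if \<open>a > 0\<close>,
  \<open>ln m1\<close> fall short of \<open>L\<close> and \<open>K\<close> by bounded amounts only, which are negligible as \<open>K \<ge> L / 2\<close>.
\<close>

lemma ln_card_dope_matrices_many_points:
  assumes \<delta>: "0 < \<delta>" "\<delta> < 1 / 4"
  shows "\<exists>N. \<forall>n\<ge>N. \<forall>m\<ge>2. sqrt n < real m \<longrightarrow> 2 * m \<le> n * (n + 1) \<longrightarrow>
    (1 - 4 * \<delta>) * ln (real (n ^ m * (m * n choose n))) \<le> ln (card (dope_matrices m n))"
proof -
  \<comment> \<open>The sizes of \<open>n\<close> at which bounded amounts and lower powers of \<open>n\<close> are absorbed by \<open>\<delta>\<close>.\<close>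
  have "eventually (\<lambda>n. 1 \<le> \<delta> * real n) at_top"
    "eventually (\<lambda>n. 1 \<le> \<delta> * sqrt (real n)) at_top"
    "eventually (\<lambda>n. - ln \<delta> \<le> \<delta> * (ln (real n) / 2)) at_top"
    "eventually (\<lambda>n. - \<delta> * ln (real n) \<le> ln (\<delta>\<^sup>2 / 4)) at_top"
    "eventually (\<lambda>n. 1 \<le> \<delta> * (ln (real n) / 2)) at_top"
    "eventually (\<lambda>n. real n * sqrt (real n) \<le> \<delta>\<^sup>2 * (real n)\<^sup>2 / 4) at_top"
    "eventually (\<lambda>n. 2 * ln (real n) + 1 \<le> \<delta> * sqrt (real n) * ln (real n)) at_top"
    using \<delta> by real_asymp+
  then have "eventually (\<lambda>n. 1 \<le> \<delta> * real n \<and> 1 \<le> \<delta> * sqrt (real n) \<and>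
      - ln \<delta> \<le> \<delta> * (ln (real n) / 2) \<and> - \<delta> * ln (real n) \<le> ln (\<delta>\<^sup>2 / 4) \<and>
      1 \<le> \<delta> * (ln (real n) / 2) \<and> real n * sqrt (real n) \<le> \<delta>\<^sup>2 * (real n)\<^sup>2 / 4 \<and>
      2 * ln (real n) + 1 \<le> \<delta> * sqrt (real n) * ln (real n)) at_top"
    by (intro eventually_conj)
  then obtain N where N: "\<And>n. n \<ge> N \<Longrightarrow> 1 \<le> \<delta> * real n \<and> 1 \<le> \<delta> * sqrt (real n) \<and>
      - ln \<delta> \<le> \<delta> * (ln (real n) / 2) \<and> - \<delta> * ln (real n) \<le> ln (\<delta>\<^sup>2 / 4) \<and>
      1 \<le> \<delta> * (ln (real n) / 2) \<and> real n * sqrt (real n) \<le> \<delta>\<^sup>2 * (real n)\<^sup>2 / 4 \<and>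
      2 * ln (real n) + 1 \<le> \<delta> * sqrt (real n) * ln (real n)"
    by (auto simp: eventually_at_top_linorder)
  show ?thesis
  proof (intro exI[of _ "max N 2"] allI impI)
    fix n m :: nat
    assume nm: "max N 2 \<le> n" "2 \<le> m" "sqrt n < real m" "2 * m \<le> n * (n + 1)"
    let ?C = "m * n choose n" and ?c = "card (dope_matrices m n)"
    define L where "L = ln (real n)"
    define K where "K = ln (real m)"
    have n2: "n \<ge> 2" and E: "1 \<le> \<delta> * real n" "1 \<le> \<delta> * sqrt (real n)" "- ln \<delta> \<le> \<delta> * (L / 2)"
      "- \<delta> * L \<le> ln (\<delta>\<^sup>2 / 4)" "1 \<le> \<delta> * (L / 2)" "real n * sqrt (real n) \<le> \<delta>\<^sup>2 * (real n)\<^sup>2 / 4"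
      "2 * L + 1 \<le> \<delta> * sqrt (real n) * L"
      using N[of n] nm unfolding L_def by auto
    have L0: "L > 0" using n2 by (simp add: L_def)
    have "ln (sqrt n) \<le> K" unfolding K_def using nm n2 by (subst ln_le_cancel_iff) auto
    then have KL: "L / 2 \<le> K" using n2 by (simp add: L_def ln_sqrt)
    have "n * (n + 1) \<le> 2 * (n * n)" using n2 by simp
    then have "m \<le> n * n" using nm(4) by linarith
    then have "K \<le> ln (real (n * n))"
      unfolding K_def using nm n2 by (subst ln_le_cancel_iff) (auto simp del: of_nat_mult)
    then have K2: "K \<le> 2 * L" using n2 by (simp add: L_def ln_mult)
    have dm: "1 \<le> \<delta> * m" using E(2) nm(3) \<delta> by (smt (verit) mult_left_mono)
    define b where "b = \<delta>\<^sup>2 * n / 4"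
    have b0: "b > 0" using \<delta> n2 by (simp add: b_def)
    have "ln b = ln (\<delta>\<^sup>2 / 4) + L" using \<delta> n2 by (simp add: b_def L_def ln_mult ln_div)
    then have lnb: "(1 - \<delta>) * L \<le> ln b" using E(4) by (simp add: algebra_simps)
    have T: "ln (real (n ^ m * ?C)) \<le> m * L + n * K + n"
      using ln_binomial_bounds(2)[of n m] ln_pow_mult_binomial[of n m m] nm n2
      by (simp add: L_def K_def)
    have coef: "(1 - 4 * \<delta>) * (1 + \<delta>) \<le> (1 - 2 * \<delta>) * (1 - \<delta>)"
      using \<delta> by (simp add: algebra_simps)
    show "(1 - 4 * \<delta>) * ln (real (n ^ m * ?C)) \<le> ln ?c"
    proof (cases "real m \<le> real n * sqrt n")
      case True
      \<comment> \<open>Small shares \<open>k\<close> and \<open>m1\<close> of \<open>n\<close> and \<open>m\<close> have logarithms close to \<open>ln n\<close> and \<open>ln m\<close>, while almost all of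
        \<open>n\<close> and \<open>m\<close> is left for the exponents \<open>a\<close> and \<open>m2\<close>; there are far more than \<open>m\<close> roots.\<close>
      define k where "k = nat \<lceil>\<delta> * n\<rceil>"
      define a where "a = n - k"
      define m1 where "m1 = nat \<lceil>\<delta> * m\<rceil>"
      define m2 where "m2 = m - m1"
      have "0 \<le> \<delta> * n" "0 \<le> \<delta> * m" using \<delta> by auto
      then have k: "\<delta> * n \<le> k" "k \<le> \<delta> * n + 1" and m1: "\<delta> * m \<le> m1" "m1 \<le> \<delta> * m + 1"
        unfolding k_def m1_def by linarith+
      have kn: "k \<le> n"
      proof -
        have "\<delta> * n + 1 \<le> 2 * (\<delta> * n)" using E(1) by simp
        also have "\<dots> \<le> n" using \<delta> mult_right_mono[of "2 * \<delta>" 1 "real n"] by simp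
        finally show ?thesis using k(2) by linarith
      qed
      have mm: "m1 \<le> m"
      proof -
        have "\<delta> * m + 1 \<le> 2 * (\<delta> * m)" using dm by simp
        also have "\<dots> \<le> m" using \<delta> mult_right_mono[of "2 * \<delta>" 1 "real m"] by simp
        finally show ?thesis using m1(2) by linarith
      qed
      have k0: "0 < k" using k(1) E(1) by (cases k) auto
      have m10: "0 < m1" using m1(1) dm by (cases m1) auto
      have "real m2 + b * k \<le> k * (k + 1) / 2"
      proof -
        have "real m2 \<le> \<delta>\<^sup>2 * (real n)\<^sup>2 / 4" using True E(6) by (simp add: m2_def)
        also have "\<dots> = (\<delta> * n) * (\<delta> * n) / 4" by (simp add: power2_eq_square)
        also have "(\<delta> * n) * (\<delta> * n) \<le> real k * real k" using k(1) \<delta> by (intro mult_mono) simp_all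
        finally have 1: "real m2 \<le> k * k / 4" by simp
        have "b = \<delta> * (\<delta> * n) / 4" by (simp add: b_def power2_eq_square)
        also have "\<dots> \<le> 1 * real k / 4" using k(1) \<delta> by (intro divide_right_mono mult_mono) auto
        finally have "b * k \<le> k / 4 * k" by (intro mult_right_mono) auto
        then show ?thesis using 1 by (simp add: field_simps)
      qed
      then have "a * ln m1 + m2 * ln b \<le> ln ?c"
        using k0 kn mm m10 b0 by (intro two_parts_ln_le[of a k n m1 m2]) (auto simp: a_def m2_def)
      moreover have "(1 - 2 * \<delta>) * (1 - \<delta>) * (n * K) \<le> a * ln m1"
      proof -
        have "ln \<delta> + K = ln (\<delta> * m)" using \<delta> nm by (simp add: K_def ln_mult)
        also have "\<dots> \<le> ln m1" using m1(1) m10 \<delta> nm by (subst ln_le_cancel_iff) auto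
        finally have "ln \<delta> + K \<le> ln m1" .
        moreover have "\<delta> * (L / 2) \<le> \<delta> * K" using KL \<delta> by (intro mult_left_mono) auto
        ultimately have "(1 - \<delta>) * K \<le> ln m1" using E(3) by (simp add: algebra_simps)
        moreover have "(1 - 2 * \<delta>) * n \<le> a" using k(2) E(1) kn by (simp add: a_def of_nat_diff algebra_simps)
        ultimately have "((1 - 2 * \<delta>) * n) * ((1 - \<delta>) * K) \<le> a * ln m1"
          using \<delta> KL L0 by (intro mult_mono) auto
        then show ?thesis by (simp add: mult_ac)
      qed
      moreover have "(1 - 2 * \<delta>) * (1 - \<delta>) * (m * L) \<le> m2 * ln b"
      proof -
        have "(1 - 2 * \<delta>) * m \<le> m2" using m1(2) dm mm by (simp add: m2_def of_nat_diff algebra_simps)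
        then have "((1 - 2 * \<delta>) * m) * ((1 - \<delta>) * L) \<le> m2 * ln b"
          using lnb \<delta> L0 by (intro mult_mono) auto
        then show ?thesis by (simp add: mult_ac)
      qed
      ultimately have "(1 - 2 * \<delta>) * (1 - \<delta>) * (m * L + n * K) \<le> ln ?c" by (simp add: distrib_left)
      moreover have "ln (real (n ^ m * ?C)) \<le> (1 + \<delta>) * (m * L + n * K)"
      proof -
        have "\<delta> * (L / 2) \<le> \<delta> * K" using KL \<delta> by (intro mult_left_mono) simp_all
        then have "1 \<le> \<delta> * K" using E(5) by linarith
        then have "real n * 1 \<le> n * (\<delta> * K)" by (intro mult_left_mono) auto
        moreover have "0 \<le> \<delta> * (m * L)" using \<delta> L0 by simp
        ultimately show ?thesis using T by (simp add: algebra_simps)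
      qed
      then have "(1 - 4 * \<delta>) * ln (real (n ^ m * ?C)) \<le> (1 - 4 * \<delta>) * ((1 + \<delta>) * (m * L + n * K))"
        using \<delta> by (intro mult_left_mono) auto
      moreover have "(1 - 4 * \<delta>) * (1 + \<delta>) * (m * L + n * K) \<le> (1 - 2 * \<delta>) * (1 - \<delta>) * (m * L + n * K)"
        using coef L0 KL by (intro mult_right_mono) auto
      ultimately show ?thesis by (simp add: mult.assoc)
    next
      case False
      \<comment> \<open>Here \<open>m\<close> may be as large as the number \<open>n (n + 1) / 2\<close> of roots, so a share of \<open>\<delta>\<close> of the points
        is given up to keep roots in reserve.\<close>
      define m2 where "m2 = nat \<lfloor>(1 - \<delta>) * m\<rfloor>"
      have "0 \<le> (1 - \<delta>) * m" using \<delta> by auto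
      then have m2: "m2 \<le> (1 - \<delta>) * m" "(1 - \<delta>) * m - 1 \<le> m2" unfolding m2_def by linarith+
      have "(1 - \<delta>) * m \<le> 1 * real m" using \<delta> by (intro mult_right_mono) auto
      then have m2m: "m2 \<le> m" using m2(1) by linarith
      have "real m2 + b * n \<le> n * (n + 1) / 2"
      proof -
        have "real (2 * m) \<le> real (n * (n + 1))" using nm(4) by (rule of_nat_mono)
        then have "(1 - \<delta>) * m \<le> (1 - \<delta>) * (n * (n + 1) / 2)" using \<delta> by (intro mult_left_mono) auto
        moreover have "b * n \<le> \<delta> * (n * (n + 1) / 2)"
        proof -
          have "b * n = \<delta> * (\<delta> / 2) * (n * n / 2)" by (simp add: b_def power2_eq_square)
          also have "\<dots> \<le> \<delta> * 1 * (n * (n + 1) / 2)" using \<delta> by (intro mult_mono) auto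
          finally show ?thesis by simp
        qed
        ultimately show ?thesis using m2(1) by (simp add: algebra_simps)
      qed
      then have "m2 * ln b \<le> ln ?c"
        using two_parts_ln_le[of 0 n n 0 m2 m b] n2 b0 m2m by simp
      moreover have "(1 - 2 * \<delta>) * (1 - \<delta>) * (m * L) \<le> m2 * ln b"
      proof -
        have "(1 - 2 * \<delta>) * m \<le> m2" using m2(2) dm by (simp add: algebra_simps)
        then have "((1 - 2 * \<delta>) * m) * ((1 - \<delta>) * L) \<le> m2 * ln b"
          using lnb \<delta> L0 by (intro mult_mono) auto
        then show ?thesis by (simp add: mult_ac)
      qed
      moreover have "ln (real (n ^ m * ?C)) \<le> (1 + \<delta>) * (m * L)"
      proof -
        have "n * K + n \<le> n * (2 * L + 1)" using mult_left_mono[OF K2, of "real n"] by (simp add: algebra_simps)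
        also have "\<dots> \<le> n * (\<delta> * sqrt n * L)" using E(7) by (intro mult_left_mono) auto
        also have "\<dots> = \<delta> * L * (n * sqrt n)" by simp
        also have "\<dots> \<le> \<delta> * L * m" using False \<delta> L0 by (intro mult_left_mono) auto
        finally show ?thesis using T by (simp add: algebra_simps)
      qed
      then have "(1 - 4 * \<delta>) * ln (real (n ^ m * ?C)) \<le> (1 - 4 * \<delta>) * ((1 + \<delta>) * (m * L))"
        using \<delta> by (intro mult_left_mono) auto
      moreover have "(1 - 4 * \<delta>) * (1 + \<delta>) * (m * L) \<le> (1 - 2 * \<delta>) * (1 - \<delta>) * (m * L)"
        using coef L0 by (intro mult_right_mono) auto
      ultimately show ?thesis by (simp add: mult.assoc)
    qed
  qed
qed

lemma ln_card_dope_matrices_lower: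
  assumes "\<epsilon> > 0"
  shows "\<exists>N. \<forall>n\<ge>N. \<forall>m\<ge>2. 2 * m \<le> n * (n + 1) \<longrightarrow>
    (1 - \<epsilon>) * ln (real (n ^ m * (m * n choose n))) \<le> ln (card (dope_matrices m n))"
proof -
  define \<delta> where "\<delta> = min (\<epsilon> / 4) (1 / 8)"
  have \<delta>: "0 < \<delta>" "\<delta> < 1 / 4" "4 * \<delta> \<le> \<epsilon>" "4 * \<delta> < 1" using assms by (auto simp: \<delta>_def)
  obtain N1 where N1: "\<And>n m. n \<ge> N1 \<Longrightarrow> m \<ge> 2 \<Longrightarrow> real m \<le> sqrt n \<Longrightarrow>
      (1 - 4 * \<delta>) * ln (real (n ^ m * (m * n choose n))) \<le> ln (card (dope_matrices m n))"
    using ln_card_dope_matrices_few_points[of "4 * \<delta>"] \<delta> by auto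
  obtain N2 where N2: "\<And>n m. n \<ge> N2 \<Longrightarrow> m \<ge> 2 \<Longrightarrow> sqrt n < real m \<Longrightarrow> 2 * m \<le> n * (n + 1) \<Longrightarrow>
      (1 - 4 * \<delta>) * ln (real (n ^ m * (m * n choose n))) \<le> ln (card (dope_matrices m n))"
    using ln_card_dope_matrices_many_points[OF \<delta>(1,2)] by auto
  show ?thesis
  proof (intro exI[of _ "max (max N1 N2) 1"] allI impI)
    fix n m :: nat assume nm: "max (max N1 N2) 1 \<le> n" "2 \<le> m" "2 * m \<le> n * (n + 1)"
    have "1 \<le> n ^ m * (m * n choose n)" using nm by (simp add: Suc_le_eq)
    then have "1 \<le> real (n ^ m * (m * n choose n))" by linarith
    then have "(1 - \<epsilon>) * ln (real (n ^ m * (m * n choose n))) \<le>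
        (1 - 4 * \<delta>) * ln (real (n ^ m * (m * n choose n)))"
      using \<delta>(3) by (intro mult_right_mono ln_ge_zero) auto
    also have "\<dots> \<le> ln (card (dope_matrices m n))"
      using N1[of n m] N2[of n m] nm by (cases "real m \<le> sqrt n") auto
    finally show "(1 - \<epsilon>) * ln (real (n ^ m * (m * n choose n))) \<le> ln (card (dope_matrices m n))" .
  qed
qed

theorem theorem1p3:
  fixes m n :: "nat \<Rightarrow> nat"
  assumes pos: "\<And>t. t > 0 \<Longrightarrow> m t > 0 \<and> n t > 0"
    and n_lim: "filterlim n at_top sequentially"
    and m_gt: "\<And>t. t > 0 \<Longrightarrow> 1 < m t"
    and m_le: "\<And>t. t > 0 \<Longrightarrow> real (m t) \<le> (real (n t) ^ 2 + real (n t)) / 2"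
  shows "\<exists>\<epsilon>\<^sub>1 \<epsilon>\<^sub>2 :: nat \<Rightarrow> real. \<epsilon>\<^sub>1 \<longlonglongrightarrow> 0 \<and> \<epsilon>\<^sub>2 \<longlonglongrightarrow> 0 \<and>
    (\<forall>t>0.
      (1 + \<epsilon>\<^sub>1 t) * ln (real (n t ^ m t * ((m t * n t) choose n t)))
        \<le> ln (real (card (dope_matrices (m t) (n t)))) \<and>
      ln (real (card (dope_matrices (m t) (n t))))
        \<le> (1 + \<epsilon>\<^sub>2 t) * ln (real (n t ^ (2 * m t) * ((m t * n t) choose n t))))"
proof -
  define c where "c = (\<lambda>t. ln (real (card (dope_matrices (m t) (n t)))))"
  define A where "A = (\<lambda>t. ln (real (n t ^ m t * ((m t * n t) choose n t))))"
  define B where "B = (\<lambda>t. ln (real (n t ^ (2 * m t) * ((m t * n t) choose n t))))"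
  define \<epsilon>1 where "\<epsilon>1 = (\<lambda>t. min 0 (c t / A t - 1))"
  define \<epsilon>2 where "\<epsilon>2 = (\<lambda>t. max 0 (c t / B t - 1))"
  have m2: "2 \<le> m t" if "t > 0" for t using m_gt[OF that] by simp
  have mn: "2 * m t \<le> n t * (n t + 1)" if "t > 0" for t
  proof -
    have "real (2 * m t) \<le> real (n t * (n t + 1))"
      using m_le[OF that] by (simp add: power2_eq_square algebra_simps)
    then show ?thesis by (simp only: of_nat_le_iff)
  qed
  have n2: "2 \<le> n t" if "t > 0" for t
  proof (rule ccontr)
    assume "\<not> 2 \<le> n t"
    then have "n t = 1" using pos[OF that] by simp
    then show False using mn[OF that] m2[OF that] by simp
  qed
  have AB: "A t > 0" "B t > 0" if "t > 0" for t
  proof -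
    have "0 \<le> n t * ln (m t)" using m2[OF that] by simp
    also have "\<dots> \<le> ln (m t * n t choose n t)"
      using m2[OF that] n2[OF that] by (intro ln_binomial_bounds(1)) auto
    finally have "0 \<le> ln (m t * n t choose n t)" .
    moreover have "0 < e * ln (n t)" if "e > 0" for e :: nat using that n2[OF \<open>t > 0\<close>] by simp
    ultimately have "0 < ln (real (n t ^ e * (m t * n t choose n t)))" if "e > 0" for e :: nat
      using that m2[OF \<open>t > 0\<close>] n2[OF \<open>t > 0\<close>]
      by (subst ln_pow_mult_binomial) (auto intro!: add_pos_nonneg)
    then show "A t > 0" "B t > 0" unfolding A_def B_def using m2[OF that] by auto
  qed
  have ev: "eventually (\<lambda>t. n t \<ge> N \<and> t > 0) sequentially" for N
    using n_lim eventually_gt_at_top[of 0] by (auto simp: filterlim_at_top eventually_conj_iff)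
  have lim1: "\<epsilon>1 \<longlonglongrightarrow> 0"
  proof (rule tendstoI)
    fix e :: real assume "e > 0"
    then obtain N where N: "\<And>n m. n \<ge> N \<Longrightarrow> m \<ge> 2 \<Longrightarrow> 2 * m \<le> n * (n + 1) \<Longrightarrow>
      (1 - e / 2) * ln (real (n ^ m * (m * n choose n))) \<le> ln (card (dope_matrices m n))"
      using ln_card_dope_matrices_lower[of "e / 2"] by auto
    show "eventually (\<lambda>t. dist (\<epsilon>1 t) 0 < e) sequentially"
      using ev[of N]
    proof eventually_elim
      case (elim t)
      then have "(1 - e / 2) * A t \<le> c t" using N[of "n t" "m t"] m2 mn by (simp add: A_def c_def)
      then have "1 - e / 2 \<le> c t / A t" using AB(1)[of t] elim by (simp add: pos_le_divide_eq)
      then show ?case using \<open>e > 0\<close> by (auto simp: \<epsilon>1_def dist_real_def)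
    qed
  qed
  have lim2: "\<epsilon>2 \<longlonglongrightarrow> 0"
  proof (rule tendstoI)
    fix e :: real assume "e > 0"
    then obtain N where N: "\<And>n m. n \<ge> N \<Longrightarrow> m \<ge> 2 \<Longrightarrow> 2 * m \<le> n * (n + 1) \<Longrightarrow>
      ln (card (dope_matrices m n)) \<le> (1 + e / 2) * ln (real (n ^ (2 * m) * (m * n choose n)))"
      using ln_card_dope_matrices_upper[of "e / 2"] by auto
    show "eventually (\<lambda>t. dist (\<epsilon>2 t) 0 < e) sequentially"
      using ev[of N]
    proof eventually_elim
      case (elim t)
      then have "c t \<le> (1 + e / 2) * B t" using N[of "n t" "m t"] m2 mn by (simp add: B_def c_def)
      then have "c t / B t \<le> 1 + e / 2" using AB(2)[of t] elim by (simp add: pos_divide_le_eq)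
      then show ?case using \<open>e > 0\<close> by (auto simp: \<epsilon>2_def dist_real_def)
    qed
  qed
  have "(1 + \<epsilon>1 t) * A t \<le> c t" "c t \<le> (1 + \<epsilon>2 t) * B t" if "t > 0" for t
  proof -
    have "(1 + \<epsilon>1 t) * A t \<le> (c t / A t) * A t"
      using AB(1)[OF that] by (intro mult_right_mono) (auto simp: \<epsilon>1_def)
    then show "(1 + \<epsilon>1 t) * A t \<le> c t" using AB(1)[OF that] by simp
    have "(c t / B t) * B t \<le> (1 + \<epsilon>2 t) * B t"
      using AB(2)[OF that] by (intro mult_right_mono) (auto simp: \<epsilon>2_def)
    then show "c t \<le> (1 + \<epsilon>2 t) * B t" using AB(2)[OF that] by simp
  qed
  then show ?thesis using lim1 lim2 unfolding A_def B_def c_def by blast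
qed

end
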